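(* Let $x=x_1,\dots,x_n$ be an $n$-tuple of elements in an $A$-algebra $R$, and let $\mathcal A=\mathrm{TS}^n_AR[\alpha^2(x)^{-1}]\to\mathcal R=\mathrm{TS}^{n-1,1}_AR[\alpha^2(x)^{-1}]$. The discriminant of the extension $\mathcal A\to\mathcal R$ (with respect to the $\mathcal A$-module basis $\varphi_n(x_1),\dots,\varphi_n(x_n)$ of $\mathcal R$) is $\alpha^2(x)$. In particular $\mathcal A\to\mathcal R$ is étale.
   Context: All rings are commutative with unit; $n\ge1$. $\mathrm T^n_AR=R\otimes_A\cdots\otimes_AR$ ($n$ factors), and $\varphi_p:R\to\mathrm T^n_AR$ is the co-projection on the $p$-th factor. The symmetric group $\mathfrak S_n$ permutes the factors; $\mathrm{TS}^n_AR=(\mathrm T^n_AR)^{\mathfrak S_n}$, and $\mathrm{TS}^{n-1,1}_AR=(\mathrm T^n_AR)^{\mathfrak S_{n-1}}$, where $\mathfrak S_{n-1}$ permutes the first $n-1$ factors. The alternating tensor is $\alpha(x)=\sum_{\sigma\in\mathfrak S_n}(-1)^{|\sigma|}x_{\sigma(1)}\otimes\cdots\otimes x_{\sigma(n)}\in\mathrm T^n_AR$; its square $\alpha^2(x)$ lies in $\mathrm{TS}^n_AR$, and the brackets denote localization at this element. The ring $\mathcal R$ is a free $\mathcal A$-module with basis $\varphi_n(x_1),\dots,\varphi_n(x_n)$. For a ring homomorphism $B\to E$ with $E$ free over $B$ with basis $e_1,\dots,e_n$, the discriminant with respect to that basis is the determinant in $B$ of the $(n\times n)$-matrix whose $(i,j)$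 entry is the trace of the $B$-linear map $E\to E$, $z\mapsto z\cdot e_ie_j$. *)

theory Defs
  imports "HOL-Algebra.Algebra"
begin

section \<open>Monoid algebras, tensor powers\<close>

text \<open>The monoid algebra over \<open>A\<close> of a commutative monoid \<open>G\<close>: finitely supported functions
  on \<open>carrier G\<close> (equal to zero off \<open>carrier G\<close>) with convolution product.\<close>

definition monoid_algebra ::
    "('a, 'k) ring_scheme \<Rightarrow> ('g, 'l) monoid_scheme \<Rightarrow> ('g \<Rightarrow> 'a) ring" where
  "monoid_algebra A G =
    \<lparr>carrier = {f. (\<forall>g\<in>carrier G. f g \<in> carrier A) \<and> (\<forall>g. g \<notin> carrier G \<longrightarrow> f g = \<zero>\<^bsub>A\<^esub>)
                 \<and> finite {g. f g \<noteq> \<zero>\<^bsub>A\<^esub>}},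
     monoid.mult = (\<lambda>f f' g. \<Oplus>\<^bsub>A\<^esub>p\<in>{(u, v). f u \<noteq> \<zero>\<^bsub>A\<^esub> \<and> f' v \<noteq> \<zero>\<^bsub>A\<^esub> \<and> u \<otimes>\<^bsub>G\<^esub> v = g}.
               f (fst p) \<otimes>\<^bsub>A\<^esub> f' (snd p)),
     one = (\<lambda>g. if g = \<one>\<^bsub>G\<^esub> then \<one>\<^bsub>A\<^esub> else \<zero>\<^bsub>A\<^esub>),
     ring.zero = (\<lambda>g. \<zero>\<^bsub>A\<^esub>),
     add = (\<lambda>f f' g. f g \<oplus>\<^bsub>A\<^esub> f' g)\<rparr>"

definition monoid_algebra_single :: "('a, 'k) ring_scheme \<Rightarrow> 'g \<Rightarrow> 'a \<Rightarrow> 'g \<Rightarrow> 'a" where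
  "monoid_algebra_single A g a = (\<lambda>u. if u = g then a else \<zero>\<^bsub>A\<^esub>)"

definition tuple_monoid :: "('r, 'k) monoid_scheme \<Rightarrow> nat \<Rightarrow> (nat \<Rightarrow> 'r) monoid" where
  "tuple_monoid R n =
    \<lparr>carrier = {1..n} \<rightarrow>\<^sub>E carrier R,
     monoid.mult = (\<lambda>x y. \<lambda>i\<in>{1..n}. x i \<otimes>\<^bsub>R\<^esub> y i),
     one = (\<lambda>i\<in>{1..n}. \<one>\<^bsub>R\<^esub>)\<rparr>"

definition multilinear_relations ::
    "('a, 'k) ring_scheme \<Rightarrow> ('a, 'r, 'l) module_scheme \<Rightarrow> nat \<Rightarrow> ((nat \<Rightarrow> 'r) \<Rightarrow> 'a) set" where
  "multilinear_relations A R n =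
    (let F = monoid_algebra A (tuple_monoid R n); s = monoid_algebra_single A in
     {s (x(i := y \<oplus>\<^bsub>R\<^esub> z)) \<one>\<^bsub>A\<^esub> \<ominus>\<^bsub>F\<^esub> (s (x(i := y)) \<one>\<^bsub>A\<^esub> \<oplus>\<^bsub>F\<^esub> s (x(i := z)) \<one>\<^bsub>A\<^esub>) | x i y z.
        x \<in> {1..n} \<rightarrow>\<^sub>E carrier R \<and> i \<in> {1..n} \<and> y \<in> carrier R \<and> z \<in> carrier R}
     \<union> {s (x(i := a \<odot>\<^bsub>R\<^esub> y)) \<one>\<^bsub>A\<^esub> \<ominus>\<^bsub>F\<^esub> s (x(i := y)) a | x i a y.
        x \<in> {1..n} \<rightarrow>\<^sub>E carrier R \<and> i \<in> {1..n} \<and> a \<in> carrier A \<and> y \<in> carrier R})"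

text \<open>The free \<open>A\<close>-module on \<open>R\<^sup>n\<close> modulo the multilinear relations. A relation times a tuple is
  again a relation, so the ideal generated by the relations in the monoid algebra of \<open>R\<^sup>n\<close> is
  their \<open>A\<close>-span, and the product on the quotient is the factorwise one.\<close>

definition tensor_ideal ::
    "('a, 'k) ring_scheme \<Rightarrow> ('a, 'r, 'l) module_scheme \<Rightarrow> nat \<Rightarrow> ((nat \<Rightarrow> 'r) \<Rightarrow> 'a) set" where
  "tensor_ideal A R n =
    Idl\<^bsub>monoid_algebra A (tuple_monoid R n)\<^esub> (multilinear_relations A R n)"

definition tensor_power ::
    "('a, 'k) ring_scheme \<Rightarrow> ('a, 'r, 'l) module_scheme \<Rightarrow> nat \<Rightarrow> ((nat \<Rightarrow> 'r) \<Rightarrow> 'a) set ring" where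
  "tensor_power A R n = monoid_algebra A (tuple_monoid R n) Quot tensor_ideal A R n"

text \<open>The pure tensor \<open>x 1 \<otimes> \<dots> \<otimes> x n\<close>.\<close>

definition pure_tensor ::
    "('a, 'k) ring_scheme \<Rightarrow> ('a, 'r, 'l) module_scheme \<Rightarrow> nat \<Rightarrow> (nat \<Rightarrow> 'r)
      \<Rightarrow> ((nat \<Rightarrow> 'r) \<Rightarrow> 'a) set" where
  "pure_tensor A R n x =
    tensor_ideal A R n +>\<^bsub>monoid_algebra A (tuple_monoid R n)\<^esub>
      monoid_algebra_single A (restrict x {1..n}) \<one>\<^bsub>A\<^esub>"

definition coprojection ::
    "('a, 'k) ring_scheme \<Rightarrow> ('a, 'r, 'l) module_scheme \<Rightarrow> nat \<Rightarrow> nat \<Rightarrow> 'r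
      \<Rightarrow> ((nat \<Rightarrow> 'r) \<Rightarrow> 'a) set" where
  "coprojection A R n p r = pure_tensor A R n (\<lambda>i. if i = p then r else \<one>\<^bsub>R\<^esub>)"

text \<open>Elements of the tensor power are cosets of functions on tuples. Precomposition with
  \<open>x \<mapsto> x \<circ> \<sigma>\<close> sends the basis element of a tuple \<open>y\<close> to that of \<open>y \<circ> \<sigma>\<^sup>-\<^sup>1\<close>, so \<open>\<sigma>\<close> moves the
  factor in position \<open>i\<close> to position \<open>\<sigma> i\<close>.\<close>

definition permute_factors ::
    "(nat \<Rightarrow> nat) \<Rightarrow> ((nat \<Rightarrow> 'r) \<Rightarrow> 'a) set \<Rightarrow> ((nat \<Rightarrow> 'r) \<Rightarrow> 'a) set" where
  "permute_factors \<sigma> t = (\<lambda>f x. f (x \<circ> \<sigma>)) ` t"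

definition tensor_invariants ::
    "('a, 'k) ring_scheme \<Rightarrow> ('a, 'r, 'l) module_scheme \<Rightarrow> nat \<Rightarrow> nat set
      \<Rightarrow> ((nat \<Rightarrow> 'r) \<Rightarrow> 'a) set ring" where
  "tensor_invariants A R n P =
    (tensor_power A R n)\<lparr>carrier :=
      {t \<in> carrier (tensor_power A R n). \<forall>\<sigma>. \<sigma> permutes P \<longrightarrow> permute_factors \<sigma> t = t}\<rparr>"

definition TS ::
    "('a, 'k) ring_scheme \<Rightarrow> ('a, 'r, 'l) module_scheme \<Rightarrow> nat \<Rightarrow> ((nat \<Rightarrow> 'r) \<Rightarrow> 'a) set ring" where
  "TS A R n = tensor_invariants A R n {1..n}"

text \<open>\<open>TS1 A R n\<close> is \<open>TS\<^sup>n\<^sup>-\<^sup>1\<^sup>,\<^sup>1\<close>.\<close>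

definition TS1 ::
    "('a, 'k) ring_scheme \<Rightarrow> ('a, 'r, 'l) module_scheme \<Rightarrow> nat \<Rightarrow> ((nat \<Rightarrow> 'r) \<Rightarrow> 'a) set ring" where
  "TS1 A R n = tensor_invariants A R n {1..n - 1}"

definition alternating_tensor ::
    "('a, 'k) ring_scheme \<Rightarrow> ('a, 'r, 'l) module_scheme \<Rightarrow> nat \<Rightarrow> (nat \<Rightarrow> 'r)
      \<Rightarrow> ((nat \<Rightarrow> 'r) \<Rightarrow> 'a) set" where
  "alternating_tensor A R n x =
    (\<Oplus>\<^bsub>tensor_power A R n\<^esub>\<sigma>\<in>{\<sigma>. \<sigma> permutes {1..n}}.
       [sign \<sigma>] \<cdot>\<^bsub>tensor_power A R n\<^esub> pure_tensor A R n (\<lambda>i. x (\<sigma> i)))"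

definition alternating_tensor_sq ::
    "('a, 'k) ring_scheme \<Rightarrow> ('a, 'r, 'l) module_scheme \<Rightarrow> nat \<Rightarrow> (nat \<Rightarrow> 'r)
      \<Rightarrow> ((nat \<Rightarrow> 'r) \<Rightarrow> 'a) set" where
  "alternating_tensor_sq A R n x =
    alternating_tensor A R n x [^]\<^bsub>tensor_power A R n\<^esub> (2::nat)"


section \<open>Localization at an element\<close>

definition powers_of :: "('b, 'k) ring_scheme \<Rightarrow> 'b \<Rightarrow> 'b set" where
  "powers_of B f = range (\<lambda>k :: nat. f [^]\<^bsub>B\<^esub> k)"

text \<open>The fraction \<open>r / s\<close> as an equivalence class of pairs.\<close>

definition loc_frac :: "('b, 'k) ring_scheme \<Rightarrow> 'b \<Rightarrow> 'b \<Rightarrow> 'b \<Rightarrow> ('b \<times> 'b) set" where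
  "loc_frac B f r s =
    {(r', s'). r' \<in> carrier B \<and> s' \<in> powers_of B f \<and>
       (\<exists>t\<in>powers_of B f. t \<otimes>\<^bsub>B\<^esub> (s' \<otimes>\<^bsub>B\<^esub> r) = t \<otimes>\<^bsub>B\<^esub> (s \<otimes>\<^bsub>B\<^esub> r'))}"

definition localization :: "('b, 'k) ring_scheme \<Rightarrow> 'b \<Rightarrow> ('b \<times> 'b) set ring" where
  "localization B f =
    \<lparr>carrier = {loc_frac B f r s | r s. r \<in> carrier B \<and> s \<in> powers_of B f},
     monoid.mult = (\<lambda>p q. \<Union>(r, s)\<in>p. \<Union>(r', s')\<in>q. loc_frac B f (r \<otimes>\<^bsub>B\<^esub> r') (s \<otimes>\<^bsub>B\<^esub> s')),
     one = loc_frac B f \<one>\<^bsub>B\<^esub> \<one>\<^bsub>B\<^esub>,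
     ring.zero = loc_frac B f \<zero>\<^bsub>B\<^esub> \<one>\<^bsub>B\<^esub>,
     add = (\<lambda>p q. \<Union>(r, s)\<in>p. \<Union>(r', s')\<in>q.
              loc_frac B f (s' \<otimes>\<^bsub>B\<^esub> r \<oplus>\<^bsub>B\<^esub> s \<otimes>\<^bsub>B\<^esub> r') (s \<otimes>\<^bsub>B\<^esub> s'))\<rparr>"

definition to_loc :: "('b, 'k) ring_scheme \<Rightarrow> 'b \<Rightarrow> 'b \<Rightarrow> ('b \<times> 'b) set" where
  "to_loc B f r = loc_frac B f r \<one>\<^bsub>B\<^esub>"

text \<open>The map of localizations induced by the inclusion of a subring containing \<open>f\<close> into \<open>E\<close>.\<close>

definition loc_inclusion ::
    "('b, 'k) ring_scheme \<Rightarrow> 'b \<Rightarrow> ('b \<times> 'b) set \<Rightarrow> ('b \<times> 'b) set" where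
  "loc_inclusion E f p = (\<Union>(r, s)\<in>p. loc_frac E f r s)"


section \<open>Free extensions and the discriminant\<close>

text \<open>A ring homomorphism \<open>h\<close> from \<open>B\<close> to \<open>E\<close> makes \<open>E\<close> a \<open>B\<close>-module; \<open>e 1, \<dots>, e n\<close> is a
  tuple of elements of \<open>E\<close>.\<close>

definition is_coordinates ::
    "('b, 'k) ring_scheme \<Rightarrow> ('e, 'l) ring_scheme \<Rightarrow> ('b \<Rightarrow> 'e) \<Rightarrow> nat \<Rightarrow> (nat \<Rightarrow> 'e)
      \<Rightarrow> 'e \<Rightarrow> (nat \<Rightarrow> 'b) \<Rightarrow> bool" where
  "is_coordinates B E h n e z c \<longleftrightarrow>
    c \<in> {1..n} \<rightarrow>\<^sub>E carrier B \<and> z = (\<Oplus>\<^bsub>E\<^esub>i\<in>{1..n}. h (c i) \<otimes>\<^bsub>E\<^esub> e i)"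

definition is_module_basis ::
    "('b, 'k) ring_scheme \<Rightarrow> ('e, 'l) ring_scheme \<Rightarrow> ('b \<Rightarrow> 'e) \<Rightarrow> nat \<Rightarrow> (nat \<Rightarrow> 'e) \<Rightarrow> bool" where
  "is_module_basis B E h n e \<longleftrightarrow>
    e \<in> {1..n} \<rightarrow> carrier E \<and> (\<forall>z\<in>carrier E. \<exists>!c. is_coordinates B E h n e z c)"

definition linear_trace ::
    "('b, 'k) ring_scheme \<Rightarrow> ('e, 'l) ring_scheme \<Rightarrow> ('b \<Rightarrow> 'e) \<Rightarrow> nat \<Rightarrow> (nat \<Rightarrow> 'e)
      \<Rightarrow> ('e \<Rightarrow> 'e) \<Rightarrow> 'b" where
  "linear_trace B E h n e u =
    (\<Oplus>\<^bsub>B\<^esub>i\<in>{1..n}. (THE c. is_coordinates B E h n e (u (e i)) c) i)"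

definition ring_det :: "('b, 'k) ring_scheme \<Rightarrow> nat \<Rightarrow> (nat \<Rightarrow> nat \<Rightarrow> 'b) \<Rightarrow> 'b" where
  "ring_det B n M =
    (\<Oplus>\<^bsub>B\<^esub>\<sigma>\<in>{\<sigma>. \<sigma> permutes {1..n}}. [sign \<sigma>] \<cdot>\<^bsub>B\<^esub> (\<Otimes>\<^bsub>B\<^esub>i\<in>{1..n}. M i (\<sigma> i)))"

definition discriminant ::
    "('b, 'k) ring_scheme \<Rightarrow> ('e, 'l) ring_scheme \<Rightarrow> ('b \<Rightarrow> 'e) \<Rightarrow> nat \<Rightarrow> (nat \<Rightarrow> 'e) \<Rightarrow> 'b" where
  "discriminant B E h n e =
    ring_det B n (\<lambda>i j. linear_trace B E h n e (\<lambda>z. z \<otimes>\<^bsub>E\<^esub> (e i \<otimes>\<^bsub>E\<^esub> e j)))"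


section \<open>Etale homomorphisms\<close>

definition exponent_monoid :: "nat \<Rightarrow> nat multiset monoid" where
  "exponent_monoid m = \<lparr>carrier = {M. set_mset M \<subseteq> {..<m}}, monoid.mult = (+), one = {#}\<rparr>"

text \<open>The polynomial ring over \<open>B\<close> in \<open>m\<close> variables; a monomial is the multiset of its variables.\<close>

definition mpoly_ring :: "('b, 'k) ring_scheme \<Rightarrow> nat \<Rightarrow> (nat multiset \<Rightarrow> 'b) ring" where
  "mpoly_ring B m = monoid_algebra B (exponent_monoid m)"

definition finitely_presented ::
    "('b, 'k) ring_scheme \<Rightarrow> ('e, 'l) ring_scheme \<Rightarrow> ('b \<Rightarrow> 'e) \<Rightarrow> bool" where
  "finitely_presented B E h \<longleftrightarrow>
    (\<exists>m F \<phi>. finite F \<and> F \<subseteq> carrier (mpoly_ring B m) \<and>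
       \<phi> \<in> ring_iso (mpoly_ring B m Quot (Idl\<^bsub>mpoly_ring B m\<^esub> F)) E \<and>
       (\<forall>b\<in>carrier B.
          \<phi> ((Idl\<^bsub>mpoly_ring B m\<^esub> F) +>\<^bsub>mpoly_ring B m\<^esub> monoid_algebra_single B {#} b) = h b))"

text \<open>Unique lifting of \<open>B\<close>-algebra maps along square-zero extensions. The test rings \<open>C\<close> range
  over all rings carried by subsets of the type \<open>'c\<close>; a theorem asserting \<open>formally_etale TYPE('c)\<close>
  with \<open>'c\<close> a free type variable asserts it for all test rings.\<close>

definition formally_etale ::
    "'c itself \<Rightarrow> ('b, 'k) ring_scheme \<Rightarrow> ('e, 'l) ring_scheme \<Rightarrow> ('b \<Rightarrow> 'e) \<Rightarrow> bool" where
  "formally_etale _ B E h \<longleftrightarrow>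
    (\<forall>(C :: 'c ring) J u v.
       cring C \<and> ideal J C \<and> J \<cdot>\<^bsub>C\<^esub> J = {\<zero>\<^bsub>C\<^esub>} \<and>
       u \<in> ring_hom B C \<and> v \<in> ring_hom E (C Quot J) \<and>
       (\<forall>b\<in>carrier B. v (h b) = J +>\<^bsub>C\<^esub> u b) \<longrightarrow>
       (\<exists>!w. w \<in> ring_hom E C \<and> w \<in> extensional (carrier E) \<and>
          (\<forall>b\<in>carrier B. w (h b) = u b) \<and> (\<forall>z\<in>carrier E. J +>\<^bsub>C\<^esub> w z = v z)))"

text \<open>The definition of EGA IV: formally etale and of finite presentation.\<close>

definition etale ::
    "'c itself \<Rightarrow> ('b, 'k) ring_scheme \<Rightarrow> ('e, 'l) ring_scheme \<Rightarrow> ('b \<Rightarrow> 'e) \<Rightarrow> bool" where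
  "etale T B E h \<longleftrightarrow>
    ring_hom_cring B E h \<and> finitely_presented B E h \<and> formally_etale T B E h"


section \<open>The extension\<close>

definition loc_base ::
    "('a, 'k) ring_scheme \<Rightarrow> ('a, 'r, 'l) module_scheme \<Rightarrow> nat \<Rightarrow> (nat \<Rightarrow> 'r)
      \<Rightarrow> (((nat \<Rightarrow> 'r) \<Rightarrow> 'a) set \<times> ((nat \<Rightarrow> 'r) \<Rightarrow> 'a) set) set ring" where
  "loc_base A R n x = localization (TS A R n) (alternating_tensor_sq A R n x)"

definition loc_ext ::
    "('a, 'k) ring_scheme \<Rightarrow> ('a, 'r, 'l) module_scheme \<Rightarrow> nat \<Rightarrow> (nat \<Rightarrow> 'r)
      \<Rightarrow> (((nat \<Rightarrow> 'r) \<Rightarrow> 'a) set \<times> ((nat \<Rightarrow> 'r) \<Rightarrow> 'a) set) set ring" where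
  "loc_ext A R n x = localization (TS1 A R n) (alternating_tensor_sq A R n x)"

definition loc_ext_map ::
    "('a, 'k) ring_scheme \<Rightarrow> ('a, 'r, 'l) module_scheme \<Rightarrow> nat \<Rightarrow> (nat \<Rightarrow> 'r)
      \<Rightarrow> (((nat \<Rightarrow> 'r) \<Rightarrow> 'a) set \<times> ((nat \<Rightarrow> 'r) \<Rightarrow> 'a) set) set
      \<Rightarrow> (((nat \<Rightarrow> 'r) \<Rightarrow> 'a) set \<times> ((nat \<Rightarrow> 'r) \<Rightarrow> 'a) set) set" where
  "loc_ext_map A R n x = loc_inclusion (TS1 A R n) (alternating_tensor_sq A R n x)"

text \<open>The image of \<open>\<phi>\<^sub>n(x\<^sub>i)\<close> in the localization.\<close>

definition loc_ext_basis ::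
    "('a, 'k) ring_scheme \<Rightarrow> ('a, 'r, 'l) module_scheme \<Rightarrow> nat \<Rightarrow> (nat \<Rightarrow> 'r) \<Rightarrow> nat
      \<Rightarrow> (((nat \<Rightarrow> 'r) \<Rightarrow> 'a) set \<times> ((nat \<Rightarrow> 'r) \<Rightarrow> 'a) set) set" where
  "loc_ext_basis A R n x i =
    to_loc (TS1 A R n) (alternating_tensor_sq A R n x) (coprojection A R n n (x i))"

end

theory Submission
  imports Defs
begin

text \<open>
  Put \<open>y p i = \<phi>\<^sub>p(x\<^sub>i)\<close>, so that \<open>\<alpha>(x) = det y\<close>, and let \<open>N p i\<close> be the cofactors of \<open>y\<close>. A permutation
  \<open>\<rho>\<close> moves row \<open>p\<close> of \<open>y\<close> to row \<open>\<rho> p\<close> and multiplies \<open>\<alpha>\<close> by the sign of \<open>\<rho>\<close>, hence it sends \<open>\<alpha> N p i\<close> to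
  \<open>\<alpha> N (\<rho> p) i\<close>. For \<open>z\<close> invariant under the permutations fixing \<open>n\<close>, with conjugates \<open>z\<^sub>p\<close>, the elements
  \<open>c i z = \<Sum>\<^sub>p \<alpha> N p i z\<^sub>p\<close> are therefore invariant, and expanding determinants along rows and columns
  shows that \<open>\<alpha>\<^sup>2 z = \<Sum>\<^sub>i c i z y n i\<close> and that a relation \<open>\<Sum>\<^sub>i r i y n i = 0\<close> with invariant \<open>r i\<close> forces
  \<open>\<alpha>\<^sup>2 r i = 0\<close>. After inverting \<open>\<alpha>\<^sup>2\<close> this gives the basis, and the trace of \<open>z\<close> is \<open>\<Sum>\<^sub>p z\<^sub>p\<close>; so the trace
  matrix is \<open>y\<^sup>T y\<close> and the discriminant is \<open>\<alpha>\<^sup>2\<close>.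

  The elements \<open>d i = \<alpha> N n i / \<alpha>\<^sup>2\<close> form the basis dual to \<open>y n i\<close> for the trace, and \<open>\<Sum>\<^sub>i y n i \<otimes> d i\<close> is a
  separability idempotent. Contracting Hochschild cocycles with it shows that maps lift uniquely along
  square-zero extensions. A free extension of finite rank is presented by its multiplication table.
\<close>


text \<open>In general \<alpha> itself lies in neither ring of invariants, only its square does, and
  the square may be a zero divisor. So nothing can be divided before localizing, and
  \<open>y\<close> is never inverted. Each identity is instead proved in the tensor power with the
  denominators cleared and with invariant coefficients; \<open>localized_free\<close> collects these
  identities and carries them over to the localization. All of them come from the two adjugate
  relations for \<open>y\<close>, one along rows and one along columns. What the computation uses of
  tensors is that permutations act by ring homomorphisms and permute the rows of \<open>y\<close>;
  \<open>symmetric_action\<close> records this, which keeps quotients and cosets apart from the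
  linear algebra. The tensor product of \<open>E\<close> with itself over \<open>B\<close> is not
  constructed. An identity in it is expressed by applying an arbitrary pair of
  \<open>B\<close>-linear maps, with values in a \<open>B\<close>-algebra, to the two
  factors.\<close>

text \<open>Keep the index conditions \<open>i \<in> {1..n}\<close> in this form.\<close>

declare One_nat_def [simp del] atLeastAtMost_iff [simp del]

section \<open>Finite sums\<close>

lemma (in abelian_monoid) finsum_Times:
  assumes "finite A" "finite B" "\<And>a b. a \<in> A \<Longrightarrow> b \<in> B \<Longrightarrow> f a b \<in> carrier G"
  shows "(\<Oplus>p\<in>A \<times> B. f (fst p) (snd p)) = (\<Oplus>a\<in>A. \<Oplus>b\<in>B. f a b)"
  using assms(1,3)
proof (induction A rule: finite_induct)
  case (insert a A)
  have "insert a A \<times> B = Pair a ` B \<union> A \<times> B" by auto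
  moreover have "(\<Oplus>p\<in>Pair a ` B. f (fst p) (snd p)) = (\<Oplus>b\<in>B. f a b)"
    using insert.prems by (subst finsum_reindex) (auto simp: inj_on_def)
  ultimately have "(\<Oplus>p\<in>insert a A \<times> B. f (fst p) (snd p))
      = (\<Oplus>b\<in>B. f a b) \<oplus> (\<Oplus>p\<in>A \<times> B. f (fst p) (snd p))"
    using insert.prems insert.hyps assms(2) finsum_Un_disjoint[of "Pair a ` B" "A \<times> B" "\<lambda>p. f (fst p) (snd p)"]
    by (force simp: Pi_iff)
  also have "\<dots> = (\<Oplus>b\<in>B. f a b) \<oplus> (\<Oplus>a\<in>A. \<Oplus>b\<in>B. f a b)"
    using insert by simp
  also have "\<dots> = (\<Oplus>a\<in>insert a A. \<Oplus>b\<in>B. f a b)"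
    using insert by (subst finsum_insert) (auto intro!: finsum_closed)
  finally show ?case .
qed simp

lemma (in abelian_monoid) finsum_swap:
  assumes "finite A" "finite B" "\<And>a b. a \<in> A \<Longrightarrow> b \<in> B \<Longrightarrow> f a b \<in> carrier G"
  shows "(\<Oplus>a\<in>A. \<Oplus>b\<in>B. f a b) = (\<Oplus>b\<in>B. \<Oplus>a\<in>A. f a b)"
  using assms(1,3)
proof (induction A rule: finite_induct)
  case empty
  show ?case using assms(2) by simp
next
  case (insert a A)
  have "(\<Oplus>a\<in>insert a A. \<Oplus>b\<in>B. f a b) = (\<Oplus>b\<in>B. f a b) \<oplus> (\<Oplus>a\<in>A. \<Oplus>b\<in>B. f a b)"
    using insert by (subst finsum_insert) (auto intro!: finsum_closed)
  also have "\<dots> = (\<Oplus>b\<in>B. f a b) \<oplus> (\<Oplus>b\<in>B. \<Oplus>a\<in>A. f a b)"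
    using insert by simp
  also have "\<dots> = (\<Oplus>b\<in>B. f a b \<oplus> (\<Oplus>a\<in>A. f a b))"
    using insert by (intro finsum_addf[symmetric]) (auto intro!: finsum_closed)
  also have "\<dots> = (\<Oplus>b\<in>B. \<Oplus>a\<in>insert a A. f a b)"
    using insert by (intro finsum_cong') (auto intro!: finsum_closed)
  finally show ?case .
qed

lemma (in abelian_monoid) finsum_delta:
  assumes "finite A" "i \<in> A" "f i \<in> carrier G"
  shows "(\<Oplus>j\<in>A. if j = i then f j else \<zero>) = f i"
proof -
  have "(\<Oplus>j\<in>A. if j = i then f j else \<zero>) = (\<Oplus>j\<in>{i}. f j)"
    using assms by (intro add.finprod_mono_neutral_cong_right) auto
  thus ?thesis using assms by simp
qed

lemma (in abelian_group) finsum_minus: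
  assumes "finite A" "f \<in> A \<rightarrow> carrier G"
  shows "(\<Oplus>a\<in>A. \<ominus> f a) = \<ominus> (\<Oplus>a\<in>A. f a)"
  using assms
proof (induction A rule: finite_induct)
  case (insert a A)
  thus ?case by (subst (1 2) finsum_insert) (auto simp: Pi_iff minus_add)
qed (use minus_equality[OF r_zero, symmetric] in simp)

lemma (in abelian_group) finsum_diff:
  assumes "finite A" "f \<in> A \<rightarrow> carrier G" "g \<in> A \<rightarrow> carrier G"
  shows "(\<Oplus>a\<in>A. f a \<ominus> g a) = (\<Oplus>a\<in>A. f a) \<ominus> (\<Oplus>a\<in>A. g a)"
proof -
  have "(\<Oplus>a\<in>A. f a \<oplus> \<ominus> g a) = (\<Oplus>a\<in>A. f a) \<oplus> (\<Oplus>a\<in>A. \<ominus> g a)"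
    using assms by (intro finsum_addf) auto
  thus ?thesis using assms finsum_minus[of A g] by (simp add: minus_eq)
qed

text \<open>A choice function on \<open>insert i I\<close> is a choice at \<open>i\<close> together
  with a choice function on \<open>I\<close>. Needed for multiplicativity of the determinant, where
  \<open>g\<close> picks one summand in every row.\<close>

lemma (in cring) finprod_finsum_PiE:
  assumes "finite I" "finite K" "\<And>i k. i \<in> I \<Longrightarrow> k \<in> K \<Longrightarrow> f i k \<in> carrier R"
  shows "(\<Otimes>i\<in>I. \<Oplus>k\<in>K. f i k) = (\<Oplus>g\<in>I \<rightarrow>\<^sub>E K. \<Otimes>i\<in>I. f i (g i))"
  using assms(1,3)
proof (induction I rule: finite_induct)
  case (insert i I)
  let ?u = "\<lambda>p. (snd p)(i := fst p)"
  have fin: "finite (I \<rightarrow>\<^sub>E K)" using insert assms by (intro finite_PiE) auto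
  have inj: "inj_on ?u (K \<times> (I \<rightarrow>\<^sub>E K))"
  proof (rule inj_onI)
    fix p q assume p: "p \<in> K \<times> (I \<rightarrow>\<^sub>E K)" and q: "q \<in> K \<times> (I \<rightarrow>\<^sub>E K)" and e: "?u p = ?u q"
    have "fst p = fst q" using fun_cong[OF e, of i] by simp
    moreover have "snd p = snd q"
    proof
      fix j show "snd p j = snd q j"
        using fun_cong[OF e, of j] p q insert(2) by (cases "j = i") (auto simp: PiE_def extensional_def)
    qed
    ultimately show "p = q" by (simp add: prod_eq_iff)
  qed
  have img: "insert i I \<rightarrow>\<^sub>E K = ?u ` (K \<times> (I \<rightarrow>\<^sub>E K))"
    by (subst PiE_insert_eq) (auto simp: image_def)
  have pc: "(\<Otimes>j\<in>I. f j (g j)) \<in> carrier R" if "g \<in> I \<rightarrow>\<^sub>E K" for g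
    using that insert.prems by (intro finprod_closed) (auto simp: PiE_iff)
  have u: "(\<Otimes>j\<in>insert i I. f j (?u p j)) = f i (fst p) \<otimes> (\<Otimes>j\<in>I. f j (snd p j))"
    if "p \<in> K \<times> (I \<rightarrow>\<^sub>E K)" for p
  proof -
    have "(\<Otimes>j\<in>insert i I. f j (?u p j)) = f i (fst p) \<otimes> (\<Otimes>j\<in>I. f j (?u p j))"
      using that insert.prems insert.hyps by (subst finprod_insert) (auto simp: PiE_iff)
    also have "(\<Otimes>j\<in>I. f j (?u p j)) = (\<Otimes>j\<in>I. f j (snd p j))"
      using that insert.prems insert.hyps by (intro finprod_cong') (auto simp: PiE_iff)
    finally show ?thesis .
  qed
  have "(\<Oplus>g\<in>insert i I \<rightarrow>\<^sub>E K. \<Otimes>j\<in>insert i I. f j (g j))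
      = (\<Oplus>p\<in>K \<times> (I \<rightarrow>\<^sub>E K). \<Otimes>j\<in>insert i I. f j (?u p j))"
    unfolding img using inj insert.prems by (intro finsum_reindex) (auto intro!: finprod_closed simp: PiE_iff)
  also have "\<dots> = (\<Oplus>p\<in>K \<times> (I \<rightarrow>\<^sub>E K). f i (fst p) \<otimes> (\<Otimes>j\<in>I. f j (snd p j)))"
    using u pc insert.prems by (intro finsum_cong') auto
  also have "\<dots> = (\<Oplus>k\<in>K. \<Oplus>g\<in>I \<rightarrow>\<^sub>E K. f i k \<otimes> (\<Otimes>j\<in>I. f j (g j)))"
    using assms fin pc insert.prems
    by (intro finsum_Times[of K _ "\<lambda>k g. f i k \<otimes> (\<Otimes>j\<in>I. f j (g j))"]) auto
  also have "\<dots> = (\<Oplus>k\<in>K. f i k \<otimes> (\<Oplus>g\<in>I \<rightarrow>\<^sub>E K. \<Otimes>j\<in>I. f j (g j)))"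
    using assms fin pc insert.prems by (intro finsum_cong' finsum_rdistr[symmetric]) (auto intro!: finsum_closed)
  also have "\<dots> = (\<Oplus>k\<in>K. f i k) \<otimes> (\<Oplus>g\<in>I \<rightarrow>\<^sub>E K. \<Otimes>j\<in>I. f j (g j))"
    using assms pc insert.prems by (intro finsum_ldistr[symmetric]) (auto intro!: finsum_closed)
  also have "\<dots> = (\<Otimes>j\<in>insert i I. \<Oplus>k\<in>K. f j k)"
    using insert by (subst finprod_insert) (auto intro!: finsum_closed)
  finally show ?case by simp
qed (simp add: PiE_empty_domain)

section \<open>Determinants over a commutative ring\<close>

lemma (in ring) add_pow_sign:
  assumes "a \<in> carrier R"
  shows "[sign \<rho>] \<cdot> a = (if evenperm \<rho> then a else \<ominus> a)"
  using assms by (simp add: sign_def add.int_pow_neg)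

lemma (in ring) add_pow_sign_mult:
  assumes "a \<in> carrier R"
  shows "[sign \<rho>] \<cdot> ([sign \<tau>] \<cdot> a) = [(sign \<rho> * sign \<tau>)] \<cdot> a"
  using assms by (simp add: add.int_pow_pow mult.commute)

lemma (in ring) add_pow_sign_finsum:
  assumes "finite A" "f \<in> A \<rightarrow> carrier R"
  shows "[sign \<rho>] \<cdot> (\<Oplus>a\<in>A. f a) = (\<Oplus>a\<in>A. [sign \<rho>] \<cdot> f a)"
proof -
  have "(\<Oplus>a\<in>A. [sign \<rho>] \<cdot> f a) = (\<Oplus>a\<in>A. if evenperm \<rho> then f a else \<ominus> f a)"
    using assms by (intro finsum_cong') (auto simp: add_pow_sign Pi_iff)
  thus ?thesis using assms finsum_minus[of A f] by (simp add: add_pow_sign finsum_closed)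
qed

section \<open>Row operations, products and cofactors of determinants\<close>

context cring
begin

lemma det_term_closed:
  assumes "\<And>i j. i \<in> {1..n} \<Longrightarrow> j \<in> {1..n} \<Longrightarrow> M i j \<in> carrier R" "\<rho> permutes {1..n}"
  shows "(\<Otimes>i\<in>{1..n}. M i (\<rho> i)) \<in> carrier R"
  using assms permutes_in_image[OF assms(2)] by (intro finprod_closed) auto

lemma ring_det_closed:
  assumes "\<And>i j. i \<in> {1..n} \<Longrightarrow> j \<in> {1..n} \<Longrightarrow> M i j \<in> carrier R"
  shows "ring_det R n M \<in> carrier R"
  unfolding ring_det_def using det_term_closed[of n M] assms
  by (intro finsum_closed) auto

lemma ring_det_cong:
  assumes "\<And>i j. i \<in> {1..n} \<Longrightarrow> j \<in> {1..n} \<Longrightarrow> M i j = M' i j"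
    and "\<And>i j. i \<in> {1..n} \<Longrightarrow> j \<in> {1..n} \<Longrightarrow> M' i j \<in> carrier R"
  shows "ring_det R n M = ring_det R n M'"
proof -
  have "(\<Otimes>i\<in>{1..n}. M i (\<rho> i)) = (\<Otimes>i\<in>{1..n}. M' i (\<rho> i))" if "\<rho> permutes {1..n}" for \<rho>
    using assms permutes_in_image[OF that] by (intro finprod_cong') auto
  thus ?thesis
    unfolding ring_det_def using det_term_closed[of n M'] assms(2)
    by (intro finsum_cong') auto
qed

text \<open>Substituting \<open>\<rho> \<circ> \<tau>\<close> for \<rho> and reordering the factors
  along \<tau> reproduces the terms of the determinant of \<open>M\<close>, up to the sign of
  \<tau>.\<close>

lemma ring_det_permute_rows:
  assumes M: "\<And>i j. i \<in> {1..n} \<Longrightarrow> j \<in> {1..n} \<Longrightarrow> M i j \<in> carrier R"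
    and p: "\<tau> permutes {1..n}"
  shows "ring_det R n (\<lambda>i. M (\<tau> i)) = [sign \<tau>] \<cdot> ring_det R n M"
proof -
  let ?P = "{\<rho>. \<rho> permutes {1..n}}"
  have fin: "finite ?P" by (simp add: finite_permutations)
  have perm: "permutation \<rho>" if "\<rho> permutes {1..n}" for \<rho>
    using that by (auto simp: permutation_permutes)
  have img: "?P = (\<lambda>\<rho>. \<rho> \<circ> \<tau>) ` ?P"
  proof (intro subset_antisym subsetI)
    fix \<rho> assume "\<rho> \<in> ?P"
    moreover have "\<rho> = (\<rho> \<circ> Hilbert_Choice.inv \<tau>) \<circ> \<tau>" using permutes_inv_o[OF p] by (simp add: comp_assoc)
    ultimately show "\<rho> \<in> (\<lambda>\<rho>. \<rho> \<circ> \<tau>) ` ?P"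
      using permutes_compose[OF permutes_inv[OF p]] by blast
  qed (use permutes_compose[OF p] in auto)
  have inj: "inj_on (\<lambda>\<rho>. \<rho> \<circ> \<tau>) ?P"
  proof (rule inj_onI)
    fix \<rho> \<rho>' assume "\<rho> \<circ> \<tau> = \<rho>' \<circ> \<tau>"
    hence "\<rho> \<circ> \<tau> \<circ> Hilbert_Choice.inv \<tau> = \<rho>' \<circ> \<tau> \<circ> Hilbert_Choice.inv \<tau>" by simp
    thus "\<rho> = \<rho>'" using permutes_inv_o[OF p] by (simp add: comp_assoc)
  qed
  have term_eq: "(\<Otimes>i\<in>{1..n}. M (\<tau> i) ((\<rho> \<circ> \<tau>) i)) = (\<Otimes>i\<in>{1..n}. M i (\<rho> i))" if "\<rho> \<in> ?P" for \<rho>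
  proof -
    have "(\<Otimes>i\<in>\<tau> ` {1..n}. M i (\<rho> i)) = (\<Otimes>i\<in>{1..n}. M (\<tau> i) (\<rho> (\<tau> i)))"
      using that M permutes_in_image[of \<rho>] permutes_in_image[OF p] permutes_inj_on[OF p]
      by (intro finprod_reindex) auto
    thus ?thesis using permutes_image[OF p] by simp
  qed
  have M': "\<And>i j. i \<in> {1..n} \<Longrightarrow> j \<in> {1..n} \<Longrightarrow> M (\<tau> i) j \<in> carrier R"
    using M permutes_in_image[OF p] by blast
  have "ring_det R n (\<lambda>i. M (\<tau> i))
      = (\<Oplus>\<rho>\<in>(\<lambda>\<rho>. \<rho> \<circ> \<tau>) ` ?P. [sign \<rho>] \<cdot> (\<Otimes>i\<in>{1..n}. M (\<tau> i) (\<rho> i)))"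
    unfolding ring_det_def img[symmetric] ..
  also have "\<dots> = (\<Oplus>\<rho>\<in>?P. [sign (\<rho> \<circ> \<tau>)] \<cdot> (\<Otimes>i\<in>{1..n}. M (\<tau> i) ((\<rho> \<circ> \<tau>) i)))"
    using inj det_term_closed[of n "\<lambda>i. M (\<tau> i)"] M' img
    by (intro finsum_reindex) blast+
  also have "\<dots> = (\<Oplus>\<rho>\<in>?P. [sign \<tau>] \<cdot> ([sign \<rho>] \<cdot> (\<Otimes>i\<in>{1..n}. M i (\<rho> i))))"
    using term_eq det_term_closed[of n M] M perm p
    by (intro finsum_cong') (auto simp: add_pow_sign_mult sign_compose mult.commute)
  also have "\<dots> = [sign \<tau>] \<cdot> (\<Oplus>\<rho>\<in>?P. [sign \<rho>] \<cdot> (\<Otimes>i\<in>{1..n}. M i (\<rho> i)))"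
    using det_term_closed[of n M] M fin by (intro add_pow_sign_finsum[symmetric]) auto
  finally show ?thesis unfolding ring_det_def .
qed

text \<open>Antisymmetry would only show that twice the determinant is zero, which is too weak in
  characteristic 2. The terms are cancelled in pairs instead: an even \<rho> against the odd
  \<open>\<rho> \<circ> transpose p q\<close>, which has the same product.\<close>

lemma ring_det_identical_rows:
  assumes M: "\<And>i j. i \<in> {1..n} \<Longrightarrow> j \<in> {1..n} \<Longrightarrow> M i j \<in> carrier R"
    and pq: "p \<in> {1..n}" "q \<in> {1..n}" "p \<noteq> q" and eq: "\<And>j. j \<in> {1..n} \<Longrightarrow> M p j = M q j"
  shows "ring_det R n M = \<zero>"
proof -
  let ?P = "{\<rho>. \<rho> permutes {1..n}}" and ?t = "transpose p q"
  let ?g = "\<lambda>\<rho>. \<Otimes>i\<in>{1..n}. M i (\<rho> i)"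
  let ?E = "{\<rho> \<in> ?P. evenperm \<rho>}" and ?O = "{\<rho> \<in> ?P. \<not> evenperm \<rho>}"
  have t: "?t permutes {1..n}" using pq by (simp add: permutes_swap_id)
  have fin: "finite ?P" by (simp add: finite_permutations)
  have perm: "permutation \<rho>" if "\<rho> permutes {1..n}" for \<rho>
    using that by (auto simp: permutation_permutes)
  have par: "evenperm (\<rho> \<circ> ?t) \<longleftrightarrow> \<not> evenperm \<rho>" if "\<rho> permutes {1..n}" for \<rho>
    using evenperm_comp[OF perm[OF that] perm[OF t]] pq by (simp add: evenperm_swap)
  have tt: "(\<rho> \<circ> ?t) \<circ> ?t = \<rho>" for \<rho> :: "nat \<Rightarrow> nat" by (simp add: comp_assoc)
  have img: "?O = (\<lambda>\<rho>. \<rho> \<circ> ?t) ` ?E"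
  proof (intro subset_antisym subsetI)
    fix \<rho> assume s: "\<rho> \<in> ?O"
    hence "\<rho> \<circ> ?t \<in> ?E" using par permutes_compose[OF t] by auto
    thus "\<rho> \<in> (\<lambda>\<rho>. \<rho> \<circ> ?t) ` ?E" by (intro image_eqI[where x = "\<rho> \<circ> ?t"]) (simp only: tt)
  next
    fix \<rho> assume "\<rho> \<in> (\<lambda>\<rho>. \<rho> \<circ> ?t) ` ?E"
    then obtain \<rho>' where "\<rho>' \<in> ?E" "\<rho> = \<rho>' \<circ> ?t" by blast
    thus "\<rho> \<in> ?O" using par[of \<rho>'] permutes_compose[OF t, of \<rho>'] by simp
  qed
  have inj: "inj_on (\<lambda>\<rho>. \<rho> \<circ> ?t) ?E" by (rule inj_on_inverseI) (rule tt)
  have c: "?g \<in> ?P \<rightarrow> carrier R" using det_term_closed[of n M] M by auto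
  have same: "?g (\<rho> \<circ> ?t) = ?g \<rho>" if "\<rho> \<in> ?P" for \<rho>
  proof -
    have "?g \<rho> = (\<Otimes>i\<in>?t ` {1..n}. M i (\<rho> i))" using permutes_image[OF t] by simp
    also have "\<dots> = (\<Otimes>i\<in>{1..n}. M (?t i) (\<rho> (?t i)))"
      using that M permutes_in_image[of \<rho>] permutes_in_image[OF t] permutes_inj_on[OF t]
      by (intro finprod_reindex) auto
    also have "\<dots> = ?g (\<rho> \<circ> ?t)"
    proof (intro finprod_cong')
      fix i assume i: "i \<in> {1..n}"
      have "\<rho> (?t i) \<in> {1..n}" using i that permutes_in_image[of \<rho>] permutes_in_image[OF t] by blast
      thus "M (?t i) (\<rho> (?t i)) = M i ((\<rho> \<circ> ?t) i)"
        using eq pq by (cases "i = p"; cases "i = q") (simp_all add: transpose_apply_other)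
    qed (use that M permutes_in_image[of \<rho>] permutes_in_image[OF t] in auto)
    finally show ?thesis ..
  qed
  have PE: "?P = ?E \<union> ?O" by blast
  have "ring_det R n M = (\<Oplus>\<rho>\<in>?E \<union> ?O. [sign \<rho>] \<cdot> ?g \<rho>)"
    unfolding ring_det_def by (rule arg_cong[OF PE])
  also have "\<dots> = (\<Oplus>\<rho>\<in>?E. [sign \<rho>] \<cdot> ?g \<rho>) \<oplus> (\<Oplus>\<rho>\<in>?O. [sign \<rho>] \<cdot> ?g \<rho>)"
    using fin c by (intro finsum_Un_disjoint) auto
  also have "(\<Oplus>\<rho>\<in>?E. [sign \<rho>] \<cdot> ?g \<rho>) = (\<Oplus>\<rho>\<in>?E. ?g \<rho>)"
    using c by (intro finsum_cong') (auto simp: add_pow_sign Pi_iff)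
  also have "(\<Oplus>\<rho>\<in>?O. [sign \<rho>] \<cdot> ?g \<rho>) = (\<Oplus>\<rho>\<in>?E. [sign (\<rho> \<circ> ?t)] \<cdot> ?g (\<rho> \<circ> ?t))"
    unfolding img
  proof (intro finsum_reindex inj)
    have "(\<lambda>\<rho>. \<rho> \<circ> ?t) ` ?E \<subseteq> ?P" unfolding img[symmetric] by blast
    thus "(\<lambda>\<rho>. [sign \<rho>] \<cdot> ?g \<rho>) \<in> (\<lambda>\<rho>. \<rho> \<circ> ?t) ` ?E \<rightarrow> carrier R"
      using c by (intro funcsetI add.int_pow_closed) blast
  qed
  also have "\<dots> = (\<Oplus>\<rho>\<in>?E. \<ominus> ?g \<rho>)"
  proof (intro finsum_cong')
    fix \<rho> assume s: "\<rho> \<in> ?E"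
    show "[sign (\<rho> \<circ> ?t)] \<cdot> ?g (\<rho> \<circ> ?t) = \<ominus> ?g \<rho>"
      using same[of \<rho>] par[of \<rho>] s c by (simp add: add_pow_sign Pi_iff)
  qed (use c in auto)
  also have "\<dots> = \<ominus> (\<Oplus>\<rho>\<in>?E. ?g \<rho>)"
    using fin c by (intro finsum_minus) auto
  finally show ?thesis using c by (simp add: r_neg finsum_closed Pi_iff)
qed

text \<open>Every term of the determinant contains exactly one factor from row \<open>p\<close>;
  \<open>rest\<close> splits it off. A whole linear combination is treated at once because cofactor
  expansions have this form.\<close>

lemma ring_det_row_finsum:
  assumes M: "\<And>i j. i \<in> {1..n} \<Longrightarrow> j \<in> {1..n} \<Longrightarrow> M i j \<in> carrier R" and p: "p \<in> {1..n}"
    and K: "finite K" and a: "\<And>k. k \<in> K \<Longrightarrow> a k \<in> carrier R"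
    and v: "\<And>k j. k \<in> K \<Longrightarrow> j \<in> {1..n} \<Longrightarrow> v k j \<in> carrier R"
  shows "ring_det R n (M(p := (\<lambda>j. \<Oplus>k\<in>K. a k \<otimes> v k j)))
       = (\<Oplus>k\<in>K. a k \<otimes> ring_det R n (M(p := v k)))"
proof -
  let ?P = "{\<rho>. \<rho> permutes {1..n}}" and ?I = "{1..n} - {p}"
  have fin: "finite ?P" by (simp add: finite_permutations)
  have rest: "(\<Otimes>i\<in>{1..n}. (M(p := w)) i (\<rho> i)) = w (\<rho> p) \<otimes> (\<Otimes>i\<in>?I. M i (\<rho> i))"
    if "\<rho> \<in> ?P" "\<And>j. j \<in> {1..n} \<Longrightarrow> w j \<in> carrier R" for \<rho> w
  proof -
    have s: "\<And>i. i \<in> {1..n} \<Longrightarrow> \<rho> i \<in> {1..n}" using that(1) permutes_in_image[of \<rho>] by blast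
    have "(\<Otimes>i\<in>insert p ?I. (M(p := w)) i (\<rho> i)) = w (\<rho> p) \<otimes> (\<Otimes>i\<in>?I. (M(p := w)) i (\<rho> i))"
      using s M that(2) p by (subst finprod_insert) auto
    also have "(\<Otimes>i\<in>?I. (M(p := w)) i (\<rho> i)) = (\<Otimes>i\<in>?I. M i (\<rho> i))"
      using s M by (intro finprod_cong') auto
    finally show ?thesis using p by (simp add: insert_absorb)
  qed
  have rc: "(\<Otimes>i\<in>?I. M i (\<rho> i)) \<in> carrier R" if "\<rho> \<in> ?P" for \<rho>
    using that M permutes_in_image[of \<rho>] by (intro finprod_closed) auto
  have sp: "\<rho> p \<in> {1..n}" if "\<rho> \<in> ?P" for \<rho> using that p permutes_in_image[of \<rho>] by blast
  have vs: "v k (\<rho> p) \<in> carrier R" if "\<rho> \<in> ?P" "k \<in> K" for \<rho> k using sp[OF that(1)] v that(2) by blast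
  have "ring_det R n (M(p := (\<lambda>j. \<Oplus>k\<in>K. a k \<otimes> v k j)))
      = (\<Oplus>\<rho>\<in>?P. \<Oplus>k\<in>K. a k \<otimes> ([sign \<rho>] \<cdot> (v k (\<rho> p) \<otimes> (\<Otimes>i\<in>?I. M i (\<rho> i)))))"
    unfolding ring_det_def
  proof (intro finsum_cong')
    fix \<rho> assume s: "\<rho> \<in> ?P"
    let ?r = "\<Otimes>i\<in>?I. M i (\<rho> i)"
    have "(\<Otimes>i\<in>{1..n}. (M(p := (\<lambda>j. \<Oplus>k\<in>K. a k \<otimes> v k j))) i (\<rho> i)) = (\<Oplus>k\<in>K. a k \<otimes> v k (\<rho> p)) \<otimes> ?r"
      using s a v by (subst rest) (auto intro!: finsum_closed)
    also have "[sign \<rho>] \<cdot> \<dots> = (\<Oplus>k\<in>K. a k \<otimes> v k (\<rho> p)) \<otimes> ([sign \<rho>] \<cdot> ?r)"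
      using s a vs rc by (intro add_pow_rdistr_int[symmetric]) (auto intro!: finsum_closed)
    also have "\<dots> = (\<Oplus>k\<in>K. a k \<otimes> v k (\<rho> p) \<otimes> ([sign \<rho>] \<cdot> ?r))"
      using s a vs rc K by (intro finsum_ldistr) auto
    also have "\<dots> = (\<Oplus>k\<in>K. a k \<otimes> ([sign \<rho>] \<cdot> (v k (\<rho> p) \<otimes> ?r)))"
      using s a vs rc by (intro finsum_cong') (auto simp: m_assoc add_pow_rdistr_int)
    finally show "[sign \<rho>] \<cdot> (\<Otimes>i\<in>{1..n}. (M(p := (\<lambda>j. \<Oplus>k\<in>K. a k \<otimes> v k j))) i (\<rho> i))
        = (\<Oplus>k\<in>K. a k \<otimes> ([sign \<rho>] \<cdot> (v k (\<rho> p) \<otimes> ?r)))" .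
  qed (use a vs rc in \<open>auto intro!: finsum_closed\<close>)
  also have "\<dots> = (\<Oplus>k\<in>K. \<Oplus>\<rho>\<in>?P. a k \<otimes> ([sign \<rho>] \<cdot> (v k (\<rho> p) \<otimes> (\<Otimes>i\<in>?I. M i (\<rho> i)))))"
    using fin K a vs rc by (intro finsum_swap) auto
  also have "\<dots> = (\<Oplus>k\<in>K. a k \<otimes> ring_det R n (M(p := v k)))"
  proof (intro finsum_cong')
    fix k assume k: "k \<in> K"
    have "ring_det R n (M(p := v k)) = (\<Oplus>\<rho>\<in>?P. [sign \<rho>] \<cdot> (v k (\<rho> p) \<otimes> (\<Otimes>i\<in>?I. M i (\<rho> i))))"
      unfolding ring_det_def using k vs rc rest[of _ "v k"] v by (intro finsum_cong') auto
    thus "(\<Oplus>\<rho>\<in>?P. a k \<otimes> ([sign \<rho>] \<cdot> (v k (\<rho> p) \<otimes> (\<Otimes>i\<in>?I. M i (\<rho> i))))) = a k \<otimes> ring_det R n (M(p := v k))"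
      using k fin a vs rc by (simp, intro finsum_rdistr[symmetric]) auto
  qed (use a v M p in \<open>auto intro!: ring_det_closed\<close>)
  finally show ?thesis .
qed

text \<open>Expanding each row of the product gives a sum over all maps \<open>g\<close> from
  \<open>{1..n}\<close> to itself. A map that is not injective selects two equal rows of
  \<open>N\<close> and contributes nothing; an injective one is a permutation and contributes its
  sign.\<close>

lemma ring_det_mult:
  assumes M: "\<And>i j. i \<in> {1..n} \<Longrightarrow> j \<in> {1..n} \<Longrightarrow> M i j \<in> carrier R"
    and N: "\<And>i j. i \<in> {1..n} \<Longrightarrow> j \<in> {1..n} \<Longrightarrow> N i j \<in> carrier R"
  shows "ring_det R n (\<lambda>i j. \<Oplus>k\<in>{1..n}. M i k \<otimes> N k j) = ring_det R n M \<otimes> ring_det R n N"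
proof -
  let ?I = "{1..n}"
  let ?P = "{\<rho>. \<rho> permutes ?I}" and ?F = "?I \<rightarrow>\<^sub>E ?I"
  let ?m = "\<lambda>g. \<Otimes>i\<in>?I. M i (g i)"
  have fin: "finite ?P" "finite ?F" by (simp_all add: finite_permutations finite_PiE)
  have perm: "permutation \<rho>" if "\<rho> \<in> ?P" for \<rho>
    using that by (auto simp: permutation_permutes)
  have sI: "\<rho> i \<in> ?I" if "\<rho> \<in> ?P" "i \<in> ?I" for \<rho> i using that permutes_in_image[of \<rho>] by blast
  have mc: "?m g \<in> carrier R" if "g \<in> ?F" for g using that M by (intro finprod_closed) (auto simp: PiE_iff)
  have nc: "(\<Otimes>i\<in>?I. N (g i) (\<rho> i)) \<in> carrier R" if "g \<in> ?F" "\<rho> \<in> ?P" for g \<rho>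
    using that N sI by (intro finprod_closed) (auto simp: PiE_iff)
  have Nc: "ring_det R n (\<lambda>i. N (g i)) \<in> carrier R" if "g \<in> ?F" for g
    using that N by (intro ring_det_closed) (auto simp: PiE_iff)
  have "ring_det R n (\<lambda>i j. \<Oplus>k\<in>?I. M i k \<otimes> N k j)
      = (\<Oplus>\<rho>\<in>?P. \<Oplus>g\<in>?F. ?m g \<otimes> ([sign \<rho>] \<cdot> (\<Otimes>i\<in>?I. N (g i) (\<rho> i))))"
    unfolding ring_det_def
  proof (intro finsum_cong')
    fix \<rho> assume s: "\<rho> \<in> ?P"
    have "(\<Otimes>i\<in>?I. \<Oplus>k\<in>?I. M i k \<otimes> N k (\<rho> i)) = (\<Oplus>g\<in>?F. \<Otimes>i\<in>?I. M i (g i) \<otimes> N (g i) (\<rho> i))"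
      using M N sI[OF s] by (intro finprod_finsum_PiE) auto
    also have "\<dots> = (\<Oplus>g\<in>?F. ?m g \<otimes> (\<Otimes>i\<in>?I. N (g i) (\<rho> i)))"
      using M N sI[OF s] mc nc s by (intro finsum_cong' finprod_multf) (auto simp: PiE_iff)
    finally have "[sign \<rho>] \<cdot> (\<Otimes>i\<in>?I. \<Oplus>k\<in>?I. M i k \<otimes> N k (\<rho> i))
        = [sign \<rho>] \<cdot> (\<Oplus>g\<in>?F. ?m g \<otimes> (\<Otimes>i\<in>?I. N (g i) (\<rho> i)))" by (rule arg_cong)
    also have "\<dots> = (\<Oplus>g\<in>?F. [sign \<rho>] \<cdot> (?m g \<otimes> (\<Otimes>i\<in>?I. N (g i) (\<rho> i))))"
      using mc nc s fin by (intro add_pow_sign_finsum) auto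
    also have "\<dots> = (\<Oplus>g\<in>?F. ?m g \<otimes> ([sign \<rho>] \<cdot> (\<Otimes>i\<in>?I. N (g i) (\<rho> i))))"
      using mc nc s by (intro finsum_cong' add_pow_rdistr_int[symmetric]) auto
    finally show "[sign \<rho>] \<cdot> (\<Otimes>i\<in>?I. \<Oplus>k\<in>?I. M i k \<otimes> N k (\<rho> i))
        = (\<Oplus>g\<in>?F. ?m g \<otimes> ([sign \<rho>] \<cdot> (\<Otimes>i\<in>?I. N (g i) (\<rho> i))))" .
  qed (use mc nc in \<open>auto intro!: finsum_closed\<close>)
  also have "\<dots> = (\<Oplus>g\<in>?F. \<Oplus>\<rho>\<in>?P. ?m g \<otimes> ([sign \<rho>] \<cdot> (\<Otimes>i\<in>?I. N (g i) (\<rho> i))))"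
    using fin mc nc by (intro finsum_swap) auto
  also have "\<dots> = (\<Oplus>g\<in>?F. ?m g \<otimes> ring_det R n (\<lambda>i. N (g i)))"
    unfolding ring_det_def using fin mc nc Nc[unfolded ring_det_def]
    by (intro finsum_cong' finsum_rdistr[symmetric]) auto
  \<comment> \<open>Elements of \<open>?F\<close> take the value \<open>undefined\<close> outside
    \<open>{1..n}\<close> while permutations are the identity there, so a permutation enters through
    its restriction.\<close>
  also have "\<dots> = (\<Oplus>g\<in>(\<lambda>\<rho>. restrict \<rho> ?I) ` ?P. ?m g \<otimes> ring_det R n (\<lambda>i. N (g i)))"
  proof (intro add.finprod_mono_neutral_cong_right ballI)
    show "(\<lambda>\<rho>. restrict \<rho> ?I) ` ?P \<subseteq> ?F" using sI by fastforce
    fix g assume g: "g \<in> ?F - (\<lambda>\<rho>. restrict \<rho> ?I) ` ?P"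
    have "\<not> inj_on g ?I"
    proof
      assume inj: "inj_on g ?I"
      \<comment> \<open>Extension by the identity turns an injective map of the index set into a
        permutation, whose restriction is \<open>g\<close> again.\<close>
      let ?s = "\<lambda>i. if i \<in> ?I then g i else i"
      have "inj_on ?s ?I" "?s ` ?I \<subseteq> ?I" using inj g by (auto simp: inj_on_def)
      hence "?s permutes ?I" by (intro inj_imp_permutes) (auto simp: image_subset_iff)
      moreover have "g = restrict ?s ?I" using g by (auto simp: restrict_def PiE_def extensional_def)
      ultimately show False using g by blast
    qed
    then obtain p q where "p \<in> ?I" "q \<in> ?I" "p \<noteq> q" "g p = g q" by (auto simp: inj_on_def)
    hence "ring_det R n (\<lambda>i. N (g i)) = \<zero>"
      using g N by (intro ring_det_identical_rows[of n _ p q]) (auto simp: PiE_iff)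
    thus "?m g \<otimes> ring_det R n (\<lambda>i. N (g i)) = \<zero>" using mc g by simp
  qed (use fin mc Nc in auto)
  also have "\<dots> = (\<Oplus>\<rho>\<in>?P. ?m (restrict \<rho> ?I) \<otimes> ring_det R n (\<lambda>i. N (restrict \<rho> ?I i)))"
  proof (intro finsum_reindex inj_onI)
    fix \<rho> \<tau> assume s: "\<rho> \<in> ?P" "\<tau> \<in> ?P" "restrict \<rho> ?I = restrict \<tau> ?I"
    show "\<rho> = \<tau>"
    proof
      fix i
      have "restrict \<rho> ?I i = restrict \<tau> ?I i" using s(3) by (rule fun_cong)
      thus "\<rho> i = \<tau> i" using s(1,2) by (cases "i \<in> ?I") (auto simp: permutes_not_in)
    qed
  next
    have "(\<lambda>\<rho>. restrict \<rho> ?I) ` ?P \<subseteq> ?F" using sI by fastforce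
    thus "(\<lambda>g. ?m g \<otimes> ring_det R n (\<lambda>i. N (g i))) \<in> (\<lambda>\<rho>. restrict \<rho> ?I) ` ?P \<rightarrow> carrier R"
      using mc Nc by blast
  qed
  also have "\<dots> = (\<Oplus>\<rho>\<in>?P. ([sign \<rho>] \<cdot> ?m \<rho>) \<otimes> ring_det R n N)"
  proof (intro finsum_cong')
    fix \<rho> assume s: "\<rho> \<in> ?P"
    have "?m (restrict \<rho> ?I) = ?m \<rho>" using s M sI by (intro finprod_cong') auto
    moreover have "ring_det R n (\<lambda>i. N (restrict \<rho> ?I i)) = ring_det R n (\<lambda>i. N (\<rho> i))"
      using s N sI by (intro ring_det_cong) auto
    moreover have "\<dots> = [sign \<rho>] \<cdot> ring_det R n N"
      using s N by (intro ring_det_permute_rows) auto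
    moreover have "?m \<rho> \<in> carrier R" using det_term_closed[of n M \<rho>] M s by auto
    ultimately show "?m (restrict \<rho> ?I) \<otimes> ring_det R n (\<lambda>i. N (restrict \<rho> ?I i)) = ([sign \<rho>] \<cdot> ?m \<rho>) \<otimes> ring_det R n N"
      using ring_det_closed[of n N] N by (simp add: add_pow_rdistr_int add_pow_ldistr_int)
  qed (use det_term_closed[of n M] M ring_det_closed[of n N] N in auto)
  also have "\<dots> = ring_det R n M \<otimes> ring_det R n N"
    using det_term_closed[of n M] M ring_det_closed[of n N] N fin
    unfolding ring_det_def[of R n M] by (intro finsum_ldistr[symmetric]) auto
  finally show ?thesis .
qed

text \<open>The inverse permutation has the same sign, and reordering the factors along \<rho>
  exchanges the roles of rows and columns.\<close>

lemma ring_det_transpose: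
  assumes M: "\<And>i j. i \<in> {1..n} \<Longrightarrow> j \<in> {1..n} \<Longrightarrow> M i j \<in> carrier R"
  shows "ring_det R n (\<lambda>i j. M j i) = ring_det R n M"
proof -
  let ?P = "{\<rho>. \<rho> permutes {1..n}}"
  have M': "\<And>i j. i \<in> {1..n} \<Longrightarrow> j \<in> {1..n} \<Longrightarrow> M j i \<in> carrier R" using M .
  have img: "?P = Hilbert_Choice.inv ` ?P"
    using permutes_inv permutes_inv_inv by (fastforce simp: image_iff)
  have inj: "inj_on Hilbert_Choice.inv ?P" by (metis (mono_tags) inj_onI mem_Collect_eq permutes_inv_inv)
  have "ring_det R n (\<lambda>i j. M j i) = (\<Oplus>\<rho>\<in>Hilbert_Choice.inv ` ?P. [sign \<rho>] \<cdot> (\<Otimes>i\<in>{1..n}. M (\<rho> i) i))"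
    unfolding ring_det_def img[symmetric] ..
  also have "\<dots> = (\<Oplus>\<rho>\<in>?P. [sign (Hilbert_Choice.inv \<rho>)] \<cdot> (\<Otimes>i\<in>{1..n}. M (Hilbert_Choice.inv \<rho> i) i))"
    using inj det_term_closed[of n "\<lambda>i j. M j i"] M' img by (intro finsum_reindex) blast+
  also have "\<dots> = (\<Oplus>\<rho>\<in>?P. [sign \<rho>] \<cdot> (\<Otimes>i\<in>{1..n}. M i (\<rho> i)))"
  proof (intro finsum_cong')
    fix \<rho> assume "\<rho> \<in> ?P"
    hence s: "\<rho> permutes {1..n}" by simp
    have "(\<Otimes>i\<in>\<rho> ` {1..n}. M (Hilbert_Choice.inv \<rho> i) i) = (\<Otimes>i\<in>{1..n}. M (Hilbert_Choice.inv \<rho> (\<rho> i)) (\<rho> i))"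
      using s M permutes_in_image[OF s] permutes_inj_on[OF s]
      by (intro finprod_reindex) (auto simp: permutes_inverses[OF s])
    thus "[sign (Hilbert_Choice.inv \<rho>)] \<cdot> (\<Otimes>i\<in>{1..n}. M (Hilbert_Choice.inv \<rho> i) i) = [sign \<rho>] \<cdot> (\<Otimes>i\<in>{1..n}. M i (\<rho> i))"
      using s by (simp add: permutes_image permutes_inverses[OF s] sign_inverse permutes_imp_permutation[of "{1..n}"])
  qed (use det_term_closed[of n M] M in auto)
  finally show ?thesis unfolding ring_det_def .
qed

text \<open>The signed minor, written as the determinant with row \<open>p\<close> replaced by the
  \<open>i\<close>-th unit row. No index has to be deleted and no sign computed, and ring
  homomorphisms and row permutations carry it to a quantity of the same kind.\<close>

definition cofactor :: "nat \<Rightarrow> (nat \<Rightarrow> nat \<Rightarrow> 'a) \<Rightarrow> nat \<Rightarrow> nat \<Rightarrow> 'a" where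
  "cofactor n M p i = ring_det R n (M(p := (\<lambda>j. if j = i then \<one> else \<zero>)))"

lemma cofactor_closed:
  assumes "\<And>i j. i \<in> {1..n} \<Longrightarrow> j \<in> {1..n} \<Longrightarrow> M i j \<in> carrier R"
  shows "cofactor n M p i \<in> carrier R"
  unfolding cofactor_def using assms by (intro ring_det_closed) auto

text \<open>Row linearity read backwards: the unit rows weighted by \<open>M q i\<close> add up to
  row \<open>q\<close>. So the sum is the determinant of \<open>M\<close> with row \<open>p\<close>
  overwritten by row \<open>q\<close>, which has two equal rows unless \<open>p = q\<close>.\<close>

lemma cofactor_row:
  assumes M: "\<And>i j. i \<in> {1..n} \<Longrightarrow> j \<in> {1..n} \<Longrightarrow> M i j \<in> carrier R" and pq: "p \<in> {1..n}" "q \<in> {1..n}"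
  shows "(\<Oplus>i\<in>{1..n}. M q i \<otimes> cofactor n M p i) = (if p = q then ring_det R n M else \<zero>)"
proof -
  have "(\<Oplus>i\<in>{1..n}. M q i \<otimes> cofactor n M p i)
      = ring_det R n (M(p := (\<lambda>j. \<Oplus>i\<in>{1..n}. M q i \<otimes> (if j = i then \<one> else \<zero>))))"
    unfolding cofactor_def using M pq by (intro ring_det_row_finsum[symmetric]) auto
  also have "\<dots> = ring_det R n (M(p := M q))"
  proof (rule ring_det_cong)
    fix i j assume ij: "i \<in> {1..n}" "j \<in> {1..n}"
    have "(\<Oplus>i\<in>{1..n}. M q i \<otimes> (if j = i then \<one> else \<zero>)) = (\<Oplus>i\<in>{1..n}. if i = j then M q i else \<zero>)"
      using M pq by (intro finsum_cong') auto
    also have "\<dots> = M q j" using M pq ij by (intro finsum_delta) auto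
    finally show "(M(p := (\<lambda>j. \<Oplus>i\<in>{1..n}. M q i \<otimes> (if j = i then \<one> else \<zero>)))) i j = (M(p := M q)) i j"
      by simp
    show "(M(p := M q)) i j \<in> carrier R" using M pq ij by simp
  qed
  also have "\<dots> = (if p = q then ring_det R n M else \<zero>)"
    using M pq ring_det_identical_rows[of n "M(p := M q)" p q] by auto
  finally show ?thesis .
qed

text \<open>\<open>?u\<close> has a unit row in place of row \<open>p\<close>, \<open>?v\<close> a
  unit column in place of column \<open>i\<close>; elsewhere both keep the entries of
  \<open>M\<close>. Their determinants agree term by term: if \<open>\<rho> p = i\<close>, the two
  products have the same factors; otherwise \<open>?u\<close> contributes a zero from row
  \<open>p\<close> and \<open>?v\<close> a zero from column \<open>i\<close>.\<close>

lemma cofactor_transpose: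
  assumes M: "\<And>i j. i \<in> {1..n} \<Longrightarrow> j \<in> {1..n} \<Longrightarrow> M i j \<in> carrier R" and "p \<in> {1..n}" "i \<in> {1..n}"
  shows "cofactor n (\<lambda>i j. M j i) i p = cofactor n M p i"
proof -
  let ?u = "\<lambda>k j. (M(p := (\<lambda>j. if j = i then \<one> else \<zero>))) k j"
  let ?v = "\<lambda>k j. ((\<lambda>i j. M j i)(i := (\<lambda>j. if j = p then \<one> else \<zero>))) j k"
  have uv: "\<And>k j. k \<in> {1..n} \<Longrightarrow> j \<in> {1..n} \<Longrightarrow> ?u k j \<in> carrier R"
    "\<And>k j. k \<in> {1..n} \<Longrightarrow> j \<in> {1..n} \<Longrightarrow> ?v k j \<in> carrier R" using M by auto
  have prod0: "(\<Otimes>k\<in>{1..n}. g k) = \<zero>" if "k \<in> {1..n}" "g k = \<zero>" "\<And>k. k \<in> {1..n} \<Longrightarrow> g k \<in> carrier R" for g k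
  proof -
    have "(\<Otimes>k\<in>insert k ({1..n} - {k}). g k) = g k \<otimes> (\<Otimes>k\<in>{1..n} - {k}. g k)"
      using that by (intro finprod_insert) auto
    moreover have "(\<Otimes>k\<in>{1..n} - {k}. g k) \<in> carrier R" using that by (intro finprod_closed) auto
    ultimately show ?thesis using that by (simp add: insert_absorb)
  qed
  have "cofactor n (\<lambda>i j. M j i) i p = ring_det R n ?v"
    unfolding cofactor_def using M by (intro ring_det_transpose[symmetric]) auto
  also have "\<dots> = ring_det R n ?u"
    unfolding ring_det_def
  proof (intro finsum_cong')
    fix \<rho> assume "\<rho> \<in> {\<rho>. \<rho> permutes {1..n}}"
    hence s: "\<rho> permutes {1..n}" by simp
    note sI = permutes_in_image[OF s]
    have "(\<Otimes>k\<in>{1..n}. ?v k (\<rho> k)) = (\<Otimes>k\<in>{1..n}. ?u k (\<rho> k))"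
    proof (cases "\<rho> p = i")
      case True
      show ?thesis
      proof (rule finprod_cong')
        fix k assume "k \<in> {1..n}"
        show "?v k (\<rho> k) = ?u k (\<rho> k)"
          using True injD[OF permutes_inj[OF s], of k p] by (cases "k = p") auto
      qed (use uv sI in auto)
    next
      case False
      have "(\<Otimes>k\<in>{1..n}. ?u k (\<rho> k)) = \<zero>" using False assms(2) uv sI by (intro prod0[of p]) auto
      moreover have "Hilbert_Choice.inv \<rho> i \<in> {1..n}" using assms(3) permutes_in_image[OF permutes_inv[OF s]] by blast
      hence "(\<Otimes>k\<in>{1..n}. ?v k (\<rho> k)) = \<zero>"
        using False uv(2) sI permutes_inverses[OF s] by (intro prod0[of "Hilbert_Choice.inv \<rho> i"]) auto
      ultimately show ?thesis by simp
    qed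
    thus "[sign \<rho>] \<cdot> (\<Otimes>k\<in>{1..n}. ?v k (\<rho> k)) = [sign \<rho>] \<cdot> (\<Otimes>k\<in>{1..n}. ?u k (\<rho> k))" by simp
  qed (use det_term_closed[of n ?u] uv in auto)
  also have "\<dots> = cofactor n M p i" unfolding cofactor_def ..
  finally show ?thesis .
qed

lemma cofactor_column:
  assumes M: "\<And>i j. i \<in> {1..n} \<Longrightarrow> j \<in> {1..n} \<Longrightarrow> M i j \<in> carrier R" and ij: "i \<in> {1..n}" "j \<in> {1..n}"
  shows "(\<Oplus>p\<in>{1..n}. M p j \<otimes> cofactor n M p i) = (if i = j then ring_det R n M else \<zero>)"
proof -
  have "(\<Oplus>p\<in>{1..n}. M p j \<otimes> cofactor n M p i) = (\<Oplus>p\<in>{1..n}. M p j \<otimes> cofactor n (\<lambda>i j. M j i) i p)"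
    using assms cofactor_transpose[of n M] cofactor_closed[of n M]
    by (intro finsum_cong') auto
  also have "\<dots> = (if i = j then ring_det R n (\<lambda>i j. M j i) else \<zero>)"
    using assms by (intro cofactor_row[of n "\<lambda>i j. M j i"]) auto
  finally show ?thesis using ring_det_transpose[of n M] M by simp
qed

lemma ring_det_gram:
  assumes M: "\<And>i j. i \<in> {1..n} \<Longrightarrow> j \<in> {1..n} \<Longrightarrow> M i j \<in> carrier R"
  shows "ring_det R n (\<lambda>i j. \<Oplus>p\<in>{1..n}. M p i \<otimes> M p j) = ring_det R n M \<otimes> ring_det R n M"
  using ring_det_mult[of n "\<lambda>i j. M j i" M] ring_det_transpose[of n M] M by simp

end

text \<open>Applied to the permutations acting on the tensor power, to localization, and to the
  inclusion of a ring of invariants, which lets a determinant over that subring be computed in the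
  whole tensor power.\<close>

lemma (in ring_hom_cring) hom_ring_det:
  assumes M: "\<And>i j. i \<in> {1..n} \<Longrightarrow> j \<in> {1..n} \<Longrightarrow> M i j \<in> carrier R"
  shows "h (ring_det R n M) = ring_det S n (\<lambda>i j. h (M i j))"
proof -
  have "h (ring_det R n M) = (\<Oplus>\<^bsub>S\<^esub>\<rho>\<in>{\<rho>. \<rho> permutes {1..n}}. h ([sign \<rho>] \<cdot> (\<Otimes>i\<in>{1..n}. M i (\<rho> i))))"
    unfolding ring_det_def using R.det_term_closed[of n M] M by (subst hom_finsum) (auto simp: o_def)
  also have "\<dots> = ring_det S n (\<lambda>i j. h (M i j))"
    unfolding ring_det_def
  proof (intro S.finsum_cong')
    fix \<rho> assume "\<rho> \<in> {\<rho>. \<rho> permutes {1..n}}"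
    hence s: "\<rho> permutes {1..n}" by simp
    have "h (\<Otimes>i\<in>{1..n}. M i (\<rho> i)) = (\<Otimes>\<^bsub>S\<^esub>i\<in>{1..n}. h (M i (\<rho> i)))"
      using M permutes_in_image[OF s] by (subst hom_finprod) (auto simp: o_def)
    moreover have "(\<Otimes>\<^bsub>S\<^esub>i\<in>{1..n}. h (M i (\<rho> i))) \<in> carrier S"
      using M permutes_in_image[OF s] by (intro S.finprod_closed) auto
    ultimately show "h ([sign \<rho>] \<cdot> (\<Otimes>i\<in>{1..n}. M i (\<rho> i))) = [sign \<rho>] \<cdot>\<^bsub>S\<^esub> (\<Otimes>\<^bsub>S\<^esub>i\<in>{1..n}. h (M i (\<rho> i)))"
      using R.det_term_closed[of n M] M s by (simp add: R.add_pow_sign S.add_pow_sign)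
  qed (use M S.det_term_closed[of n "\<lambda>i j. h (M i j)"] in auto)
  finally show ?thesis .
qed


section \<open>Localization\<close>

locale localization_at = cring B for B (structure) +
  fixes f
  assumes f_closed: "f \<in> carrier B"
begin

abbreviation S where "S \<equiv> powers_of B f"
abbreviation L where "L \<equiv> localization B f"
abbreviation frac where "frac \<equiv> loc_frac B f"

lemma powers_closed [simp, intro]: "s \<in> S \<Longrightarrow> s \<in> carrier B"
  using f_closed by (auto simp: powers_of_def)

lemma one_powers [simp]: "\<one> \<in> S"
  unfolding powers_of_def by (metis nat_pow_0 rangeI)

lemma f_powers [simp]: "f \<in> S"
  unfolding powers_of_def using f_closed by (metis nat_pow_eone rangeI)

lemma mult_powers [simp, intro]: "s \<in> S \<Longrightarrow> t \<in> S \<Longrightarrow> s \<otimes> t \<in> S"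
  unfolding powers_of_def using f_closed by (auto simp: nat_pow_mult)

lemma frac_mem_iff:
  "(r', s') \<in> frac r s \<longleftrightarrow> r' \<in> carrier B \<and> s' \<in> S \<and> (\<exists>t\<in>S. t \<otimes> (s' \<otimes> r) = t \<otimes> (s \<otimes> r'))"
  by (simp add: loc_frac_def)

lemma frac_self: "r \<in> carrier B \<Longrightarrow> s \<in> S \<Longrightarrow> (r, s) \<in> frac r s"
  unfolding frac_mem_iff by (auto intro!: bexI[OF _ one_powers])

text \<open>This is transitivity of the equivalence of fractions. Denominators may be zero divisors,
  so the witnessing factor for the result is the product of both given witnesses \<open>u\<close>,
  \<open>t\<close> and the middle denominator \<open>s\<close>.\<close>

lemma frac_subset:
  assumes c: "r \<in> carrier B" "s \<in> S" "r' \<in> carrier B" "s' \<in> S"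
    and t: "t \<in> S" "t \<otimes> (s' \<otimes> r) = t \<otimes> (s \<otimes> r')"
  shows "frac r s \<subseteq> frac r' s'"
proof (intro subrelI)
  fix a b assume "(a, b) \<in> frac r s"
  then obtain u where ab: "a \<in> carrier B" "b \<in> S" "u \<in> S" "u \<otimes> (b \<otimes> r) = u \<otimes> (s \<otimes> a)"
    by (auto simp: frac_mem_iff)
  have "(u \<otimes> t \<otimes> s) \<otimes> (b \<otimes> r') = (u \<otimes> b) \<otimes> (t \<otimes> (s \<otimes> r'))"
    using c t(1) ab by (simp add: m_ac)
  also have "\<dots> = (u \<otimes> b) \<otimes> (t \<otimes> (s' \<otimes> r))" using t(2) by simp
  also have "\<dots> = (t \<otimes> s') \<otimes> (u \<otimes> (b \<otimes> r))" using c t(1) ab(1-3) by (simp add: m_ac)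
  also have "\<dots> = (t \<otimes> s') \<otimes> (u \<otimes> (s \<otimes> a))" using ab(4) by simp
  also have "\<dots> = (u \<otimes> t \<otimes> s) \<otimes> (s' \<otimes> a)" using c t(1) ab(1-3) by (simp add: m_ac)
  finally show "(a, b) \<in> frac r' s'" using ab t c unfolding frac_mem_iff by blast
qed

lemma frac_eq_iff:
  assumes "r \<in> carrier B" "s \<in> S" "r' \<in> carrier B" "s' \<in> S"
  shows "frac r s = frac r' s' \<longleftrightarrow> (\<exists>t\<in>S. t \<otimes> (s' \<otimes> r) = t \<otimes> (s \<otimes> r'))"
proof
  assume "frac r s = frac r' s'"
  thus "\<exists>t\<in>S. t \<otimes> (s' \<otimes> r) = t \<otimes> (s \<otimes> r')" using frac_self[OF assms(3,4)] frac_mem_iff by blast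
next
  assume "\<exists>t\<in>S. t \<otimes> (s' \<otimes> r) = t \<otimes> (s \<otimes> r')"
  then obtain t where "t \<in> S" "t \<otimes> (s' \<otimes> r) = t \<otimes> (s \<otimes> r')" by blast
  thus "frac r s = frac r' s'" using frac_subset assms by (metis subset_antisym)
qed

lemma frac_eqI:
  assumes "r \<in> carrier B" "s \<in> S" "r' \<in> carrier B" "s' \<in> S" "s' \<otimes> r = s \<otimes> r'"
  shows "frac r s = frac r' s'"
  unfolding frac_eq_iff[OF assms(1-4)] using assms(5) by (intro bexI[OF _ one_powers]) simp

lemma frac_closed [simp, intro]: "r \<in> carrier B \<Longrightarrow> s \<in> S \<Longrightarrow> frac r s \<in> carrier L"
  by (auto simp: localization_def)

lemma loc_carrierE:
  assumes "z \<in> carrier L"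
  obtains r s where "r \<in> carrier B" "s \<in> S" "z = frac r s"
  using assms by (auto simp: localization_def)

text \<open>The product is a union of classes over all pairs of representatives. By
  \<open>eq\<close> these classes coincide, and by \<open>frac_self\<close> there is at least one
  pair, so the union collapses to a single class. Sums are treated in the same way.\<close>

lemma frac_mult:
  assumes "r \<in> carrier B" "s \<in> S" "r' \<in> carrier B" "s' \<in> S"
  shows "frac r s \<otimes>\<^bsub>L\<^esub> frac r' s' = frac (r \<otimes> r') (s \<otimes> s')"
proof -
  have eq: "frac (a \<otimes> a') (b \<otimes> b') = frac (r \<otimes> r') (s \<otimes> s')"
    if h: "(a, b) \<in> frac r s" "(a', b') \<in> frac r' s'" for a b a' b'
  proof -
    obtain t where t: "a \<in> carrier B" "b \<in> S" "t \<in> S" "t \<otimes> (b \<otimes> r) = t \<otimes> (s \<otimes> a)"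
      using h by (auto simp: frac_mem_iff)
    obtain t' where t': "a' \<in> carrier B" "b' \<in> S" "t' \<in> S" "t' \<otimes> (b' \<otimes> r') = t' \<otimes> (s' \<otimes> a')"
      using h by (auto simp: frac_mem_iff)
    have "(t \<otimes> t') \<otimes> ((s \<otimes> s') \<otimes> (a \<otimes> a')) = (t \<otimes> (s \<otimes> a)) \<otimes> (t' \<otimes> (s' \<otimes> a'))"
      using t(1-3) t'(1-3) assms by (simp add: m_ac)
    also have "\<dots> = (t \<otimes> (b \<otimes> r)) \<otimes> (t' \<otimes> (b' \<otimes> r'))" using t(4) t'(4) by simp
    also have "\<dots> = (t \<otimes> t') \<otimes> ((b \<otimes> b') \<otimes> (r \<otimes> r'))"
      using t(1-3) t'(1-3) assms by (simp add: m_ac)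
    finally show ?thesis using t(1-3) t'(1-3) assms by (subst frac_eq_iff) auto
  qed
  have "frac r s \<otimes>\<^bsub>L\<^esub> frac r' s' = (\<Union>(r, s)\<in>frac r s. \<Union>(r', s')\<in>frac r' s'. frac (r \<otimes> r') (s \<otimes> s'))"
    by (simp add: localization_def)
  also have "\<dots> = frac (r \<otimes> r') (s \<otimes> s')"
    using frac_self[OF assms(1,2)] frac_self[OF assms(3,4)] eq by blast
  finally show ?thesis .
qed

lemma frac_add:
  assumes "r \<in> carrier B" "s \<in> S" "r' \<in> carrier B" "s' \<in> S"
  shows "frac r s \<oplus>\<^bsub>L\<^esub> frac r' s' = frac (s' \<otimes> r \<oplus> s \<otimes> r') (s \<otimes> s')"
proof -
  have eq: "frac (b' \<otimes> a \<oplus> b \<otimes> a') (b \<otimes> b') = frac (s' \<otimes> r \<oplus> s \<otimes> r') (s \<otimes> s')"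
    if h: "(a, b) \<in> frac r s" "(a', b') \<in> frac r' s'" for a b a' b'
  proof -
    obtain t where t: "a \<in> carrier B" "b \<in> S" "t \<in> S" "t \<otimes> (b \<otimes> r) = t \<otimes> (s \<otimes> a)"
      using h by (auto simp: frac_mem_iff)
    obtain t' where t': "a' \<in> carrier B" "b' \<in> S" "t' \<in> S" "t' \<otimes> (b' \<otimes> r') = t' \<otimes> (s' \<otimes> a')"
      using h by (auto simp: frac_mem_iff)
    have "(t \<otimes> t') \<otimes> ((s \<otimes> s') \<otimes> (b' \<otimes> a \<oplus> b \<otimes> a'))
        = (t' \<otimes> s' \<otimes> b') \<otimes> (t \<otimes> (s \<otimes> a)) \<oplus> (t \<otimes> s \<otimes> b) \<otimes> (t' \<otimes> (s' \<otimes> a'))"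
      using t(1-3) t'(1-3) assms by (simp add: m_ac r_distr)
    also have "\<dots> = (t' \<otimes> s' \<otimes> b') \<otimes> (t \<otimes> (b \<otimes> r)) \<oplus> (t \<otimes> s \<otimes> b) \<otimes> (t' \<otimes> (b' \<otimes> r'))"
      using t(4) t'(4) by simp
    also have "\<dots> = (t \<otimes> t') \<otimes> ((b \<otimes> b') \<otimes> (s' \<otimes> r \<oplus> s \<otimes> r'))"
      using t(1-3) t'(1-3) assms by (simp add: m_ac r_distr)
    finally show ?thesis using t(1-3) t'(1-3) assms by (subst frac_eq_iff) auto
  qed
  have "frac r s \<oplus>\<^bsub>L\<^esub> frac r' s' = (\<Union>(r, s)\<in>frac r s. \<Union>(r', s')\<in>frac r' s'. frac (s' \<otimes> r \<oplus> s \<otimes> r') (s \<otimes> s'))"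
    by (simp add: localization_def)
  also have "\<dots> = frac (s' \<otimes> r \<oplus> s \<otimes> r') (s \<otimes> s')"
    using frac_self[OF assms(1,2)] frac_self[OF assms(3,4)] eq by blast
  finally show ?thesis .
qed

lemma frac_zero: "s \<in> S \<Longrightarrow> frac \<zero> s = \<zero>\<^bsub>L\<^esub>"
  by (simp add: localization_def frac_eqI)

lemma frac_one: "s \<in> S \<Longrightarrow> frac s s = \<one>\<^bsub>L\<^esub>"
  by (simp add: localization_def frac_eqI)

lemma frac_eq_zero_iff:
  assumes "r \<in> carrier B" "s \<in> S"
  shows "frac r s = \<zero>\<^bsub>L\<^esub> \<longleftrightarrow> (\<exists>t\<in>S. t \<otimes> r = \<zero>)"
  unfolding frac_zero[OF one_powers, symmetric] using assms by (subst frac_eq_iff) auto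

lemma cring_localization: "cring L"
proof (intro cringI abelian_groupI comm_monoidI)
  fix x y assume "x \<in> carrier L" "y \<in> carrier L"
  then obtain r s r' s' where *: "r \<in> carrier B" "s \<in> S" "x = frac r s" "r' \<in> carrier B" "s' \<in> S" "y = frac r' s'"
    by (elim loc_carrierE)
  show "x \<oplus>\<^bsub>L\<^esub> y \<in> carrier L" "x \<otimes>\<^bsub>L\<^esub> y \<in> carrier L" "x \<otimes>\<^bsub>L\<^esub> y = y \<otimes>\<^bsub>L\<^esub> x" "x \<oplus>\<^bsub>L\<^esub> y = y \<oplus>\<^bsub>L\<^esub> x"
    using * by (simp_all add: frac_add frac_mult m_comm a_comm)
next
  fix x assume "x \<in> carrier L"
  then obtain r s where *: "r \<in> carrier B" "s \<in> S" "x = frac r s" by (elim loc_carrierE)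
  show "\<one>\<^bsub>L\<^esub> \<otimes>\<^bsub>L\<^esub> x = x" "\<zero>\<^bsub>L\<^esub> \<oplus>\<^bsub>L\<^esub> x = x"
    using * frac_one[OF one_powers] frac_zero[OF one_powers]
      frac_mult[OF one_closed one_powers] frac_add[OF zero_closed one_powers] by (metis l_one l_zero one_powers powers_closed zero_closed r_null, metis l_one l_zero powers_closed r_null)
  have "frac (\<ominus> r) s \<oplus>\<^bsub>L\<^esub> x = frac (s \<otimes> \<ominus> r \<oplus> s \<otimes> r) (s \<otimes> s)" using * by (simp add: frac_add)
  also have "s \<otimes> \<ominus> r \<oplus> s \<otimes> r = \<zero>" using * by (simp add: l_neg r_minus)
  finally have "frac (\<ominus> r) s \<oplus>\<^bsub>L\<^esub> x = \<zero>\<^bsub>L\<^esub>" using * by (simp add: frac_zero)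
  thus "\<exists>y\<in>carrier L. y \<oplus>\<^bsub>L\<^esub> x = \<zero>\<^bsub>L\<^esub>" using * by blast
next
  fix x y z assume "x \<in> carrier L" "y \<in> carrier L" "z \<in> carrier L"
  then obtain r s r' s' r'' s'' where *: "r \<in> carrier B" "s \<in> S" "x = frac r s"
    "r' \<in> carrier B" "s' \<in> S" "y = frac r' s'" "r'' \<in> carrier B" "s'' \<in> S" "z = frac r'' s''"
    by (elim loc_carrierE)
  show "x \<oplus>\<^bsub>L\<^esub> y \<oplus>\<^bsub>L\<^esub> z = x \<oplus>\<^bsub>L\<^esub> (y \<oplus>\<^bsub>L\<^esub> z)" "x \<otimes>\<^bsub>L\<^esub> y \<otimes>\<^bsub>L\<^esub> z = x \<otimes>\<^bsub>L\<^esub> (y \<otimes>\<^bsub>L\<^esub> z)"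
    using * by (simp_all add: frac_add frac_mult m_ac a_ac r_distr)
  show "(x \<oplus>\<^bsub>L\<^esub> y) \<otimes>\<^bsub>L\<^esub> z = x \<otimes>\<^bsub>L\<^esub> z \<oplus>\<^bsub>L\<^esub> y \<otimes>\<^bsub>L\<^esub> z"
    using * by (simp add: frac_add frac_mult) (rule frac_eqI; simp add: m_ac r_distr l_distr)
qed (use frac_closed[OF zero_closed one_powers] frac_closed[OF one_closed one_powers]
       frac_zero[OF one_powers] frac_one[OF one_powers] in auto)

sublocale L: cring "localization B f"
  by (rule cring_localization)

lemma frac_add_same:
  assumes "r \<in> carrier B" "r' \<in> carrier B" "s \<in> S"
  shows "frac r s \<oplus>\<^bsub>L\<^esub> frac r' s = frac (r \<oplus> r') s"
  using assms by (simp add: frac_add) (rule frac_eqI; simp add: m_ac r_distr)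

lemma frac_finsum:
  assumes "finite I" "\<And>i. i \<in> I \<Longrightarrow> r i \<in> carrier B" "s \<in> S"
  shows "(\<Oplus>\<^bsub>L\<^esub>i\<in>I. frac (r i) s) = frac (\<Oplus>i\<in>I. r i) s"
  using assms(1,2)
proof (induction I rule: finite_induct)
  case empty
  show ?case using frac_zero[OF assms(3)] by simp
next
  case (insert i I)
  thus ?case using assms(3) by (simp add: frac_add_same Pi_iff)
qed

lemma frac_mult_one:
  assumes "r \<in> carrier B" "s \<in> S" "r' \<in> carrier B"
  shows "frac r s \<otimes>\<^bsub>L\<^esub> frac r' \<one> = frac (r \<otimes> r') s"
  using assms by (simp add: frac_mult)

text \<open>Lets a linear relation over the localization be rewritten as a relation between
  numerators. When a fraction is added to the family, the old numerators are multiplied by its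
  denominator \<open>s'\<close> and its numerator by the old denominator \<open>s\<close>.\<close>

lemma common_denominator:
  assumes "finite I" "\<And>i. i \<in> I \<Longrightarrow> c i \<in> carrier L"
  shows "\<exists>s\<in>S. \<exists>r. \<forall>i\<in>I. r i \<in> carrier B \<and> c i = frac (r i) s"
  using assms
proof (induction I rule: finite_induct)
  case empty
  show ?case by (intro bexI[OF _ one_powers]) simp
next
  case (insert i I)
  then obtain s r where s: "s \<in> S" and r: "\<And>i. i \<in> I \<Longrightarrow> r i \<in> carrier B \<and> c i = frac (r i) s"
    by force
  have "c i \<in> carrier L" using insert.prems by simp
  then obtain r' s' where *: "r' \<in> carrier B" "s' \<in> S" "c i = frac r' s'"
    by (rule loc_carrierE)
  let ?r = "\<lambda>j. if j = i then s \<otimes> r' else s' \<otimes> r j"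
  have "?r j \<in> carrier B \<and> c j = frac (?r j) (s \<otimes> s')" if "j \<in> insert i I" for j
  proof (cases "j = i")
    case True
    thus ?thesis using s * by (simp, intro frac_eqI) (auto simp: m_ac)
  next
    case False
    thus ?thesis using s * r[of j] that by (simp, intro frac_eqI) (auto simp: m_ac)
  qed
  thus ?case using s * by (intro bexI[of _ "s \<otimes> s'"] exI[of _ ?r]) auto
qed

lemma to_loc_hom: "ring_hom_cring B L (to_loc B f)"
proof (intro ring_hom_cringI ring_hom_memI)
  show "cring B" by (rule cring_axioms)
  show "cring L" by (rule cring_localization)
qed (auto simp: to_loc_def frac_mult frac_add frac_one frac_closed)

end

section \<open>Localization of the inclusion of a subring\<close>

lemma ring_hom_cring_id_subring:
  assumes "cring E" "cring (E\<lparr>carrier := K\<rparr>)" "K \<subseteq> carrier E"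
  shows "ring_hom_cring (E\<lparr>carrier := K\<rparr>) E (\<lambda>z. z)"
  using assms by (intro ring_hom_cringI ring_hom_memI) auto

text \<open>Restricting the carrier leaves product and unit unchanged. Hence the fraction classes
  over the subring and over \<open>E\<close> share their denominators and their witnessing
  factors.\<close>

lemma powers_of_carrier_update [simp]: "powers_of (E\<lparr>carrier := K\<rparr>) f = powers_of E f"
  by (simp add: powers_of_def nat_pow_def)

text \<open>The subring is \<open>E\<close> with a smaller carrier, so its operations are literally
  those of \<open>E\<close>. That \<open>f\<close> lies in \<open>K\<close> is the content of the
  second \<open>localization_at\<close>.\<close>

locale localized_subring = E: localization_at E f + B: localization_at "E\<lparr>carrier := K\<rparr>" f
  for E (structure) and K f +
  assumes K_subset: "K \<subseteq> carrier E"
begin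

text \<open>The members of a class over the subring all represent the same fraction over
  \<open>E\<close>, because the power of \<open>f\<close> that witnesses an equality is available in
  both rings. So the union in \<open>loc_inclusion\<close> is a single class.\<close>

lemma loc_inclusion_frac:
  assumes "r \<in> K" "s \<in> powers_of E f"
  shows "loc_inclusion E f (loc_frac (E\<lparr>carrier := K\<rparr>) f r s) = loc_frac E f r s"
proof -
  have eq: "loc_frac E f a b = loc_frac E f r s" if ab: "(a, b) \<in> loc_frac (E\<lparr>carrier := K\<rparr>) f r s" for a b
  proof -
    from ab obtain t where "a \<in> K" "b \<in> powers_of E f" "t \<in> powers_of E f" "t \<otimes> (b \<otimes> r) = t \<otimes> (s \<otimes> a)"
      by (auto simp: loc_frac_def)
    thus ?thesis using assms K_subset by (subst E.frac_eq_iff) (auto intro: sym)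
  qed
  moreover have "(r, s) \<in> loc_frac (E\<lparr>carrier := K\<rparr>) f r s" using B.frac_self[of r s] assms by simp
  ultimately show ?thesis unfolding loc_inclusion_def by blast
qed

lemma loc_inclusion_hom: "ring_hom_cring B.L E.L (loc_inclusion E f)"
proof (intro ring_hom_cringI ring_hom_memI)
  show "cring B.L" "cring E.L" by (rule B.cring_localization E.cring_localization)+
  fix x assume "x \<in> carrier B.L"
  then obtain r s where *: "r \<in> K" "s \<in> powers_of E f" "x = B.frac r s" by (auto elim: B.loc_carrierE)
  show "loc_inclusion E f x \<in> carrier E.L"
    using * K_subset by (auto simp: loc_inclusion_frac)
  fix y assume "y \<in> carrier B.L"
  then obtain r' s' where **: "r' \<in> K" "s' \<in> powers_of E f" "y = B.frac r' s'" by (auto elim: B.loc_carrierE)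
  have rr: "r \<in> carrier E" "r' \<in> carrier E" using * ** K_subset by auto
  have c: "r \<otimes> r' \<in> K" "s' \<otimes> r \<oplus> s \<otimes> r' \<in> K" "s \<otimes> s' \<in> powers_of E f"
    using B.m_closed[of r r'] B.a_closed[of "s' \<otimes> r" "s \<otimes> r'"] B.m_closed[of s' r] B.m_closed[of s r']
      B.powers_closed[of s] B.powers_closed[of s'] * ** by auto
  show "loc_inclusion E f (x \<otimes>\<^bsub>B.L\<^esub> y) = loc_inclusion E f x \<otimes>\<^bsub>E.L\<^esub> loc_inclusion E f y"
    using * ** c rr B.frac_mult[of r s r' s'] by (simp add: loc_inclusion_frac E.frac_mult)
  show "loc_inclusion E f (x \<oplus>\<^bsub>B.L\<^esub> y) = loc_inclusion E f x \<oplus>\<^bsub>E.L\<^esub> loc_inclusion E f y"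
    using * ** c rr B.frac_add[of r s r' s'] by (simp add: loc_inclusion_frac E.frac_add)
next
  have "\<one> \<in> K" using B.one_closed by simp
  thus "loc_inclusion E f \<one>\<^bsub>B.L\<^esub> = \<one>\<^bsub>E.L\<^esub>"
    using B.frac_one[of \<one>] E.frac_one[of \<one>] loc_inclusion_frac[of \<one> \<one>] by simp
qed

end


section \<open>Monoid algebras\<close>

locale monoid_algebra_over = A: cring A + G: comm_monoid G
  for A :: "('a, 'k) ring_scheme" (structure) and G :: "('g, 'l) monoid_scheme"
begin

abbreviation F where "F \<equiv> monoid_algebra A G"
abbreviation single where "single \<equiv> monoid_algebra_single A"
definition supp where "supp f = {g. f g \<noteq> \<zero>}"

lemma mem_carrier_iff:
  "f \<in> carrier F \<longleftrightarrow> (\<forall>g. f g \<in> carrier A) \<and> supp f \<subseteq> carrier G \<and> finite (supp f)"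
proof -
  have "(\<forall>g\<in>carrier G. f g \<in> carrier A) \<and> (\<forall>g. g \<notin> carrier G \<longrightarrow> f g = \<zero>)
      \<longleftrightarrow> (\<forall>g. f g \<in> carrier A) \<and> {g. f g \<noteq> \<zero>} \<subseteq> carrier G"
    using A.zero_closed by (metis (mono_tags, lifting) Collect_mono_iff mem_Collect_eq subset_eq)
  thus ?thesis unfolding supp_def by (simp add: monoid_algebra_def) blast
qed

lemma F_add: "f \<oplus>\<^bsub>F\<^esub> f' = (\<lambda>g. f g \<oplus> f' g)"
  and F_zero: "\<zero>\<^bsub>F\<^esub> = (\<lambda>g. \<zero>)"
  and F_one: "\<one>\<^bsub>F\<^esub> = single \<one>\<^bsub>G\<^esub> \<one>"
  by (auto simp: monoid_algebra_def monoid_algebra_single_def)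

lemma F_mult_apply:
  "(f \<otimes>\<^bsub>F\<^esub> f') g = (\<Oplus>p\<in>{(u, v). f u \<noteq> \<zero> \<and> f' v \<noteq> \<zero> \<and> u \<otimes>\<^bsub>G\<^esub> v = g}. f (fst p) \<otimes> f' (snd p))"
  by (simp add: monoid_algebra_def)

lemma carrierD:
  assumes "f \<in> carrier F"
  shows "f g \<in> carrier A" "supp f \<subseteq> carrier G" "finite (supp f)"
  using assms by (auto simp: mem_carrier_iff)

lemmas carrierD_simps [simp] = carrierD(1,3)

lemma notin_supp: "g \<notin> supp f \<Longrightarrow> f g = \<zero>"
  by (simp add: supp_def)

text \<open>The defining sum ranges over a set of pairs that depends on \<open>g\<close>. Spreading
  it over a fixed finite rectangle, with the condition moved into the summand, gives a sum that can
  be exchanged with others.\<close>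

lemma F_mult:
  assumes f: "f \<in> carrier F" "f' \<in> carrier F"
    and U: "finite U" "supp f \<subseteq> U" and V: "finite V" "supp f' \<subseteq> V"
  shows "(f \<otimes>\<^bsub>F\<^esub> f') g = (\<Oplus>p\<in>U \<times> V. if fst p \<otimes>\<^bsub>G\<^esub> snd p = g then f (fst p) \<otimes> f' (snd p) else \<zero>)"
proof -
  let ?D = "{(u, v). f u \<noteq> \<zero> \<and> f' v \<noteq> \<zero> \<and> u \<otimes>\<^bsub>G\<^esub> v = g}"
  have "(f \<otimes>\<^bsub>F\<^esub> f') g = (\<Oplus>p\<in>?D. f (fst p) \<otimes> f' (snd p))"
    by (rule F_mult_apply)
  also have "\<dots> = (\<Oplus>p\<in>U \<times> V. if fst p \<otimes>\<^bsub>G\<^esub> snd p = g then f (fst p) \<otimes> f' (snd p) else \<zero>)"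
  proof (intro A.add.finprod_mono_neutral_cong_left)
    show "?D \<subseteq> U \<times> V" using U V by (auto simp: supp_def)
    fix p assume p: "p \<in> U \<times> V - ?D"
    hence "f (fst p) = \<zero> \<or> f' (snd p) = \<zero> \<or> fst p \<otimes>\<^bsub>G\<^esub> snd p \<noteq> g" by (auto simp: case_prod_beta)
    thus "(if fst p \<otimes>\<^bsub>G\<^esub> snd p = g then f (fst p) \<otimes> f' (snd p) else \<zero>) = \<zero>" using f by auto
  qed (use f U V in auto)
  finally show ?thesis .
qed

lemma supp_mult:
  assumes f: "f \<in> carrier F" "f' \<in> carrier F"
  shows "supp (f \<otimes>\<^bsub>F\<^esub> f') \<subseteq> (\<lambda>p. fst p \<otimes>\<^bsub>G\<^esub> snd p) ` (supp f \<times> supp f')"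
proof (rule subsetI, rule ccontr)
  fix g assume g: "g \<in> supp (f \<otimes>\<^bsub>F\<^esub> f')" and n: "g \<notin> (\<lambda>p. fst p \<otimes>\<^bsub>G\<^esub> snd p) ` (supp f \<times> supp f')"
  have "(f \<otimes>\<^bsub>F\<^esub> f') g = (\<Oplus>p\<in>supp f \<times> supp f'. \<zero>)"
    unfolding F_mult[OF f carrierD(3)[OF f(1)] subset_refl carrierD(3)[OF f(2)] subset_refl]
  proof (intro A.finsum_cong')
    fix p assume "p \<in> supp f \<times> supp f'"
    hence "fst p \<otimes>\<^bsub>G\<^esub> snd p \<noteq> g" using n by blast
    thus "(if fst p \<otimes>\<^bsub>G\<^esub> snd p = g then f (fst p) \<otimes> f' (snd p) else \<zero>) = \<zero>" by simp
  qed auto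
  thus False using g by (simp add: supp_def)
qed

lemma F_mult_closed:
  assumes f: "f \<in> carrier F" "f' \<in> carrier F"
  shows "f \<otimes>\<^bsub>F\<^esub> f' \<in> carrier F"
  unfolding mem_carrier_iff
proof (intro conjI allI)
  fix g
  show "(f \<otimes>\<^bsub>F\<^esub> f') g \<in> carrier A"
    using f by (subst F_mult[of f f' "supp f" "supp f'"]) (auto intro!: A.finsum_closed)
  have "(\<lambda>p. fst p \<otimes>\<^bsub>G\<^esub> snd p) ` (supp f \<times> supp f') \<subseteq> carrier G"
    using subsetD[OF carrierD(2)[OF f(1)]] subsetD[OF carrierD(2)[OF f(2)]] by auto
  thus "supp (f \<otimes>\<^bsub>F\<^esub> f') \<subseteq> carrier G" using supp_mult[OF f] by (rule subset_trans[rotated])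
  show "finite (supp (f \<otimes>\<^bsub>F\<^esub> f'))" using f by (intro finite_subset[OF supp_mult[OF f]]) simp
qed

lemma supp_single: "supp (single g a) \<subseteq> {g}"
  by (auto simp: supp_def monoid_algebra_single_def)

lemma single_closed: "g \<in> carrier G \<Longrightarrow> a \<in> carrier A \<Longrightarrow> single g a \<in> carrier F"
  using supp_single[of g a] finite_subset[OF supp_single[of g a]]
  unfolding mem_carrier_iff by (auto simp: monoid_algebra_single_def)

lemma supp_add: "supp (f \<oplus>\<^bsub>F\<^esub> f') \<subseteq> supp f \<union> supp f'"
  by (auto simp: supp_def F_add)

lemma F_add_closed: "f \<in> carrier F \<Longrightarrow> f' \<in> carrier F \<Longrightarrow> f \<oplus>\<^bsub>F\<^esub> f' \<in> carrier F"
  using supp_add[of f f'] finite_subset[OF supp_add[of f f']]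
  unfolding mem_carrier_iff by (fastforce simp: F_add)

lemma single_mult:
  assumes "u \<in> carrier G" "v \<in> carrier G" "a \<in> carrier A" "b \<in> carrier A"
  shows "single u a \<otimes>\<^bsub>F\<^esub> single v b = single (u \<otimes>\<^bsub>G\<^esub> v) (a \<otimes> b)"
proof
  fix g
  have "(single u a \<otimes>\<^bsub>F\<^esub> single v b) g
      = (\<Oplus>p\<in>{u} \<times> {v}. if fst p \<otimes>\<^bsub>G\<^esub> snd p = g then single u a (fst p) \<otimes> single v b (snd p) else \<zero>)"
    using assms by (intro F_mult single_closed supp_single) auto
  also have "\<dots> = single (u \<otimes>\<^bsub>G\<^esub> v) (a \<otimes> b) g"
    using assms by (auto simp: monoid_algebra_single_def)
  finally show "(single u a \<otimes>\<^bsub>F\<^esub> single v b) g = single (u \<otimes>\<^bsub>G\<^esub> v) (a \<otimes> b) g" .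
qed

end

text \<open>The pairing of \<open>f\<close> with an arbitrary function \<open>\<phi>\<close> on the monoid. For an indicator function
  it returns a coefficient of \<open>f\<close>, for a multiplicative \<open>\<phi>\<close> it is the induced ring homomorphism.\<close>

locale monoid_algebra_eval = monoid_algebra_over A G + E: cring E + h: ring_hom_cring A E h
  for A :: "('a, 'k) ring_scheme" and G :: "('g, 'l) monoid_scheme"
    and E :: "('e, 'm) ring_scheme" (structure) and h
begin

definition ev where "ev \<phi> f = (\<Oplus>g\<in>supp f. h (f g) \<otimes> \<phi> g)"

lemma ev_superset:
  assumes "f \<in> carrier F" "finite U" "supp f \<subseteq> U" "\<phi> \<in> carrier G \<rightarrow> carrier E" "U \<subseteq> carrier G"
  shows "ev \<phi> f = (\<Oplus>g\<in>U. h (f g) \<otimes> \<phi> g)"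
  unfolding ev_def
proof (intro E.add.finprod_mono_neutral_cong_left)
  fix g assume "g \<in> U - supp f"
  hence "f g = \<zero>\<^bsub>A\<^esub>" "\<phi> g \<in> carrier E" using assms notin_supp[of g f] by auto
  thus "h (f g) \<otimes> \<phi> g = \<zero>" by simp
next
  have "\<And>g. g \<in> U \<Longrightarrow> \<phi> g \<in> carrier E" using assms by blast
  thus "(\<lambda>g. h (f g) \<otimes> \<phi> g) \<in> U \<rightarrow> carrier E" using assms(1) by auto
qed (use assms in auto)

lemma ev_closed:
  assumes "f \<in> carrier F" "\<phi> \<in> carrier G \<rightarrow> carrier E"
  shows "ev \<phi> f \<in> carrier E"
proof -
  have "\<And>g. g \<in> supp f \<Longrightarrow> \<phi> g \<in> carrier E" using assms carrierD(2)[OF assms(1)] by blast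
  thus ?thesis unfolding ev_def using assms(1) by (intro E.finsum_closed) auto
qed

lemma ev_add:
  assumes f: "f \<in> carrier F" "f' \<in> carrier F" and p: "\<phi> \<in> carrier G \<rightarrow> carrier E"
  shows "ev \<phi> (f \<oplus>\<^bsub>F\<^esub> f') = ev \<phi> f \<oplus> ev \<phi> f'"
proof -
  let ?U = "supp f \<union> supp f'"
  have U: "finite ?U" "?U \<subseteq> carrier G" using f carrierD(2) by auto
  hence pU: "\<And>g. g \<in> ?U \<Longrightarrow> \<phi> g \<in> carrier E" using p by blast
  have "ev \<phi> (f \<oplus>\<^bsub>F\<^esub> f') = (\<Oplus>g\<in>?U. h ((f \<oplus>\<^bsub>F\<^esub> f') g) \<otimes> \<phi> g)"
    using U p f by (intro ev_superset supp_add F_add_closed)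
  also have "\<dots> = (\<Oplus>g\<in>?U. h (f g) \<otimes> \<phi> g \<oplus> h (f' g) \<otimes> \<phi> g)"
    using pU f by (intro E.finsum_cong') (auto simp: F_add E.l_distr)
  also have "\<dots> = (\<Oplus>g\<in>?U. h (f g) \<otimes> \<phi> g) \<oplus> (\<Oplus>g\<in>?U. h (f' g) \<otimes> \<phi> g)"
    using pU f by (intro E.finsum_addf) auto
  also have "(\<Oplus>g\<in>?U. h (f g) \<otimes> \<phi> g) = ev \<phi> f"
    using U p f by (intro ev_superset[symmetric]) auto
  also have "(\<Oplus>g\<in>?U. h (f' g) \<otimes> \<phi> g) = ev \<phi> f'"
    using U p f by (intro ev_superset[symmetric]) auto
  finally show ?thesis .
qed

text \<open>With \<phi> an arbitrary function, the formula serves two ends: for multiplicative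
  \<phi> the double sum factors, and for \<open>E = A\<close> it tests identities between products
  in the algebra against all functions on \<open>G\<close>.\<close>

lemma ev_mult:
  assumes f: "f \<in> carrier F" "f' \<in> carrier F" and p: "\<phi> \<in> carrier G \<rightarrow> carrier E"
  shows "ev \<phi> (f \<otimes>\<^bsub>F\<^esub> f')
    = (\<Oplus>u\<in>supp f. \<Oplus>v\<in>supp f'. h (f u) \<otimes> h (f' v) \<otimes> \<phi> (u \<otimes>\<^bsub>G\<^esub> v))"
proof -
  let ?UV = "supp f \<times> supp f'" and ?m = "\<lambda>p. fst p \<otimes>\<^bsub>G\<^esub> snd p"
  let ?W = "?m ` ?UV"
  have UV: "finite ?UV" using f by simp
  have sc: "\<And>u. u \<in> supp f \<Longrightarrow> u \<in> carrier G" "\<And>v. v \<in> supp f' \<Longrightarrow> v \<in> carrier G" using f carrierD(2) by blast+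
  have W: "finite ?W" "?W \<subseteq> carrier G" using UV sc by auto
  have pW: "\<phi> w \<in> carrier E" if "w \<in> ?W" for w using p W that by blast
  let ?c = "\<lambda>p. h (f (fst p)) \<otimes> h (f' (snd p))"
  have cc: "?c p \<in> carrier E" for p using f by simp
  have "ev \<phi> (f \<otimes>\<^bsub>F\<^esub> f') = (\<Oplus>w\<in>?W. h ((f \<otimes>\<^bsub>F\<^esub> f') w) \<otimes> \<phi> w)"
    using W p f by (intro ev_superset supp_mult F_mult_closed)
  \<comment> \<open>Each pair is filed under its product \<open>w\<close>; after exchanging the sums
    exactly one \<open>w\<close> survives for every pair.\<close>
  also have "\<dots> = (\<Oplus>w\<in>?W. \<Oplus>p\<in>?UV. if w = ?m p then ?c p \<otimes> \<phi> w else \<zero>)"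
  proof (intro E.finsum_cong')
    fix w assume w: "w \<in> ?W"
    have "h ((f \<otimes>\<^bsub>F\<^esub> f') w) = h (\<Oplus>\<^bsub>A\<^esub>p\<in>?UV. if ?m p = w then f (fst p) \<otimes>\<^bsub>A\<^esub> f' (snd p) else \<zero>\<^bsub>A\<^esub>)"
      using f by (subst F_mult[of f f' "supp f" "supp f'"]) auto
    also have "\<dots> = (\<Oplus>p\<in>?UV. h (if ?m p = w then f (fst p) \<otimes>\<^bsub>A\<^esub> f' (snd p) else \<zero>\<^bsub>A\<^esub>))"
      using f UV by (subst h.hom_finsum) (auto simp: o_def)
    finally have "h ((f \<otimes>\<^bsub>F\<^esub> f') w) \<otimes> \<phi> w
        = (\<Oplus>p\<in>?UV. h (if ?m p = w then f (fst p) \<otimes>\<^bsub>A\<^esub> f' (snd p) else \<zero>\<^bsub>A\<^esub>)) \<otimes> \<phi> w" by simp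
    also have "\<dots> = (\<Oplus>p\<in>?UV. h (if ?m p = w then f (fst p) \<otimes>\<^bsub>A\<^esub> f' (snd p) else \<zero>\<^bsub>A\<^esub>) \<otimes> \<phi> w)"
      using f UV pW[OF w] by (intro E.finsum_ldistr) auto
    also have "\<dots> = (\<Oplus>p\<in>?UV. if w = ?m p then ?c p \<otimes> \<phi> w else \<zero>)"
      using f pW[OF w] by (intro E.finsum_cong') auto
    finally show "h ((f \<otimes>\<^bsub>F\<^esub> f') w) \<otimes> \<phi> w = (\<Oplus>p\<in>?UV. if w = ?m p then ?c p \<otimes> \<phi> w else \<zero>)" .
  qed (use cc pW in \<open>auto intro!: E.finsum_closed\<close>)
  also have "\<dots> = (\<Oplus>p\<in>?UV. \<Oplus>w\<in>?W. if w = ?m p then ?c p \<otimes> \<phi> w else \<zero>)"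
    using UV W cc pW by (intro E.finsum_swap) auto
  also have "\<dots> = (\<Oplus>p\<in>?UV. h (f (fst p)) \<otimes> h (f' (snd p)) \<otimes> \<phi> (fst p \<otimes>\<^bsub>G\<^esub> snd p))"
    using W cc pW by (intro E.finsum_cong' E.finsum_delta) auto
  also have "\<dots> = (\<Oplus>u\<in>supp f. \<Oplus>v\<in>supp f'. h (f u) \<otimes> h (f' v) \<otimes> \<phi> (u \<otimes>\<^bsub>G\<^esub> v))"
    using f sc funcset_mem[OF p] by (intro E.finsum_Times[of "supp f" "supp f'" "\<lambda>u v. h (f u) \<otimes> h (f' v) \<otimes> \<phi> (u \<otimes>\<^bsub>G\<^esub> v)"]) auto
  finally show ?thesis .
qed

lemma ev_single:
  assumes "g \<in> carrier G" "a \<in> carrier A" "\<phi> \<in> carrier G \<rightarrow> carrier E"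
  shows "ev \<phi> (single g a) = h a \<otimes> \<phi> g"
proof -
  have "ev \<phi> (single g a) = (\<Oplus>u\<in>{g}. h (single g a u) \<otimes> \<phi> u)"
    using assms by (intro ev_superset single_closed supp_single) auto
  also have "\<dots> = h (single g a g) \<otimes> \<phi> g"
    using assms single_closed[of g a] funcset_mem[OF assms(3,1)] by (subst E.finsum_insert) auto
  also have "\<dots> = h a \<otimes> \<phi> g" by (simp add: monoid_algebra_single_def)
  finally show ?thesis .
qed

end

section \<open>Ring axioms of the monoid algebra, by pairing with functions\<close>

context monoid_algebra_over
begin

lemma eval_id: "monoid_algebra_eval A G A (\<lambda>a. a)"
  by unfold_locales (auto simp: ring_hom_def)

definition pair where "pair \<phi> f = (\<Oplus>g\<in>supp f. f g \<otimes> \<phi> g)"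

text \<open>Makes the facts about \<open>ev\<close> available inside
  \<open>monoid_algebra_over\<close>, while the monoid algebra is not yet known to be a
  ring.\<close>

lemma pair_eq: "monoid_algebra_eval.ev A A (\<lambda>a. a) = pair"
  by (intro ext) (simp add: monoid_algebra_eval.ev_def[OF eval_id] pair_def)

lemmas pair_superset = monoid_algebra_eval.ev_superset[OF eval_id, unfolded pair_eq]
  and pair_closed = monoid_algebra_eval.ev_closed[OF eval_id, unfolded pair_eq]
  and pair_add = monoid_algebra_eval.ev_add[OF eval_id, unfolded pair_eq]
  and pair_mult' = monoid_algebra_eval.ev_mult[OF eval_id, unfolded pair_eq]
  and pair_single = monoid_algebra_eval.ev_single[OF eval_id, unfolded pair_eq]

lemma coeff_eq_pair:
  assumes "f \<in> carrier F" "g \<in> carrier G"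
  shows "f g = pair (\<lambda>u. if u = g then \<one> else \<zero>) f"
proof -
  have "pair (\<lambda>u. if u = g then \<one> else \<zero>) f = (\<Oplus>u\<in>insert g (supp f). f u \<otimes> (if u = g then \<one> else \<zero>))"
    using assms carrierD(2)[OF assms(1)] by (intro pair_superset) auto
  also have "\<dots> = (\<Oplus>u\<in>insert g (supp f). if u = g then f u else \<zero>)"
    using assms by (intro A.finsum_cong') auto
  also have "\<dots> = f g" using assms by (intro A.finsum_delta) auto
  finally show ?thesis ..
qed

text \<open>Pairing with an indicator function returns a coefficient, so functions on
  \<open>G\<close> separate elements. The laws of the convolution product can therefore be checked
  on pairings, without keeping track of supports.\<close>

lemma F_eqI:
  assumes "f \<in> carrier F" "f' \<in> carrier F" "\<And>\<phi>. \<phi> \<in> carrier G \<rightarrow> carrier A \<Longrightarrow> pair \<phi> f = pair \<phi> f'"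
  shows "f = f'"
proof
  fix g show "f g = f' g"
  proof (cases "g \<in> carrier G")
    case True
    have "(\<lambda>u. if u = g then \<one> else \<zero>) \<in> carrier G \<rightarrow> carrier A" by simp
    thus ?thesis using coeff_eq_pair[OF assms(1) True] coeff_eq_pair[OF assms(2) True] assms(3) by metis
  next
    case False
    hence "g \<notin> supp f" "g \<notin> supp f'" using assms carrierD(2) by blast+
    thus ?thesis by (simp add: supp_def)
  qed
qed

text \<open>A product in the algebra becomes the monoid product inside the argument of \<phi>;
  associativity and the unit law are then those of \<open>G\<close>.\<close>

lemma pair_mult:
  assumes f: "f \<in> carrier F" "f' \<in> carrier F" and p: "\<phi> \<in> carrier G \<rightarrow> carrier A"
  shows "pair \<phi> (f \<otimes>\<^bsub>F\<^esub> f') = pair (\<lambda>u. pair (\<lambda>v. \<phi> (u \<otimes>\<^bsub>G\<^esub> v)) f') f"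
  unfolding pair_mult'[OF assms] unfolding pair_def
proof (intro A.finsum_cong')
  fix u assume "u \<in> supp f"
  hence u: "u \<in> carrier G" using f carrierD(2) by blast
  have c: "\<phi> (u \<otimes>\<^bsub>G\<^esub> v) \<in> carrier A" if "v \<in> supp f'" for v using that u p f(2) carrierD(2)[OF f(2)] by blast
  have "(\<Oplus>v\<in>supp f'. f u \<otimes> f' v \<otimes> \<phi> (u \<otimes>\<^bsub>G\<^esub> v)) = (\<Oplus>v\<in>supp f'. f u \<otimes> (f' v \<otimes> \<phi> (u \<otimes>\<^bsub>G\<^esub> v)))"
    using f c by (intro A.finsum_cong') (auto simp: A.m_assoc)
  also have "\<dots> = f u \<otimes> (\<Oplus>v\<in>supp f'. f' v \<otimes> \<phi> (u \<otimes>\<^bsub>G\<^esub> v))"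
    using f c by (intro A.finsum_rdistr[symmetric]) auto
  finally show "(\<Oplus>v\<in>supp f'. f u \<otimes> f' v \<otimes> \<phi> (u \<otimes>\<^bsub>G\<^esub> v)) = f u \<otimes> (\<Oplus>v\<in>supp f'. f' v \<otimes> \<phi> (u \<otimes>\<^bsub>G\<^esub> v))" .
next
  have "\<phi> (u \<otimes>\<^bsub>G\<^esub> v) \<in> carrier A" if "u \<in> supp f" "v \<in> supp f'" for u v
    using that p f carrierD(2)[OF f(1)] carrierD(2)[OF f(2)] by blast
  thus "(\<lambda>u. f u \<otimes> (\<Oplus>v\<in>supp f'. f' v \<otimes> \<phi> (u \<otimes>\<^bsub>G\<^esub> v))) \<in> supp f \<rightarrow> carrier A"
    using f by (auto intro!: A.finsum_closed)
qed simp

lemma pair_cong: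
  assumes "f \<in> carrier F" "\<And>g. g \<in> carrier G \<Longrightarrow> \<phi> g = \<psi> g" "\<psi> \<in> carrier G \<rightarrow> carrier A"
  shows "pair \<phi> f = pair \<psi> f"
proof -
  have 1: "\<psi> g \<in> carrier A" if "g \<in> supp f" for g using that assms carrierD(2)[OF assms(1)] by blast
  have 2: "\<phi> g = \<psi> g" if "g \<in> supp f" for g using that assms(2) carrierD(2)[OF assms(1)] by blast
  show ?thesis unfolding pair_def
    by (rule A.finsum_cong'[OF refl]) (auto simp: 1 2 assms(1))
qed

lemma F_mult_comm:
  assumes f: "f \<in> carrier F" "f' \<in> carrier F"
  shows "f \<otimes>\<^bsub>F\<^esub> f' = f' \<otimes>\<^bsub>F\<^esub> f"
proof (intro F_eqI F_mult_closed f)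
  fix \<phi> assume p: "\<phi> \<in> carrier G \<rightarrow> carrier A"
  have sc: "\<And>u. u \<in> supp f \<Longrightarrow> u \<in> carrier G" "\<And>v. v \<in> supp f' \<Longrightarrow> v \<in> carrier G" using f carrierD(2) by blast+
  have c: "\<phi> (u \<otimes>\<^bsub>G\<^esub> v) \<in> carrier A" "\<phi> (v \<otimes>\<^bsub>G\<^esub> u) \<in> carrier A"
    if "u \<in> supp f" "v \<in> supp f'" for u v
    using that p sc by blast+
  show "pair \<phi> (f \<otimes>\<^bsub>F\<^esub> f') = pair \<phi> (f' \<otimes>\<^bsub>F\<^esub> f)"
    unfolding pair_mult'[OF f p] pair_mult'[OF f(2,1) p]
  proof (subst A.finsum_swap)
    show "(\<Oplus>v\<in>supp f'. \<Oplus>u\<in>supp f. f u \<otimes> f' v \<otimes> \<phi> (u \<otimes>\<^bsub>G\<^esub> v))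
        = (\<Oplus>v\<in>supp f'. \<Oplus>u\<in>supp f. f' v \<otimes> f u \<otimes> \<phi> (v \<otimes>\<^bsub>G\<^esub> u))"
    proof (intro A.finsum_cong' refl)
      fix u v assume u: "u \<in> supp f" and v: "v \<in> supp f'"
      show "f u \<otimes> f' v \<otimes> \<phi> (u \<otimes>\<^bsub>G\<^esub> v) = f' v \<otimes> f u \<otimes> \<phi> (v \<otimes>\<^bsub>G\<^esub> u)"
        using f A.m_comm[of "f u" "f' v"] G.m_comm[OF sc(1)[OF u] sc(2)[OF v]] by simp
    qed (auto intro!: A.finsum_closed simp: f c(2))
  qed (auto simp: f c(1))
qed

lemma cring_monoid_algebra: "cring F"
proof (intro cringI abelian_groupI comm_monoidI)
  show "\<one>\<^bsub>F\<^esub> \<in> carrier F" unfolding F_one by (intro single_closed) auto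
  show z: "\<zero>\<^bsub>F\<^esub> \<in> carrier F" unfolding F_zero mem_carrier_iff by (simp add: supp_def)
next
  fix f assume f: "f \<in> carrier F"
  show "\<zero>\<^bsub>F\<^esub> \<oplus>\<^bsub>F\<^esub> f = f" using f by (simp add: F_add F_zero)
  have "supp (\<lambda>g. \<ominus> f g) = supp f" using f unfolding supp_def
    by (metis A.minus_minus A.minus_zero carrierD(1))
  hence "(\<lambda>g. \<ominus> f g) \<in> carrier F" using f by (simp add: mem_carrier_iff del: carrierD_simps)
  moreover have "(\<lambda>g. \<ominus> f g) \<oplus>\<^bsub>F\<^esub> f = \<zero>\<^bsub>F\<^esub>" using f by (simp add: F_add F_zero A.l_neg)
  ultimately show "\<exists>f'\<in>carrier F. f' \<oplus>\<^bsub>F\<^esub> f = \<zero>\<^bsub>F\<^esub>" by blast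
  show "\<one>\<^bsub>F\<^esub> \<otimes>\<^bsub>F\<^esub> f = f"
  proof (intro F_eqI F_mult_closed f)
    show o: "\<one>\<^bsub>F\<^esub> \<in> carrier F" unfolding F_one by (intro single_closed) auto
    fix \<phi> assume p: "\<phi> \<in> carrier G \<rightarrow> carrier A"
    have "pair \<phi> (\<one>\<^bsub>F\<^esub> \<otimes>\<^bsub>F\<^esub> f) = pair (\<lambda>u. pair (\<lambda>v. \<phi> (u \<otimes>\<^bsub>G\<^esub> v)) f) (single \<one>\<^bsub>G\<^esub> \<one>)"
      using o f p by (simp add: pair_mult F_one)
    also have "\<dots> = \<one> \<otimes> pair (\<lambda>v. \<phi> (\<one>\<^bsub>G\<^esub> \<otimes>\<^bsub>G\<^esub> v)) f"
      using p f by (intro pair_single) (auto intro!: pair_closed)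
    also have "\<dots> = pair (\<lambda>v. \<phi> (\<one>\<^bsub>G\<^esub> \<otimes>\<^bsub>G\<^esub> v)) f"
      using p f by (intro A.l_one pair_closed) auto
    also have "\<dots> = pair \<phi> f" using p f by (intro pair_cong) auto
    finally show "pair \<phi> (\<one>\<^bsub>F\<^esub> \<otimes>\<^bsub>F\<^esub> f) = pair \<phi> f" .
  qed
next
  fix f f' f'' assume f: "f \<in> carrier F" "f' \<in> carrier F" "f'' \<in> carrier F"
  show "f \<oplus>\<^bsub>F\<^esub> f' \<oplus>\<^bsub>F\<^esub> f'' = f \<oplus>\<^bsub>F\<^esub> (f' \<oplus>\<^bsub>F\<^esub> f'')" using f by (simp add: F_add A.a_assoc)
  show "f \<otimes>\<^bsub>F\<^esub> f' \<otimes>\<^bsub>F\<^esub> f'' = f \<otimes>\<^bsub>F\<^esub> (f' \<otimes>\<^bsub>F\<^esub> f'')"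
  proof (intro F_eqI F_mult_closed f)
    fix \<phi> assume p: "\<phi> \<in> carrier G \<rightarrow> carrier A"
    have p1: "(\<lambda>v. \<phi> (u \<otimes>\<^bsub>G\<^esub> v)) \<in> carrier G \<rightarrow> carrier A" if "u \<in> carrier G" for u using that p by auto
    have p2: "(\<lambda>v. \<phi> (u \<otimes>\<^bsub>G\<^esub> v \<otimes>\<^bsub>G\<^esub> w)) \<in> carrier G \<rightarrow> carrier A" if "u \<in> carrier G" "w \<in> carrier G" for u w using that p by auto
    have p3: "(\<lambda>w. \<phi> (u \<otimes>\<^bsub>G\<^esub> v \<otimes>\<^bsub>G\<^esub> w)) \<in> carrier G \<rightarrow> carrier A" if "u \<in> carrier G" "v \<in> carrier G" for u v using that p by auto
    have q: "(\<lambda>u. pair (\<lambda>v. \<phi> (u \<otimes>\<^bsub>G\<^esub> v)) f'') \<in> carrier G \<rightarrow> carrier A"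
      by (rule funcsetI) (rule pair_closed[OF f(3) p1])
    have "pair \<phi> (f \<otimes>\<^bsub>F\<^esub> f' \<otimes>\<^bsub>F\<^esub> f'') = pair (\<lambda>u. pair (\<lambda>v. pair (\<lambda>w. \<phi> (u \<otimes>\<^bsub>G\<^esub> v \<otimes>\<^bsub>G\<^esub> w)) f'') f') f"
      using f p q by (simp add: pair_mult F_mult_closed)
    also have "\<dots> = pair (\<lambda>u. pair (\<lambda>v. \<phi> (u \<otimes>\<^bsub>G\<^esub> v)) (f' \<otimes>\<^bsub>F\<^esub> f'')) f"
    proof (intro pair_cong f)
      fix u assume u: "u \<in> carrier G"
      have "pair (\<lambda>v. \<phi> (u \<otimes>\<^bsub>G\<^esub> v)) (f' \<otimes>\<^bsub>F\<^esub> f'') = pair (\<lambda>v. pair (\<lambda>w. \<phi> (u \<otimes>\<^bsub>G\<^esub> (v \<otimes>\<^bsub>G\<^esub> w))) f'') f'"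
        using f p1[OF u] by (simp add: pair_mult)
      also have "\<dots> = pair (\<lambda>v. pair (\<lambda>w. \<phi> (u \<otimes>\<^bsub>G\<^esub> v \<otimes>\<^bsub>G\<^esub> w)) f'') f'"
        using u f p by (intro pair_cong funcsetI pair_closed) (auto simp: G.m_assoc)
      finally show "pair (\<lambda>v. pair (\<lambda>w. \<phi> (u \<otimes>\<^bsub>G\<^esub> v \<otimes>\<^bsub>G\<^esub> w)) f'') f' = pair (\<lambda>v. \<phi> (u \<otimes>\<^bsub>G\<^esub> v)) (f' \<otimes>\<^bsub>F\<^esub> f'')" ..
    qed (use p f in \<open>auto intro!: pair_closed F_mult_closed\<close>)
    also have "\<dots> = pair \<phi> (f \<otimes>\<^bsub>F\<^esub> (f' \<otimes>\<^bsub>F\<^esub> f''))"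
      using f p by (simp add: pair_mult F_mult_closed)
    finally show "pair \<phi> (f \<otimes>\<^bsub>F\<^esub> f' \<otimes>\<^bsub>F\<^esub> f'') = pair \<phi> (f \<otimes>\<^bsub>F\<^esub> (f' \<otimes>\<^bsub>F\<^esub> f''))" .
  qed
  show "(f \<oplus>\<^bsub>F\<^esub> f') \<otimes>\<^bsub>F\<^esub> f'' = f \<otimes>\<^bsub>F\<^esub> f'' \<oplus>\<^bsub>F\<^esub> f' \<otimes>\<^bsub>F\<^esub> f''"
  proof (intro F_eqI F_mult_closed F_add_closed f)
    fix \<phi> assume p: "\<phi> \<in> carrier G \<rightarrow> carrier A"
    have q: "(\<lambda>u. pair (\<lambda>v. \<phi> (u \<otimes>\<^bsub>G\<^esub> v)) f'') \<in> carrier G \<rightarrow> carrier A"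
      using p f by (intro funcsetI pair_closed) auto
    show "pair \<phi> ((f \<oplus>\<^bsub>F\<^esub> f') \<otimes>\<^bsub>F\<^esub> f'') = pair \<phi> (f \<otimes>\<^bsub>F\<^esub> f'' \<oplus>\<^bsub>F\<^esub> f' \<otimes>\<^bsub>F\<^esub> f'')"
      using f p q by (simp add: pair_mult F_mult_closed F_add_closed pair_add)
  qed
next
  fix f f' assume f: "f \<in> carrier F" "f' \<in> carrier F"
  show "f \<oplus>\<^bsub>F\<^esub> f' = f' \<oplus>\<^bsub>F\<^esub> f" using f by (simp add: F_add A.a_comm)
qed (auto simp: F_add_closed F_mult_closed F_mult_comm)

sublocale F: cring "monoid_algebra A G"
  by (rule cring_monoid_algebra)

text \<open>Induction on a finite set \<open>U\<close> containing the support: setting one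
  coefficient to zero moves the support into the smaller set.\<close>

lemma monoid_algebra_induct [consumes 1, case_names zero add]:
  assumes f: "f \<in> carrier F" and zero: "P \<zero>\<^bsub>F\<^esub>"
    and add: "\<And>g a f. g \<in> carrier G \<Longrightarrow> a \<in> carrier A \<Longrightarrow> f \<in> carrier F \<Longrightarrow> P f \<Longrightarrow> P (single g a \<oplus>\<^bsub>F\<^esub> f)"
  shows "P f"
proof -
  have "\<forall>f. f \<in> carrier F \<longrightarrow> supp f \<subseteq> U \<longrightarrow> P f" if "finite U" for U
    using that
  proof (induction U rule: finite_induct)
    case empty
    have "f = \<zero>\<^bsub>F\<^esub>" if "supp f = {}" for f using that by (auto simp: supp_def F_zero)
    thus ?case using zero by auto
  next
    case (insert g U)
    show ?case
    proof (intro allI impI)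
      fix f assume f: "f \<in> carrier F" "supp f \<subseteq> insert g U"
      show "P f"
      proof (cases "g \<in> supp f")
        case False
        thus ?thesis using f insert.IH by blast
      next
        case True
        let ?f = "f(g := \<zero>)"
        have s: "supp ?f = supp f - {g}" by (auto simp: supp_def)
        hence c: "?f \<in> carrier F" using f(1) by (auto simp: mem_carrier_iff simp del: carrierD_simps)
        have "supp ?f \<subseteq> U" using s f(2) by blast
        hence "P ?f" using insert.IH c by blast
        hence "P (single g (f g) \<oplus>\<^bsub>F\<^esub> ?f)"
          using f c True carrierD(2)[OF f(1)] by (intro add) auto
        moreover have "single g (f g) \<oplus>\<^bsub>F\<^esub> ?f = f"
          using f(1) by (auto simp: F_add monoid_algebra_single_def)
        ultimately show ?thesis by simp
      qed
    qed
  qed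
  thus ?thesis using f carrierD(3)[OF f] by blast
qed

end

context monoid_algebra_eval
begin

text \<open>Universal property of the monoid algebra. Each summand of \<open>ev_mult\<close> becomes
  a product of a factor in \<open>u\<close> and a factor in \<open>v\<close>, so the double sum
  separates.\<close>

lemma ev_ring_hom:
  assumes p: "\<phi> \<in> carrier G \<rightarrow> carrier E" and one: "\<phi> \<one>\<^bsub>G\<^esub> = \<one>"
    and mult: "\<And>u v. u \<in> carrier G \<Longrightarrow> v \<in> carrier G \<Longrightarrow> \<phi> (u \<otimes>\<^bsub>G\<^esub> v) = \<phi> u \<otimes> \<phi> v"
  shows "ring_hom_cring F E (ev \<phi>)"
proof (intro ring_hom_cringI ring_hom_memI)
  show "cring F" "cring E" by unfold_locales
  show "ev \<phi> \<one>\<^bsub>F\<^esub> = \<one>" unfolding F_one using p one by (subst ev_single) auto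
  fix f assume f: "f \<in> carrier F"
  show "ev \<phi> f \<in> carrier E" using f p by (rule ev_closed)
  fix f' assume f': "f' \<in> carrier F"
  show "ev \<phi> (f \<oplus>\<^bsub>F\<^esub> f') = ev \<phi> f \<oplus> ev \<phi> f'" using f f' p by (rule ev_add)
  have sc: "\<And>u. u \<in> supp f \<Longrightarrow> u \<in> carrier G" "\<And>v. v \<in> supp f' \<Longrightarrow> v \<in> carrier G" using f f' carrierD(2) by blast+
  have pc: "\<And>u. u \<in> carrier G \<Longrightarrow> \<phi> u \<in> carrier E" using p by auto
  have "ev \<phi> (f \<otimes>\<^bsub>F\<^esub> f')
      = (\<Oplus>u\<in>supp f. \<Oplus>v\<in>supp f'. (h (f u) \<otimes> \<phi> u) \<otimes> (h (f' v) \<otimes> \<phi> v))"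
    unfolding ev_mult[OF f f' p] using f f' sc pc
    by (intro E.finsum_cong') (auto intro!: E.finsum_closed simp: mult E.m_ac)
  also have "\<dots> = (\<Oplus>u\<in>supp f. (h (f u) \<otimes> \<phi> u) \<otimes> ev \<phi> f')"
    unfolding ev_def using f f' sc pc
    by (intro E.finsum_cong' E.finsum_rdistr[symmetric]) (auto intro!: E.finsum_closed)
  also have "\<dots> = ev \<phi> f \<otimes> ev \<phi> f'"
    unfolding ev_def[of \<phi> f] using f f' sc pc p
    by (intro E.finsum_ldistr[symmetric]) (auto intro!: ev_closed)
  finally show "ev \<phi> (f \<otimes>\<^bsub>F\<^esub> f') = ev \<phi> f \<otimes> ev \<phi> f'" .
qed

end


section \<open>Free extensions\<close>

locale free_extension = ring_hom_cring B E h
  for B :: "('b, 'k) ring_scheme" and E :: "('e, 'l) ring_scheme" (structure) and h +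
  fixes n :: nat and e :: "nat \<Rightarrow> 'e"
  assumes basis: "is_module_basis B E h n e"
begin

definition coord where "coord z = (THE c. is_coordinates B E h n e z c)"

lemma basis_closed [simp]: "i \<in> {1..n} \<Longrightarrow> e i \<in> carrier E"
  using basis by (auto simp: is_module_basis_def)

lemma coordinates_ex1: "z \<in> carrier E \<Longrightarrow> \<exists>!c. is_coordinates B E h n e z c"
  using basis unfolding is_module_basis_def by (elim conjE) (erule bspec)

lemma coord_is_coordinates: "z \<in> carrier E \<Longrightarrow> is_coordinates B E h n e z (coord z)"
  unfolding coord_def by (rule theI'[OF coordinates_ex1])

lemma coord_closed [simp]: "z \<in> carrier E \<Longrightarrow> i \<in> {1..n} \<Longrightarrow> coord z i \<in> carrier B"
  using coord_is_coordinates[of z] by (auto simp: is_coordinates_def)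

lemma coord_sum: "z \<in> carrier E \<Longrightarrow> (\<Oplus>i\<in>{1..n}. h (coord z i) \<otimes> e i) = z"
  using coord_is_coordinates[of z] by (simp add: is_coordinates_def)

text \<open>\<open>is_coordinates\<close> asks for a family extensional on \<open>{1..n}\<close>, so
  uniqueness is applied to \<open>restrict c {1..n}\<close>. This admits any \<open>c\<close> given
  by a formula.\<close>

lemma coord_unique:
  assumes "\<And>i. i \<in> {1..n} \<Longrightarrow> c i \<in> carrier B" "z = (\<Oplus>i\<in>{1..n}. h (c i) \<otimes> e i)" "i \<in> {1..n}"
  shows "coord z i = c i"
proof -
  have z: "z \<in> carrier E" unfolding assms(2) using assms(1) by (intro S.finsum_closed) auto
  have "z = (\<Oplus>i\<in>{1..n}. h (restrict c {1..n} i) \<otimes> e i)"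
    unfolding assms(2) using assms(1) by (intro S.finsum_cong') auto
  hence "is_coordinates B E h n e z (restrict c {1..n})"
    using assms(1) by (auto simp: is_coordinates_def)
  hence "coord z = restrict c {1..n}"
    using coord_is_coordinates[OF z] coordinates_ex1[OF z] by blast
  thus ?thesis using assms(3) by simp
qed

lemma coord_add:
  assumes "x \<in> carrier E" "y \<in> carrier E" "i \<in> {1..n}"
  shows "coord (x \<oplus> y) i = coord x i \<oplus>\<^bsub>B\<^esub> coord y i"
proof (rule coord_unique)
  have "(\<Oplus>i\<in>{1..n}. h (coord x i \<oplus>\<^bsub>B\<^esub> coord y i) \<otimes> e i)
      = (\<Oplus>i\<in>{1..n}. h (coord x i) \<otimes> e i \<oplus> h (coord y i) \<otimes> e i)"
    using assms by (intro S.finsum_cong') (auto simp: S.l_distr)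
  also have "\<dots> = (\<Oplus>i\<in>{1..n}. h (coord x i) \<otimes> e i) \<oplus> (\<Oplus>i\<in>{1..n}. h (coord y i) \<otimes> e i)"
    using assms by (intro S.finsum_addf) auto
  also have "\<dots> = x \<oplus> y" using assms by (simp add: coord_sum)
  finally show "x \<oplus> y = (\<Oplus>i\<in>{1..n}. h (coord x i \<oplus>\<^bsub>B\<^esub> coord y i) \<otimes> e i)" ..
qed (use assms in auto)

lemma coord_smult:
  assumes "b \<in> carrier B" "x \<in> carrier E" "i \<in> {1..n}"
  shows "coord (h b \<otimes> x) i = b \<otimes>\<^bsub>B\<^esub> coord x i"
proof (rule coord_unique)
  have "(\<Oplus>i\<in>{1..n}. h (b \<otimes>\<^bsub>B\<^esub> coord x i) \<otimes> e i) = (\<Oplus>i\<in>{1..n}. h b \<otimes> (h (coord x i) \<otimes> e i))"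
    using assms by (intro S.finsum_cong') (auto simp: S.m_assoc)
  also have "\<dots> = h b \<otimes> (\<Oplus>i\<in>{1..n}. h (coord x i) \<otimes> e i)"
    using assms by (intro S.finsum_rdistr[symmetric]) auto
  also have "\<dots> = h b \<otimes> x" using assms by (simp add: coord_sum)
  finally show "h b \<otimes> x = (\<Oplus>i\<in>{1..n}. h (b \<otimes>\<^bsub>B\<^esub> coord x i) \<otimes> e i)" ..
qed (use assms in auto)

text \<open>Here \<open>u\<close> makes \<open>C\<close> a \<open>B\<close>-algebra and
  \<open>p\<close> is a \<open>B\<close>-linear map from \<open>E\<close> to \<open>C\<close>.
  Linear maps are needed besides ring homomorphisms because the provisional lift \<open>w0\<close>
  and its defect \<delta> are not multiplicative.\<close>

definition base_linear where
  "base_linear C u p \<longleftrightarrow> p \<in> carrier E \<rightarrow> carrier C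
     \<and> (\<forall>x\<in>carrier E. \<forall>y\<in>carrier E. p (x \<oplus> y) = p x \<oplus>\<^bsub>C\<^esub> p y)
     \<and> (\<forall>b\<in>carrier B. \<forall>x\<in>carrier E. p (h b \<otimes> x) = u b \<otimes>\<^bsub>C\<^esub> p x)"

lemma base_linearD:
  assumes "base_linear C u p"
  shows "x \<in> carrier E \<Longrightarrow> p x \<in> carrier C"
    and "x \<in> carrier E \<Longrightarrow> y \<in> carrier E \<Longrightarrow> p (x \<oplus> y) = p x \<oplus>\<^bsub>C\<^esub> p y"
    and "b \<in> carrier B \<Longrightarrow> x \<in> carrier E \<Longrightarrow> p (h b \<otimes> x) = u b \<otimes>\<^bsub>C\<^esub> p x"
  using assms by (auto simp: base_linear_def)

lemma base_linear_finsum: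
  assumes C: "cring C" and u: "u \<in> ring_hom B C" and p: "base_linear C u p" and I: "finite I"
    and c: "\<And>i. i \<in> I \<Longrightarrow> c i \<in> carrier B" and x: "\<And>i. i \<in> I \<Longrightarrow> x i \<in> carrier E"
  shows "p (\<Oplus>i\<in>I. h (c i) \<otimes> x i) = (\<Oplus>\<^bsub>C\<^esub>i\<in>I. u (c i) \<otimes>\<^bsub>C\<^esub> p (x i))"
proof -
  interpret C: cring C by (rule C)
  have uc: "u b \<in> carrier C" if "b \<in> carrier B" for b using u that by (rule ring_hom_closed)
  have "u \<zero>\<^bsub>B\<^esub> = \<zero>\<^bsub>C\<^esub>" using u C ring_hom_zero[OF u R.ring_axioms C.ring_axioms] by simp
  hence "p \<zero> = \<zero>\<^bsub>C\<^esub>"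
    using base_linearD(3)[OF p R.zero_closed S.zero_closed] base_linearD(1)[OF p S.zero_closed] by simp
  show ?thesis using I c x
  proof (induction I rule: finite_induct)
    case empty
    show ?case using \<open>p \<zero> = \<zero>\<^bsub>C\<^esub>\<close> by simp
  next
    case (insert i I)
    have "(\<Oplus>i\<in>insert i I. h (c i) \<otimes> x i) = h (c i) \<otimes> x i \<oplus> (\<Oplus>i\<in>I. h (c i) \<otimes> x i)"
      using insert by (intro S.finsum_insert) auto
    moreover have "(\<Oplus>i\<in>I. h (c i) \<otimes> x i) \<in> carrier E"
      using insert.prems by (intro S.finsum_closed) auto
    moreover have "(\<Oplus>\<^bsub>C\<^esub>i\<in>insert i I. u (c i) \<otimes>\<^bsub>C\<^esub> p (x i)) = u (c i) \<otimes>\<^bsub>C\<^esub> p (x i) \<oplus>\<^bsub>C\<^esub> (\<Oplus>\<^bsub>C\<^esub>i\<in>I. u (c i) \<otimes>\<^bsub>C\<^esub> p (x i))"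
      using insert uc base_linearD(1)[OF p] by (intro C.finsum_insert) auto
    ultimately show ?case
      using insert base_linearD(2,3)[OF p] by simp
  qed
qed

lemma base_linear_hom:
  assumes w: "w \<in> ring_hom E C" and u: "\<And>b. b \<in> carrier B \<Longrightarrow> w (h b) = u b"
  shows "base_linear C u w"
  using ring_hom_closed[OF w] ring_hom_add[OF w] ring_hom_mult[OF w] u by (simp add: base_linear_def)

end

section \<open>Separable free extensions are formally etale\<close>

text \<open>The element \<open>\<Sum> e i \<otimes> d i\<close> of \<open>E \<otimes>\<^sub>B E\<close> is a separability idempotent.\<close>

locale separable_extension = free_extension B E h n e
  for B :: "('b, 'k) ring_scheme" and E :: "('e, 'l) ring_scheme" (structure) and h n e +
  fixes d :: "nat \<Rightarrow> 'e"
  assumes dual_closed [simp]: "i \<in> {1..n} \<Longrightarrow> d i \<in> carrier E"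
    and dual_sum: "(\<Oplus>i\<in>{1..n}. e i \<otimes> d i) = \<one>"
    and dual_mult: "z \<in> carrier E \<Longrightarrow> i \<in> {1..n}
      \<Longrightarrow> z \<otimes> d i = (\<Oplus>j\<in>{1..n}. h (coord (z \<otimes> e j) i) \<otimes> d j)"
begin

text \<open>By \<open>dual_mult\<close>, the matrix of multiplication by \<open>z\<close> on the
  \<open>e i\<close> acts transposed on the \<open>d i\<close>. So \<open>z\<close> may pass from
  the left to the right factor in the sum of all \<open>e i\<close> tensor \<open>d i\<close>; the
  pair \<open>p\<close>, \<open>q\<close> evaluates this identity in \<open>C\<close>.\<close>

lemma casimir:
  assumes C: "cring C" and u: "u \<in> ring_hom B C" and p: "base_linear C u p" and q: "base_linear C u q"
    and z: "z \<in> carrier E"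
  shows "(\<Oplus>\<^bsub>C\<^esub>i\<in>{1..n}. p (z \<otimes> e i) \<otimes>\<^bsub>C\<^esub> q (d i)) = (\<Oplus>\<^bsub>C\<^esub>i\<in>{1..n}. p (e i) \<otimes>\<^bsub>C\<^esub> q (z \<otimes> d i))"
proof -
  interpret C: cring C by (rule C)
  let ?k = "\<lambda>i j. coord (z \<otimes> e i) j"
  have uc: "u b \<in> carrier C" if "b \<in> carrier B" for b using u that by (rule ring_hom_closed)
  have k: "?k i j \<in> carrier B" if "i \<in> {1..n}" "j \<in> {1..n}" for i j using that z by simp
  have pe: "p (e i) \<in> carrier C" if "i \<in> {1..n}" for i using base_linearD(1)[OF p] that by simp
  have qd: "q (d i) \<in> carrier C" if "i \<in> {1..n}" for i using base_linearD(1)[OF q] that by simp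
  have 1: "p (z \<otimes> e i) = (\<Oplus>\<^bsub>C\<^esub>j\<in>{1..n}. u (?k i j) \<otimes>\<^bsub>C\<^esub> p (e j))" if i: "i \<in> {1..n}" for i
  proof -
    have "p (z \<otimes> e i) = p (\<Oplus>j\<in>{1..n}. h (?k i j) \<otimes> e j)" using z i by (simp add: coord_sum)
    also have "\<dots> = (\<Oplus>\<^bsub>C\<^esub>j\<in>{1..n}. u (?k i j) \<otimes>\<^bsub>C\<^esub> p (e j))"
      using i k by (intro base_linear_finsum[OF C u p]) auto
    finally show ?thesis .
  qed
  have 2: "q (z \<otimes> d j) = (\<Oplus>\<^bsub>C\<^esub>i\<in>{1..n}. u (?k i j) \<otimes>\<^bsub>C\<^esub> q (d i))" if j: "j \<in> {1..n}" for j
    unfolding dual_mult[OF z j] using j k by (intro base_linear_finsum[OF C u q]) auto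
  have "(\<Oplus>\<^bsub>C\<^esub>i\<in>{1..n}. p (z \<otimes> e i) \<otimes>\<^bsub>C\<^esub> q (d i))
      = (\<Oplus>\<^bsub>C\<^esub>i\<in>{1..n}. \<Oplus>\<^bsub>C\<^esub>j\<in>{1..n}. u (?k i j) \<otimes>\<^bsub>C\<^esub> p (e j) \<otimes>\<^bsub>C\<^esub> q (d i))"
  proof (intro C.finsum_cong')
    fix i assume i: "i \<in> {1..n}"
    show "p (z \<otimes> e i) \<otimes>\<^bsub>C\<^esub> q (d i) = (\<Oplus>\<^bsub>C\<^esub>j\<in>{1..n}. u (?k i j) \<otimes>\<^bsub>C\<^esub> p (e j) \<otimes>\<^bsub>C\<^esub> q (d i))"
      unfolding 1[OF i] using i qd k uc pe by (intro C.finsum_ldistr) auto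
  qed (use qd k uc pe in \<open>auto intro!: C.finsum_closed\<close>)
  also have "\<dots> = (\<Oplus>\<^bsub>C\<^esub>j\<in>{1..n}. \<Oplus>\<^bsub>C\<^esub>i\<in>{1..n}. u (?k i j) \<otimes>\<^bsub>C\<^esub> p (e j) \<otimes>\<^bsub>C\<^esub> q (d i))"
    using qd k uc pe by (intro C.finsum_swap) auto
  also have "\<dots> = (\<Oplus>\<^bsub>C\<^esub>j\<in>{1..n}. p (e j) \<otimes>\<^bsub>C\<^esub> q (z \<otimes> d j))"
  proof (intro C.finsum_cong')
    fix j assume j: "j \<in> {1..n}"
    have "(\<Oplus>\<^bsub>C\<^esub>i\<in>{1..n}. u (?k i j) \<otimes>\<^bsub>C\<^esub> p (e j) \<otimes>\<^bsub>C\<^esub> q (d i)) = (\<Oplus>\<^bsub>C\<^esub>i\<in>{1..n}. p (e j) \<otimes>\<^bsub>C\<^esub> (u (?k i j) \<otimes>\<^bsub>C\<^esub> q (d i)))"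
      using j qd k uc pe by (intro C.finsum_cong') (auto simp: C.m_ac)
    also have "\<dots> = p (e j) \<otimes>\<^bsub>C\<^esub> (\<Oplus>\<^bsub>C\<^esub>i\<in>{1..n}. u (?k i j) \<otimes>\<^bsub>C\<^esub> q (d i))"
      using j qd k uc pe by (intro C.finsum_rdistr[symmetric]) auto
    finally show "(\<Oplus>\<^bsub>C\<^esub>i\<in>{1..n}. u (?k i j) \<otimes>\<^bsub>C\<^esub> p (e j) \<otimes>\<^bsub>C\<^esub> q (d i)) = p (e j) \<otimes>\<^bsub>C\<^esub> q (z \<otimes> d j)"
      unfolding 2[OF j] .
  qed (use pe base_linearD(1)[OF q] z in auto)
  finally show ?thesis .
qed

end

section \<open>Lifting along a square-zero ideal\<close>

locale square_zero_lifting = separable_extension B E h n e d + C: cring C + J: ideal J C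
  for B :: "('b, 'k) ring_scheme" and E :: "('e, 'l) ring_scheme" and h n e d
    and C :: "('c, 'm) ring_scheme" (structure) and J +
  fixes u v
  assumes J_sq: "\<And>a b. a \<in> J \<Longrightarrow> b \<in> J \<Longrightarrow> a \<otimes> b = \<zero>"
    and u: "u \<in> ring_hom B C" and v: "v \<in> ring_hom E (C Quot J)"
    and v_h: "\<And>b. b \<in> carrier B \<Longrightarrow> v (h b) = J +> u b"
begin

abbreviation "q a \<equiv> J +> a"

lemma J_closed [simp]: "a \<in> J \<Longrightarrow> a \<in> carrier C"
  by (rule J.Icarr)

sublocale Q: ring_hom_cring C "C Quot J" "(+>) J"
  by (rule J.rcos_ring_hom_cring[OF C.cring_axioms])

sublocale V: ring_hom_cring E "C Quot J" v
  by unfold_locales (rule v)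

lemma q_eq_iff: "a \<in> carrier C \<Longrightarrow> b \<in> carrier C \<Longrightarrow> q a = q b \<longleftrightarrow> a \<ominus> b \<in> J"
  using C.quotient_eq_iff_same_a_r_cos[OF J.ideal_axioms] by simp

lemma q_zero_iff: "a \<in> carrier C \<Longrightarrow> q a = \<zero>\<^bsub>C Quot J\<^esub> \<longleftrightarrow> a \<in> J"
  using q_eq_iff[of a "\<zero>"] Q.hom_zero by (simp add: C.minus_eq)

lemma u_closed [simp]: "b \<in> carrier B \<Longrightarrow> u b \<in> carrier C"
  using u by (rule ring_hom_closed)

text \<open>By \<open>dual_sum\<close> the sum is congruent to 1 modulo \<open>J\<close>, and
  elements of \<open>J\<close> annihilate each other, so it acts as the identity on
  \<open>J\<close>. Stated for arbitrary lifts of \<open>v\<close> so as to cover ring homomorphisms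
  and the linear lift \<open>w0\<close> alike.\<close>

lemma lift_casimir_one:
  assumes w: "\<And>z. z \<in> carrier E \<Longrightarrow> w z \<in> carrier C" "\<And>z. z \<in> carrier E \<Longrightarrow> q (w z) = v z"
    and w': "\<And>z. z \<in> carrier E \<Longrightarrow> w' z \<in> carrier C" "\<And>z. z \<in> carrier E \<Longrightarrow> q (w' z) = v z"
    and t: "t \<in> J"
  shows "(\<Oplus>i\<in>{1..n}. w (e i) \<otimes> w' (d i)) \<otimes> t = t"
proof -
  let ?s = "\<Oplus>i\<in>{1..n}. w (e i) \<otimes> w' (d i)"
  have s: "?s \<in> carrier C" using w w' by (intro C.finsum_closed) auto
  have "q ?s = (\<Oplus>\<^bsub>C Quot J\<^esub>i\<in>{1..n}. q (w (e i) \<otimes> w' (d i)))"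
    using w w' by (subst Q.hom_finsum) (auto simp: o_def)
  also have "\<dots> = (\<Oplus>\<^bsub>C Quot J\<^esub>i\<in>{1..n}. v (e i \<otimes>\<^bsub>E\<^esub> d i))"
    using w w' by (intro Q.S.finsum_cong') auto
  also have "\<dots> = v (\<Oplus>\<^bsub>E\<^esub>i\<in>{1..n}. e i \<otimes>\<^bsub>E\<^esub> d i)"
    by (subst V.hom_finsum) (auto simp: o_def)
  also have "\<dots> = q \<one>" by (simp add: dual_sum)
  finally have "?s \<ominus> \<one> \<in> J" using q_eq_iff[OF s C.one_closed] by blast
  hence "(?s \<ominus> \<one>) \<otimes> t = \<zero>" using t J_sq by blast
  hence "?s \<otimes> t \<ominus> t = \<zero>" using s t by (simp add: C.minus_eq C.l_distr C.l_minus)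
  thus ?thesis using s t by simp
qed

text \<open>Moving \<open>z\<close> across with \<open>casimir\<close> shows that \<open>?s\<close>
  times \<open>w z\<close> equals \<open>?s\<close> times \<open>w' z\<close>. The difference of
  \<open>w z\<close> and \<open>w' z\<close> lies in \<open>J\<close>, where \<open>?s\<close> acts
  as 1, so it vanishes.\<close>

lemma lift_unique:
  assumes w: "w \<in> ring_hom E C" "\<And>b. b \<in> carrier B \<Longrightarrow> w (h b) = u b" "\<And>z. z \<in> carrier E \<Longrightarrow> q (w z) = v z"
    and w': "w' \<in> ring_hom E C" "\<And>b. b \<in> carrier B \<Longrightarrow> w' (h b) = u b" "\<And>z. z \<in> carrier E \<Longrightarrow> q (w' z) = v z"
    and z: "z \<in> carrier E"
  shows "w z = w' z"
proof -
  let ?s = "\<Oplus>i\<in>{1..n}. w (e i) \<otimes> w' (d i)"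
  note c = ring_hom_closed[OF w(1)] ring_hom_closed[OF w'(1)]
  have s: "?s \<in> carrier C" using c by (intro C.finsum_closed) auto
  have "?s \<otimes> w z = (\<Oplus>i\<in>{1..n}. w (e i) \<otimes> w' (d i) \<otimes> w z)"
    using c z by (intro C.finsum_ldistr) auto
  also have "\<dots> = (\<Oplus>i\<in>{1..n}. w (z \<otimes>\<^bsub>E\<^esub> e i) \<otimes> w' (d i))"
    using c z by (intro C.finsum_cong') (auto simp: ring_hom_mult[OF w(1)] C.m_ac)
  also have "\<dots> = (\<Oplus>i\<in>{1..n}. w (e i) \<otimes> w' (z \<otimes>\<^bsub>E\<^esub> d i))"
    using z w w' by (intro casimir[OF C.cring_axioms u] base_linear_hom)
  also have "\<dots> = (\<Oplus>i\<in>{1..n}. w (e i) \<otimes> w' (d i) \<otimes> w' z)"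
    using c z by (intro C.finsum_cong') (auto simp: ring_hom_mult[OF w'(1)] C.m_ac)
  also have "\<dots> = ?s \<otimes> w' z"
    using c z by (intro C.finsum_ldistr[symmetric]) auto
  finally have eq: "?s \<otimes> w z = ?s \<otimes> w' z" .
  have "q (w z) = q (w' z)" using w w' z by simp
  hence "w z \<ominus> w' z \<in> J" using q_eq_iff c z by simp
  hence "?s \<otimes> (w z \<ominus> w' z) = w z \<ominus> w' z"
    using w(3) w'(3) c by (intro lift_casimir_one) auto
  moreover have "?s \<otimes> (w z \<ominus> w' z) = \<zero>"
    using eq s c z by (simp add: C.minus_eq C.r_distr C.r_minus C.r_neg)
  ultimately have "w z \<ominus> w' z = \<zero>" by metis
  thus ?thesis using c z by simp
qed

text \<open>Lift \<open>v\<close> to a linear map \<open>w\<^sub>0\<close>. Its defect \<open>\<delta> x y = w\<^sub>0 (x y) - w\<^sub>0 x w\<^sub>0 y\<close> of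
  multiplicativity is a Hochschild 2-cocycle with values in \<open>J\<close>; contracting it with the separability
  idempotent gives a cochain \<open>c z = \<Sum> w\<^sub>0 (e i) \<delta> (d i) z\<close>, and \<open>w\<^sub>0 + c\<close> is multiplicative.\<close>

lemma lift_exists:
  "\<exists>w. w \<in> ring_hom E C \<and> (\<forall>b\<in>carrier B. w (h b) = u b) \<and> (\<forall>z\<in>carrier E. q (w z) = v z)"
proof -
  have "\<exists>a\<in>carrier C. q a = v (e i)" if "i \<in> {1..n}" for i
    using V.hom_closed[OF basis_closed[OF that]] unfolding FactRing_def A_RCOSETS_def' by auto
  then obtain l where l: "\<And>i. i \<in> {1..n} \<Longrightarrow> l i \<in> carrier C" "\<And>i. i \<in> {1..n} \<Longrightarrow> q (l i) = v (e i)"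
    by metis
  \<comment> \<open>Freeness enters here: the arbitrary lifts \<open>l i\<close> of the values on
    the basis extend to a linear map.\<close>
  define w0 where "w0 z = (\<Oplus>i\<in>{1..n}. u (coord z i) \<otimes> l i)" for z
  have w0c [simp]: "w0 z \<in> carrier C" if "z \<in> carrier E" for z
    unfolding w0_def using that l by (intro C.finsum_closed) auto
  have w0_add: "w0 (x \<oplus>\<^bsub>E\<^esub> y) = w0 x \<oplus> w0 y" if x: "x \<in> carrier E" and y: "y \<in> carrier E" for x y
  proof -
    have "w0 (x \<oplus>\<^bsub>E\<^esub> y) = (\<Oplus>i\<in>{1..n}. u (coord x i) \<otimes> l i \<oplus> u (coord y i) \<otimes> l i)"
      unfolding w0_def using x y l
      by (intro C.finsum_cong') (auto simp: coord_add ring_hom_add[OF u] C.l_distr)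
    also have "\<dots> = w0 x \<oplus> w0 y" unfolding w0_def using x y l by (intro C.finsum_addf) auto
    finally show ?thesis .
  qed
  have w0_smult: "w0 (h b \<otimes>\<^bsub>E\<^esub> x) = u b \<otimes> w0 x" if b: "b \<in> carrier B" and x: "x \<in> carrier E" for b x
  proof -
    have "w0 (h b \<otimes>\<^bsub>E\<^esub> x) = (\<Oplus>i\<in>{1..n}. u b \<otimes> (u (coord x i) \<otimes> l i))"
      unfolding w0_def using b x l
      by (intro C.finsum_cong') (auto simp: coord_smult ring_hom_mult[OF u] C.m_assoc)
    also have "\<dots> = u b \<otimes> w0 x" unfolding w0_def using b x l by (intro C.finsum_rdistr[symmetric]) auto
    finally show ?thesis .
  qed
  have w0_lin: "base_linear C u w0" unfolding base_linear_def using w0_add w0_smult by auto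
  have qw0: "q (w0 z) = v z" if z: "z \<in> carrier E" for z
  proof -
    have "q (w0 z) = (\<Oplus>\<^bsub>C Quot J\<^esub>i\<in>{1..n}. q (u (coord z i) \<otimes> l i))"
      unfolding w0_def using z l by (subst Q.hom_finsum) (auto simp: o_def)
    also have "\<dots> = (\<Oplus>\<^bsub>C Quot J\<^esub>i\<in>{1..n}. v (h (coord z i) \<otimes>\<^bsub>E\<^esub> e i))"
      using z l by (intro Q.S.finsum_cong') (auto simp: v_h)
    also have "\<dots> = v (\<Oplus>\<^bsub>E\<^esub>i\<in>{1..n}. h (coord z i) \<otimes>\<^bsub>E\<^esub> e i)"
      using z by (subst V.hom_finsum) (auto simp: o_def)
    finally show ?thesis using z by (simp add: coord_sum)
  qed
  define \<delta> where "\<delta> x y = w0 (x \<otimes>\<^bsub>E\<^esub> y) \<ominus> w0 x \<otimes> w0 y" for x y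
  have \<delta>J [simp]: "\<delta> x y \<in> J" if "x \<in> carrier E" "y \<in> carrier E" for x y
    unfolding \<delta>_def using that qw0 by (subst q_eq_iff[symmetric]) auto
  have w0_mult: "w0 (x \<otimes>\<^bsub>E\<^esub> y) = w0 x \<otimes> w0 y \<oplus> \<delta> x y" if "x \<in> carrier E" "y \<in> carrier E" for x y
  proof -
    have "w0 x \<otimes> w0 y \<oplus> (\<ominus> (w0 x \<otimes> w0 y) \<oplus> w0 (x \<otimes>\<^bsub>E\<^esub> y)) = w0 (x \<otimes>\<^bsub>E\<^esub> y)"
      using that by (intro C.r_neg2) auto
    thus ?thesis using that by (simp add: \<delta>_def C.minus_eq C.a_comm)
  qed
  have \<delta>_lin: "base_linear C u (\<lambda>x. \<delta> x y)" if y: "y \<in> carrier E" for y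
    unfolding base_linear_def
  proof (intro conjI ballI funcsetI)
    fix x x' assume x: "x \<in> carrier E" "x' \<in> carrier E"
    show "\<delta> (x \<oplus>\<^bsub>E\<^esub> x') y = \<delta> x y \<oplus> \<delta> x' y"
      unfolding \<delta>_def using x y
      by (simp add: w0_add S.l_distr C.l_distr C.minus_eq C.minus_add C.a_ac)
  next
    fix b x assume x: "b \<in> carrier B" "x \<in> carrier E"
    have "h b \<otimes>\<^bsub>E\<^esub> x \<otimes>\<^bsub>E\<^esub> y = h b \<otimes>\<^bsub>E\<^esub> (x \<otimes>\<^bsub>E\<^esub> y)" using x y by (simp add: S.m_assoc)
    thus "\<delta> (h b \<otimes>\<^bsub>E\<^esub> x) y = u b \<otimes> \<delta> x y"
      unfolding \<delta>_def using x y
      by (simp add: w0_smult C.m_assoc C.minus_eq C.r_distr C.r_minus)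
  qed (use y in simp)
  define c where "c z = (\<Oplus>i\<in>{1..n}. w0 (e i) \<otimes> \<delta> (d i) z)" for z
  have sumJ: "(\<Oplus>i\<in>I. f i) \<in> J" if "finite I" "\<And>i. i \<in> I \<Longrightarrow> f i \<in> J" for f and I :: "nat set"
    using that by (induction I rule: finite_induct) (auto simp: Pi_iff J.zero_closed J.a_closed)
  have cJ [simp]: "c z \<in> J" if "z \<in> carrier E" for z
    unfolding c_def using that by (intro sumJ J.I_l_closed) auto
  have \<delta>_add: "\<delta> x (y \<oplus>\<^bsub>E\<^esub> y') = \<delta> x y \<oplus> \<delta> x y'" if "x \<in> carrier E" "y \<in> carrier E" "y' \<in> carrier E" for x y y'
    unfolding \<delta>_def using that by (simp add: w0_add S.r_distr C.r_distr C.minus_eq C.minus_add C.a_ac)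
  have \<delta>_smult: "\<delta> x (h b \<otimes>\<^bsub>E\<^esub> y) = u b \<otimes> \<delta> x y" if "x \<in> carrier E" "b \<in> carrier B" "y \<in> carrier E" for x b y
  proof -
    have "x \<otimes>\<^bsub>E\<^esub> (h b \<otimes>\<^bsub>E\<^esub> y) = h b \<otimes>\<^bsub>E\<^esub> (x \<otimes>\<^bsub>E\<^esub> y)" using that by (simp add: S.m_ac)
    moreover have "w0 x \<otimes> (u b \<otimes> w0 y) = u b \<otimes> (w0 x \<otimes> w0 y)" using that by (simp add: C.m_ac)
    ultimately show ?thesis unfolding \<delta>_def using that
      by (simp add: w0_smult C.minus_eq C.r_distr C.r_minus)
  qed
  have c_add: "c (x \<oplus>\<^bsub>E\<^esub> y) = c x \<oplus> c y" if "x \<in> carrier E" "y \<in> carrier E" for x y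
  proof -
    have "c (x \<oplus>\<^bsub>E\<^esub> y) = (\<Oplus>i\<in>{1..n}. w0 (e i) \<otimes> \<delta> (d i) x \<oplus> w0 (e i) \<otimes> \<delta> (d i) y)"
      unfolding c_def using that by (intro C.finsum_cong') (auto simp: \<delta>_add C.r_distr)
    also have "\<dots> = c x \<oplus> c y" unfolding c_def using that by (intro C.finsum_addf) auto
    finally show ?thesis .
  qed
  have c_smult: "c (h b \<otimes>\<^bsub>E\<^esub> x) = u b \<otimes> c x" if "b \<in> carrier B" "x \<in> carrier E" for b x
  proof -
    have "c (h b \<otimes>\<^bsub>E\<^esub> x) = (\<Oplus>i\<in>{1..n}. u b \<otimes> (w0 (e i) \<otimes> \<delta> (d i) x))"
      unfolding c_def using that by (intro C.finsum_cong') (auto simp: \<delta>_smult C.m_ac)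
    also have "\<dots> = u b \<otimes> c x" unfolding c_def using that by (intro C.finsum_rdistr[symmetric]) auto
    finally show ?thesis .
  qed
  \<comment> \<open>The defect \<delta> has values in \<open>J\<close> and so kills
    \<open>J\<close>; on \<open>J\<close>, therefore, \<open>w0\<close> acts as if it were
    multiplicative.\<close>
  have w0_J: "w0 (x \<otimes>\<^bsub>E\<^esub> y) \<otimes> t = w0 x \<otimes> (w0 y \<otimes> t)" if "x \<in> carrier E" "y \<in> carrier E" "t \<in> J" for x y t
    using that by (simp add: w0_mult C.l_distr J_sq C.m_assoc)
  \<comment> \<open>Both sides are what remains of \<open>w0\<close> of the triple product after
    removing the product of the three values of \<open>w0\<close>. The last term is written with
    \<open>y\<close> before \<open>x\<close> so that for \<open>x = d i\<close> it has the shape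
    that \<open>casimir\<close> handles.\<close>
  have cocycle: "\<delta> x (y \<otimes>\<^bsub>E\<^esub> z) \<oplus> w0 x \<otimes> \<delta> y z = \<delta> x y \<otimes> w0 z \<oplus> \<delta> (y \<otimes>\<^bsub>E\<^esub> x) z"
    if x: "x \<in> carrier E" and y: "y \<in> carrier E" and z: "z \<in> carrier E" for x y z
  proof -
    let ?t = "w0 (x \<otimes>\<^bsub>E\<^esub> y \<otimes>\<^bsub>E\<^esub> z)" and ?s = "w0 x \<otimes> w0 y \<otimes> w0 z"
    have tc: "?t \<in> carrier C" "?s \<in> carrier C" "\<delta> x (y \<otimes>\<^bsub>E\<^esub> z) \<in> carrier C" "w0 x \<otimes> \<delta> y z \<in> carrier C"
      "\<delta> x y \<otimes> w0 z \<in> carrier C" "\<delta> (x \<otimes>\<^bsub>E\<^esub> y) z \<in> carrier C" using x y z by auto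
    have "?t = w0 x \<otimes> w0 (y \<otimes>\<^bsub>E\<^esub> z) \<oplus> \<delta> x (y \<otimes>\<^bsub>E\<^esub> z)" using x y z w0_mult[of x "y \<otimes>\<^bsub>E\<^esub> z"] by (simp add: S.m_assoc)
    also have "w0 (y \<otimes>\<^bsub>E\<^esub> z) = w0 y \<otimes> w0 z \<oplus> \<delta> y z" using y z by (rule w0_mult)
    finally have 1: "?t = ?s \<oplus> (\<delta> x (y \<otimes>\<^bsub>E\<^esub> z) \<oplus> w0 x \<otimes> \<delta> y z)"
      using x y z by (simp add: C.r_distr C.m_assoc C.a_ac)
    have "?t = w0 (x \<otimes>\<^bsub>E\<^esub> y) \<otimes> w0 z \<oplus> \<delta> (x \<otimes>\<^bsub>E\<^esub> y) z" using x y z by (intro w0_mult) auto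
    also have "w0 (x \<otimes>\<^bsub>E\<^esub> y) = w0 x \<otimes> w0 y \<oplus> \<delta> x y" using x y by (rule w0_mult)
    finally have 2: "?t = ?s \<oplus> (\<delta> x y \<otimes> w0 z \<oplus> \<delta> (x \<otimes>\<^bsub>E\<^esub> y) z)"
      using x y z by (simp add: C.l_distr C.m_assoc C.a_ac)
    have "y \<otimes>\<^bsub>E\<^esub> x = x \<otimes>\<^bsub>E\<^esub> y" by (rule S.m_comm[OF y x])
    thus ?thesis using 1 2 tc by (metis C.add.m_closed C.add.l_cancel)
  qed
  \<comment> \<open>The coboundary equation. The idempotent is inserted in front of
    \<open>\<delta> z z'\<close>, the cocycle identity is applied with \<open>d i\<close> in the
    first place, and \<open>casimir\<close> carries \<open>z\<close> over to \<open>e i\<close>,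
    where \<open>w0_J\<close> pulls it out.\<close>
  have c_mult: "c (z \<otimes>\<^bsub>E\<^esub> z') \<oplus> \<delta> z z' = c z \<otimes> w0 z' \<oplus> w0 z \<otimes> c z'"
    if z: "z \<in> carrier E" and z': "z' \<in> carrier E" for z z'
  proof -
    have "\<delta> z z' = (\<Oplus>i\<in>{1..n}. w0 (e i) \<otimes> w0 (d i)) \<otimes> \<delta> z z'"
      using z z' qw0 by (intro lift_casimir_one[symmetric]) auto
    also have "\<dots> = (\<Oplus>i\<in>{1..n}. w0 (e i) \<otimes> w0 (d i) \<otimes> \<delta> z z')"
      using z z' by (intro C.finsum_ldistr) auto
    finally have "c (z \<otimes>\<^bsub>E\<^esub> z') \<oplus> \<delta> z z' = c (z \<otimes>\<^bsub>E\<^esub> z') \<oplus> (\<Oplus>i\<in>{1..n}. w0 (e i) \<otimes> w0 (d i) \<otimes> \<delta> z z')"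
      by (rule arg_cong)
    also have "\<dots> = (\<Oplus>i\<in>{1..n}. w0 (e i) \<otimes> \<delta> (d i) (z \<otimes>\<^bsub>E\<^esub> z') \<oplus> w0 (e i) \<otimes> w0 (d i) \<otimes> \<delta> z z')"
      unfolding c_def using z z' by (intro C.finsum_addf[symmetric]) auto
    also have "\<dots> = (\<Oplus>i\<in>{1..n}. w0 (e i) \<otimes> \<delta> (d i) z \<otimes> w0 z' \<oplus> w0 (e i) \<otimes> \<delta> (z \<otimes>\<^bsub>E\<^esub> d i) z')"
    proof (intro C.finsum_cong')
      fix i assume i: "i \<in> {1..n}"
      have "w0 (e i) \<otimes> (\<delta> (d i) (z \<otimes>\<^bsub>E\<^esub> z') \<oplus> w0 (d i) \<otimes> \<delta> z z')
          = w0 (e i) \<otimes> (\<delta> (d i) z \<otimes> w0 z' \<oplus> \<delta> (z \<otimes>\<^bsub>E\<^esub> d i) z')"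
        using cocycle[of "d i" z z'] i z z' by simp
      thus "w0 (e i) \<otimes> \<delta> (d i) (z \<otimes>\<^bsub>E\<^esub> z') \<oplus> w0 (e i) \<otimes> w0 (d i) \<otimes> \<delta> z z'
          = w0 (e i) \<otimes> \<delta> (d i) z \<otimes> w0 z' \<oplus> w0 (e i) \<otimes> \<delta> (z \<otimes>\<^bsub>E\<^esub> d i) z'"
        using i z z' by (simp add: C.r_distr C.m_assoc)
    qed (use z z' in auto)
    also have "\<dots> = (\<Oplus>i\<in>{1..n}. w0 (e i) \<otimes> \<delta> (d i) z \<otimes> w0 z') \<oplus> (\<Oplus>i\<in>{1..n}. w0 (e i) \<otimes> \<delta> (z \<otimes>\<^bsub>E\<^esub> d i) z')"
      using z z' by (intro C.finsum_addf) auto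
    also have "(\<Oplus>i\<in>{1..n}. w0 (e i) \<otimes> \<delta> (d i) z \<otimes> w0 z') = c z \<otimes> w0 z'"
      unfolding c_def using z z' by (intro C.finsum_ldistr[symmetric]) auto
    also have "(\<Oplus>i\<in>{1..n}. w0 (e i) \<otimes> \<delta> (z \<otimes>\<^bsub>E\<^esub> d i) z') = (\<Oplus>i\<in>{1..n}. w0 (z \<otimes>\<^bsub>E\<^esub> e i) \<otimes> \<delta> (d i) z')"
      by (rule casimir[OF C.cring_axioms u w0_lin \<delta>_lin[OF z'] z, symmetric])
    also have "\<dots> = (\<Oplus>i\<in>{1..n}. w0 z \<otimes> (w0 (e i) \<otimes> \<delta> (d i) z'))"
      using z z' by (intro C.finsum_cong') (auto simp: w0_J)
    also have "\<dots> = w0 z \<otimes> c z'"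
      unfolding c_def using z z' by (intro C.finsum_rdistr[symmetric]) auto
    finally show ?thesis .
  qed
  define w where "w z = w0 z \<oplus> c z" for z
  have wc [simp]: "w z \<in> carrier C" if "z \<in> carrier E" for z unfolding w_def using that by simp
  have qw: "q (w z) = v z" if z: "z \<in> carrier E" for z
    unfolding w_def using z qw0[OF z] q_zero_iff[of "c z"] Q.S.r_zero[OF V.hom_closed[OF z]] by simp
  have w_mult: "w (x \<otimes>\<^bsub>E\<^esub> y) = w x \<otimes> w y" if x: "x \<in> carrier E" and y: "y \<in> carrier E" for x y
  proof -
    have "w (x \<otimes>\<^bsub>E\<^esub> y) = w0 x \<otimes> w0 y \<oplus> (c (x \<otimes>\<^bsub>E\<^esub> y) \<oplus> \<delta> x y)"
      unfolding w_def using x y by (simp add: w0_mult C.a_ac)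
    also have "\<dots> = w0 x \<otimes> w0 y \<oplus> (c x \<otimes> w0 y \<oplus> w0 x \<otimes> c y)" using x y by (simp add: c_mult)
    also have "\<dots> = w x \<otimes> w y"
      unfolding w_def using x y J_sq[of "c x" "c y"] by (simp add: C.l_distr C.r_distr C.a_ac)
    finally show ?thesis .
  qed
  have w_smult: "w (h b \<otimes>\<^bsub>E\<^esub> x) = u b \<otimes> w x" if "b \<in> carrier B" "x \<in> carrier E" for b x
    unfolding w_def using that by (simp add: w0_smult c_smult C.r_distr)
  \<comment> \<open>The \<open>l i\<close> were chosen without regard to 1, so preservation of the
    unit has to be proved. The element \<open>?j\<close> is idempotent because the image of 1 is,
    and it has square zero because it lies in \<open>J\<close>; hence it is zero.\<close>
  have w_one: "w \<one>\<^bsub>E\<^esub> = \<one>"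
  proof -
    let ?j = "\<one> \<ominus> w \<one>\<^bsub>E\<^esub>"
    have "q \<one> = q (w \<one>\<^bsub>E\<^esub>)" using qw by simp
    hence j: "?j \<in> J" using q_eq_iff[OF C.one_closed wc[OF S.one_closed]] by blast
    have "w \<one>\<^bsub>E\<^esub> \<otimes> w \<one>\<^bsub>E\<^esub> = w \<one>\<^bsub>E\<^esub>" using w_mult[of "\<one>\<^bsub>E\<^esub>" "\<one>\<^bsub>E\<^esub>"] by simp
    hence "w \<one>\<^bsub>E\<^esub> \<otimes> ?j = \<zero>" by (simp add: C.minus_eq C.r_distr C.r_minus C.r_neg)
    moreover have "?j \<otimes> ?j = \<zero>" using j by (intro J_sq)
    moreover have "?j \<otimes> ?j = ?j \<ominus> w \<one>\<^bsub>E\<^esub> \<otimes> ?j"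
      using j by (simp add: C.minus_eq C.l_distr C.l_minus del: J_closed)
    ultimately have "?j = \<zero>" using J_closed[OF j] by (simp add: C.minus_eq)
    thus ?thesis by simp
  qed
  have "w \<in> ring_hom E C"
    using w_mult w_one w0_add c_add by (intro ring_hom_memI) (auto simp: w_def C.a_ac)
  moreover have "w (h b) = u b" if "b \<in> carrier B" for b
    using w_smult[OF that S.one_closed] w_one that by simp
  ultimately show ?thesis using qw by blast
qed

end

context separable_extension
begin

lemma formally_etale: "formally_etale TYPE('c) B E h"
  unfolding formally_etale_def
proof (intro allI impI)
  fix C :: "'c ring" and J u v
  assume a: "cring C \<and> ideal J C \<and> J \<cdot>\<^bsub>C\<^esub> J = {\<zero>\<^bsub>C\<^esub>} \<and> u \<in> ring_hom B C \<and> v \<in> ring_hom E (C Quot J) \<and>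
       (\<forall>b\<in>carrier B. v (h b) = J +>\<^bsub>C\<^esub> u b)"
  have sq: "a \<otimes>\<^bsub>C\<^esub> b = \<zero>\<^bsub>C\<^esub>" if "a \<in> J" "b \<in> J" for a b
    using ideal_prod.prod[OF that, of C] a by simp
  interpret C: cring C using a by simp
  interpret J: ideal J C using a by simp
  interpret square_zero_lifting B E h n e d C J u v
    using a sq by unfold_locales auto
  obtain w where w: "w \<in> ring_hom E C" "\<forall>b\<in>carrier B. w (h b) = u b" "\<forall>z\<in>carrier E. q (w z) = v z"
    using lift_exists by blast
  \<comment> \<open>Uniqueness in \<open>formally_etale\<close> is among functions extensional on
    \<open>carrier E\<close>, so the lift is normalized outside the carrier.\<close>
  let ?w = "restrict w (carrier E)"
  show "\<exists>!w. w \<in> ring_hom E C \<and> w \<in> extensional (carrier E) \<and>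
          (\<forall>b\<in>carrier B. w (h b) = u b) \<and> (\<forall>z\<in>carrier E. J +>\<^bsub>C\<^esub> w z = v z)"
  proof (rule ex1I)
    have "?w \<in> ring_hom E C" using w(1) unfolding ring_hom_def by auto
    thus "?w \<in> ring_hom E C \<and> ?w \<in> extensional (carrier E) \<and>
          (\<forall>b\<in>carrier B. ?w (h b) = u b) \<and> (\<forall>z\<in>carrier E. J +>\<^bsub>C\<^esub> ?w z = v z)"
      using w by simp
    fix w' assume w': "w' \<in> ring_hom E C \<and> w' \<in> extensional (carrier E) \<and>
          (\<forall>b\<in>carrier B. w' (h b) = u b) \<and> (\<forall>z\<in>carrier E. J +>\<^bsub>C\<^esub> w' z = v z)"
    show "w' = ?w"
    proof (rule extensionalityI[of _ "carrier E"])
      fix z assume z: "z \<in> carrier E"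
      have "w' z = w z"
        by (rule lift_unique[of w' w, OF _ _ _ w(1)]) (use w w' z in blast)+
      thus "w' z = ?w z" using z by simp
    qed (use w' in \<open>simp_all only: restrict_extensional\<close>)
  qed
qed

end


section \<open>Free extensions are finitely presented\<close>

lemma comm_monoid_exponent_monoid: "comm_monoid (exponent_monoid m)"
  by (rule comm_monoidI) (auto simp: exponent_monoid_def add_ac)

context free_extension
begin

text \<open>The variables of \<open>mpoly_ring\<close> are numbered from 0 and the basis from 1, so
  variable \<open>k\<close> is sent to \<open>e (Suc k)\<close>.\<close>

definition monomial_eval where
  "monomial_eval x = (\<Otimes>k\<in>{..<n}. e (Suc k) [^] count x k)"

lemma basis_closed_Suc: "k < n \<Longrightarrow> e (Suc k) \<in> carrier E"
  by (intro basis_closed) (simp add: atLeastAtMost_iff)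

lemma monomial_eval_closed: "monomial_eval x \<in> carrier E"
  unfolding monomial_eval_def using basis_closed_Suc by (intro S.finprod_closed) auto

lemma monomial_eval_add: "monomial_eval (x + Y) = monomial_eval x \<otimes> monomial_eval Y"
proof -
  have "monomial_eval (x + Y) = (\<Otimes>k\<in>{..<n}. e (Suc k) [^] count x k \<otimes> e (Suc k) [^] count Y k)"
    unfolding monomial_eval_def using basis_closed_Suc
    by (intro S.finprod_cong') (auto simp: S.nat_pow_mult)
  also have "\<dots> = monomial_eval x \<otimes> monomial_eval Y"
    unfolding monomial_eval_def using basis_closed_Suc by (intro S.finprod_multf) auto
  finally show ?thesis .
qed

lemma monomial_eval_single:
  assumes "k < n"
  shows "monomial_eval {#k#} = e (Suc k)"
proof -
  have "monomial_eval {#k#} = (\<Otimes>j\<in>{..<n}. if k = j then e (Suc j) else \<one>)"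
    unfolding monomial_eval_def using basis_closed_Suc by (intro S.finprod_cong') auto
  also have "\<dots> = e (Suc k)"
    using assms basis_closed_Suc by (intro S.finprod_singleton) auto
  finally show ?thesis .
qed

lemma monomial_eval_empty: "monomial_eval {#} = \<one>"
  unfolding monomial_eval_def by simp

lemma mpoly_eval_locale: "monoid_algebra_eval B (exponent_monoid n) E h"
  by (intro monoid_algebra_eval.intro monoid_algebra_over.intro comm_monoid_exponent_monoid
      R.cring_axioms S.cring_axioms ring_hom_cring_axioms)

text \<open>Modulo the relations every polynomial is a linear form: the set \<open>W\<close> of such
  polynomials contains 1 and is closed under sums, scalars and multiplication by variables. A linear
  form in the kernel has zero coefficients by independence of the \<open>e i\<close>, so the
  relations generate the kernel.\<close>

lemma finitely_presented: "finitely_presented B E h"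
proof -
  interpret M: monoid_algebra_eval B "exponent_monoid n" E h by (rule mpoly_eval_locale)
  let ?G = "exponent_monoid n" and ?P = "mpoly_ring B n" and ?I = "{1..n}"
  have P: "?P = M.F" by (simp add: mpoly_ring_def)
  let ?\<psi> = "M.ev monomial_eval"
  interpret \<psi>: ring_hom_cring M.F E ?\<psi>
    by (rule M.ev_ring_hom) (auto simp: exponent_monoid_def monomial_eval_closed monomial_eval_add monomial_eval_empty)
  have \<psi>r: "ring_hom_ring M.F E ?\<psi>"
    by (rule ring_hom_ringI2[OF M.F.ring_axioms S.ring_axioms \<psi>.homh])
  let ?s = "\<lambda>k a. M.single {#k - 1#} a"
  \<comment> \<open>\<open>x i\<close> is the variable that goes to \<open>e i\<close>, and
    \<open>Y c\<close> the linear form with coefficients \<open>c\<close> and no constant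
    term.\<close>
  define x where "x i = ?s i \<one>\<^bsub>B\<^esub>" for i :: nat
  define Y where "Y c = (\<Oplus>\<^bsub>M.F\<^esub>k\<in>?I. ?s k (c k))" for c
  let ?cB = "\<lambda>c. \<forall>k\<in>?I. c k \<in> carrier B"
  have kG: "{#k - 1#} \<in> carrier ?G" if "k \<in> ?I" for k using that by (auto simp: exponent_monoid_def atLeastAtMost_iff)
  have eG: "{#} \<in> carrier ?G" by (simp add: exponent_monoid_def)
  have ks: "k - 1 < n" "Suc (k - 1) = k" if "k \<in> ?I" for k using that by (auto simp: atLeastAtMost_iff)
  have sc: "?s k a \<in> carrier M.F" if "k \<in> ?I" "a \<in> carrier B" for k a
    using that kG by (intro M.single_closed)
  have Xc: "x k \<in> carrier M.F" if "k \<in> ?I" for k unfolding x_def using that sc by simp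
  have Yc: "Y c \<in> carrier M.F" if "?cB c" for c
    unfolding Y_def using that sc by (intro M.F.finsum_closed) auto
  have \<psi>s: "?\<psi> (?s k a) = h a \<otimes> e k" if "k \<in> ?I" "a \<in> carrier B" for k a
    using that kG ks[OF that(1)] monomial_eval_closed monomial_eval_single[of "k - 1"]
    by (subst M.ev_single) auto
  have \<psi>x: "?\<psi> (x k) = e k" if "k \<in> ?I" for k unfolding x_def using \<psi>s that by simp
  have \<psi>Y: "?\<psi> (Y c) = (\<Oplus>k\<in>?I. h (c k) \<otimes> e k)" if c: "?cB c" for c
  proof -
    have "?\<psi> (Y c) = (\<Oplus>k\<in>?I. ?\<psi> (?s k (c k)))"
      unfolding Y_def using c sc by (subst \<psi>.hom_finsum) (auto simp: o_def)
    also have "\<dots> = (\<Oplus>k\<in>?I. h (c k) \<otimes> e k)"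
      using c \<psi>s by (intro S.finsum_cong') auto
    finally show ?thesis .
  qed
  have \<psi>b: "?\<psi> (M.single {#} b) = h b" if "b \<in> carrier B" for b
    using that eG monomial_eval_closed by (subst M.ev_single) (auto simp: monomial_eval_empty)
  have coordB: "?cB (coord z)" if "z \<in> carrier E" for z using that by simp
  \<comment> \<open>Besides the multiplication table, one relation expresses 1 as a linear form. The
    basis need not contain 1, and without this relation the constants would stay outside the span of
    the variables.\<close>
  define Rel where "Rel = (\<lambda>(i, j). x i \<otimes>\<^bsub>M.F\<^esub> x j \<ominus>\<^bsub>M.F\<^esub> Y (coord (e i \<otimes> e j))) ` (?I \<times> ?I)
      \<union> {\<one>\<^bsub>M.F\<^esub> \<ominus>\<^bsub>M.F\<^esub> Y (coord \<one>)}"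
  have Rel_fin: "finite Rel" by (simp add: Rel_def)
  have Rel_c: "Rel \<subseteq> carrier M.F"
    unfolding Rel_def using Xc Yc by (auto intro!: M.F.minus_closed M.F.m_closed)
  define K where "K = a_kernel M.F E ?\<psi>"
  have K_mem: "p \<in> K \<longleftrightarrow> p \<in> carrier M.F \<and> ?\<psi> p = \<zero>" for p
    unfolding K_def a_kernel_def' by auto
  have K_ideal: "ideal K M.F" unfolding K_def by (rule ring_hom_ring.kernel_is_ideal[OF \<psi>r])
  have RelK: "Rel \<subseteq> K"
  proof
    fix r assume r: "r \<in> Rel"
    hence rc: "r \<in> carrier M.F" using Rel_c by blast
    from r consider i j where "i \<in> ?I" "j \<in> ?I" "r = x i \<otimes>\<^bsub>M.F\<^esub> x j \<ominus>\<^bsub>M.F\<^esub> Y (coord (e i \<otimes> e j))"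
      | "r = \<one>\<^bsub>M.F\<^esub> \<ominus>\<^bsub>M.F\<^esub> Y (coord \<one>)" unfolding Rel_def by auto
    hence "?\<psi> r = \<zero>"
    proof cases
      case 1
      thus ?thesis using Xc Yc \<psi>x
        by (simp add: M.F.minus_eq \<psi>Y coord_sum S.r_neg)
    next
      case 2
      thus ?thesis using Yc by (simp add: M.F.minus_eq \<psi>Y coord_sum S.r_neg)
    qed
    thus "r \<in> K" using rc K_mem by simp
  qed
  define J where "J = Idl\<^bsub>M.F\<^esub> Rel"
  interpret J: ideal J M.F unfolding J_def by (rule M.F.genideal_ideal[OF Rel_c])
  have RelJ: "Rel \<subseteq> J" unfolding J_def by (rule M.F.genideal_self[OF Rel_c])
  have JK: "J \<subseteq> K" unfolding J_def by (rule M.F.genideal_minimal[OF K_ideal RelK])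
  define W where "W = {Y c \<oplus>\<^bsub>M.F\<^esub> j | c j. ?cB c \<and> j \<in> J}"
  have WI: "Y c \<oplus>\<^bsub>M.F\<^esub> j \<in> W" if "?cB c" "j \<in> J" for c j using that unfolding W_def by blast
  have Y_add: "Y c \<oplus>\<^bsub>M.F\<^esub> Y c' = Y (\<lambda>k. c k \<oplus>\<^bsub>B\<^esub> c' k)" if "?cB c" "?cB c'" for c c'
  proof -
    have "?s k (a \<oplus>\<^bsub>B\<^esub> b) = ?s k a \<oplus>\<^bsub>M.F\<^esub> ?s k b" for k a b
      using R.l_zero[OF R.zero_closed] by (auto simp: M.F_add monoid_algebra_single_def)
    hence "Y (\<lambda>k. c k \<oplus>\<^bsub>B\<^esub> c' k) = (\<Oplus>\<^bsub>M.F\<^esub>k\<in>?I. ?s k (c k) \<oplus>\<^bsub>M.F\<^esub> ?s k (c' k))" unfolding Y_def by simp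
    also have "\<dots> = Y c \<oplus>\<^bsub>M.F\<^esub> Y c'" unfolding Y_def using that sc by (intro M.F.finsum_addf) auto
    finally show ?thesis ..
  qed
  have Y_smult: "M.single {#} a \<otimes>\<^bsub>M.F\<^esub> Y c = Y (\<lambda>k. a \<otimes>\<^bsub>B\<^esub> c k)" if "a \<in> carrier B" "?cB c" for a c
  proof -
    have ac: "M.single {#} a \<in> carrier M.F" using that eG by (intro M.single_closed)
    have "M.single {#} a \<otimes>\<^bsub>M.F\<^esub> Y c = (\<Oplus>\<^bsub>M.F\<^esub>k\<in>?I. M.single {#} a \<otimes>\<^bsub>M.F\<^esub> ?s k (c k))"
      unfolding Y_def using that sc ac by (intro M.F.finsum_rdistr) auto
    also have "\<dots> = Y (\<lambda>k. a \<otimes>\<^bsub>B\<^esub> c k)" unfolding Y_def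
    proof (intro M.F.finsum_cong')
      fix k assume k: "k \<in> ?I"
      have "{#} \<otimes>\<^bsub>?G\<^esub> {#k - 1#} = {#k - 1#}" by (simp add: exponent_monoid_def)
      thus "M.single {#} a \<otimes>\<^bsub>M.F\<^esub> ?s k (c k) = ?s k (a \<otimes>\<^bsub>B\<^esub> c k)"
        using M.single_mult[OF eG kG[OF k] that(1)] that(2) k by simp
    qed (use that sc in auto)
    finally show ?thesis .
  qed
  have Y_zero: "Y (\<lambda>k. \<zero>\<^bsub>B\<^esub>) = \<zero>\<^bsub>M.F\<^esub>"
  proof -
    have "?s k \<zero>\<^bsub>B\<^esub> = \<zero>\<^bsub>M.F\<^esub>" for k by (auto simp: M.F_zero monoid_algebra_single_def)
    thus ?thesis unfolding Y_def by simp
  qed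
  have W_c: "p \<in> carrier M.F" if "p \<in> W" for p
    using that Yc J.Icarr unfolding W_def by auto
  have W_add: "p \<oplus>\<^bsub>M.F\<^esub> p' \<in> W" if p: "p \<in> W" and p': "p' \<in> W" for p p'
  proof -
    obtain c j where c: "?cB c" "j \<in> J" "p = Y c \<oplus>\<^bsub>M.F\<^esub> j" using p W_def by blast
    obtain c' j' where c': "?cB c'" "j' \<in> J" "p' = Y c' \<oplus>\<^bsub>M.F\<^esub> j'" using p' W_def by blast
    have "p \<oplus>\<^bsub>M.F\<^esub> p' = (Y c \<oplus>\<^bsub>M.F\<^esub> Y c') \<oplus>\<^bsub>M.F\<^esub> (j \<oplus>\<^bsub>M.F\<^esub> j')"
      using Yc[OF c(1)] Yc[OF c'(1)] J.Icarr[OF c(2)] J.Icarr[OF c'(2)] c(3) c'(3) by (simp add: M.F.a_ac)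
    also have "\<dots> = Y (\<lambda>k. c k \<oplus>\<^bsub>B\<^esub> c' k) \<oplus>\<^bsub>M.F\<^esub> (j \<oplus>\<^bsub>M.F\<^esub> j')" using Y_add[OF c(1) c'(1)] by simp
    finally show ?thesis using WI[of "\<lambda>k. c k \<oplus>\<^bsub>B\<^esub> c' k" "j \<oplus>\<^bsub>M.F\<^esub> j'"] c c' J.a_closed by simp
  qed
  have W_J: "j \<in> W" if "j \<in> J" for j
    using WI[of "\<lambda>k. \<zero>\<^bsub>B\<^esub>" j] that Y_zero J.Icarr[OF that] by simp
  have W_Y: "Y c \<in> W" if "?cB c" for c
    using WI[OF that J.zero_closed] Yc[OF that] by simp
  have W_smult: "M.single {#} a \<otimes>\<^bsub>M.F\<^esub> p \<in> W" if a: "a \<in> carrier B" and p: "p \<in> W" for a p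
  proof -
    obtain c j where c: "?cB c" "j \<in> J" "p = Y c \<oplus>\<^bsub>M.F\<^esub> j" using p W_def by blast
    have ac: "M.single {#} a \<in> carrier M.F" using a eG by (intro M.single_closed)
    have "M.single {#} a \<otimes>\<^bsub>M.F\<^esub> p = Y (\<lambda>k. a \<otimes>\<^bsub>B\<^esub> c k) \<oplus>\<^bsub>M.F\<^esub> M.single {#} a \<otimes>\<^bsub>M.F\<^esub> j"
      using c(3) ac Yc[OF c(1)] J.Icarr[OF c(2)] Y_smult[OF a c(1)] by (simp add: M.F.r_distr)
    moreover have "M.single {#} a \<otimes>\<^bsub>M.F\<^esub> j \<in> J" using c(2) ac by (rule J.I_l_closed)
    ultimately show ?thesis using WI[of "\<lambda>k. a \<otimes>\<^bsub>B\<^esub> c k" "M.single {#} a \<otimes>\<^bsub>M.F\<^esub> j"] a c(1) by simp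
  qed
  have W_diff: "p \<in> W" if "p \<in> carrier M.F" "?cB c" "p \<ominus>\<^bsub>M.F\<^esub> Y c \<in> J" for p c
  proof -
    have "Y c \<oplus>\<^bsub>M.F\<^esub> (p \<ominus>\<^bsub>M.F\<^esub> Y c) = p"
      using that(1) Yc[OF that(2)] M.F.r_neg2[of "Y c" p] by (simp add: M.F.minus_eq M.F.a_ac)
    thus ?thesis using WI[OF that(2,3)] by simp
  qed
  have W_one: "\<one>\<^bsub>M.F\<^esub> \<in> W"
    using RelJ by (intro W_diff[of _ "coord \<one>"]) (auto simp: Rel_def)
  have W_XX: "x i \<otimes>\<^bsub>M.F\<^esub> x j \<in> W" if "i \<in> ?I" "j \<in> ?I" for i j
    using RelJ that Xc by (intro W_diff[of _ "coord (e i \<otimes> e j)"]) (auto simp: Rel_def)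
  have W_sum: "(\<Oplus>\<^bsub>M.F\<^esub>k\<in>L. f k) \<in> W" if "finite L" "\<And>k. k \<in> L \<Longrightarrow> f k \<in> W" for f and L :: "nat set"
    using that
  proof (induction L rule: finite_induct)
    case empty
    show ?case using W_J[OF J.zero_closed] by simp
  next
    case (insert k L)
    thus ?case using W_c W_add by (subst M.F.finsum_insert) auto
  qed
  \<comment> \<open>The multiplication table is used here: a variable times a linear form is a
    combination of products \<open>x i\<close> times \<open>x k\<close>, each of which is in
    \<open>W\<close>.\<close>
  have W_X: "x i \<otimes>\<^bsub>M.F\<^esub> p \<in> W" if i: "i \<in> ?I" and p: "p \<in> W" for i p
  proof -
    obtain c j where c: "?cB c" "j \<in> J" "p = Y c \<oplus>\<^bsub>M.F\<^esub> j" using p W_def by blast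
    have "x i \<otimes>\<^bsub>M.F\<^esub> Y c = (\<Oplus>\<^bsub>M.F\<^esub>k\<in>?I. x i \<otimes>\<^bsub>M.F\<^esub> ?s k (c k))"
      unfolding Y_def using c(1) sc Xc[OF i] by (intro M.F.finsum_rdistr) auto
    moreover have "x i \<otimes>\<^bsub>M.F\<^esub> ?s k (c k) \<in> W" if k: "k \<in> ?I" for k
    proof -
      have ac: "M.single {#} (c k) \<in> carrier M.F" using c(1) k eG by (intro M.single_closed) auto
      have "{#} \<otimes>\<^bsub>?G\<^esub> {#k - 1#} = {#k - 1#}" by (simp add: exponent_monoid_def)
      hence "?s k (c k) = M.single {#} (c k) \<otimes>\<^bsub>M.F\<^esub> x k"
        using M.single_mult[OF eG kG[OF k], of "c k" "\<one>\<^bsub>B\<^esub>"] c(1) k by (simp add: x_def)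
      hence "x i \<otimes>\<^bsub>M.F\<^esub> ?s k (c k) = M.single {#} (c k) \<otimes>\<^bsub>M.F\<^esub> (x i \<otimes>\<^bsub>M.F\<^esub> x k)"
        using ac Xc i k by (simp add: M.F.m_ac)
      thus ?thesis using W_smult W_XX[OF i k] c(1) k by simp
    qed
    ultimately have "x i \<otimes>\<^bsub>M.F\<^esub> Y c \<in> W" using W_sum[of ?I] by simp
    moreover have "x i \<otimes>\<^bsub>M.F\<^esub> j \<in> W" using J.I_l_closed[OF c(2) Xc[OF i]] by (rule W_J)
    ultimately show ?thesis
      using W_add c(3) Xc[OF i] Yc[OF c(1)] J.Icarr[OF c(2)] by (simp add: M.F.r_distr)
  qed
  have W_single: "M.single N a \<in> W" if "N \<in> carrier ?G" "a \<in> carrier B" for N a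
    using that(1)
  proof (induction N)
    case empty
    have ac: "M.single {#} a \<in> carrier M.F" using that(2) eG by (intro M.single_closed)
    show ?case using W_smult[OF that(2) W_one] ac by simp
  next
    case (add k N)
    hence k: "Suc k \<in> ?I" and N: "N \<in> carrier ?G" by (auto simp: exponent_monoid_def atLeastAtMost_iff)
    have "{#k#} \<otimes>\<^bsub>?G\<^esub> N = add_mset k N" by (simp add: exponent_monoid_def)
    hence "M.single (add_mset k N) a = x (Suc k) \<otimes>\<^bsub>M.F\<^esub> M.single N a"
      using M.single_mult[OF kG[OF k] N, of "\<one>\<^bsub>B\<^esub>" a] that(2) by (simp add: x_def)
    thus ?case using W_X[OF k add.IH[OF N]] by simp
  qed
  have W_all: "p \<in> W" if "p \<in> carrier M.F" for p
    using that by (induction p rule: M.monoid_algebra_induct) (auto intro: W_J[OF J.zero_closed] W_add W_single)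
  have "K \<subseteq> J"
  proof
    fix p assume p: "p \<in> K"
    hence "p \<in> W" using W_all K_mem by blast
    then obtain c j where c: "?cB c" "j \<in> J" "p = Y c \<oplus>\<^bsub>M.F\<^esub> j" using W_def by blast
    have "?\<psi> j = \<zero>" using JK c(2) K_mem by blast
    hence "?\<psi> (Y c) = \<zero>" using p c(3) Yc[OF c(1)] J.Icarr[OF c(2)] K_mem by auto
    hence z: "\<zero> = (\<Oplus>k\<in>?I. h (c k) \<otimes> e k)" using \<psi>Y[OF c(1)] by simp
    \<comment> \<open>Two expansions of 0 are compared, since independence is available as
      uniqueness of coordinates.\<close>
    have z': "\<zero> = (\<Oplus>k\<in>?I. h \<zero>\<^bsub>B\<^esub> \<otimes> e k)"
      by (subst S.add.finprod_one_eqI) auto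
    have "c k = \<zero>\<^bsub>B\<^esub>" if "k \<in> ?I" for k
      using coord_unique[OF _ z that] coord_unique[OF _ z' that] c(1) by auto
    hence "Y c = Y (\<lambda>k. \<zero>\<^bsub>B\<^esub>)" unfolding Y_def using sc by (intro M.F.finsum_cong') auto
    hence "p = j" using c(3) Y_zero J.Icarr[OF c(2)] by simp
    thus "p \<in> J" using c(2) by simp
  qed
  hence KJ: "K = J" using JK by blast
  have surj: "?\<psi> ` carrier M.F = carrier E"
  proof (intro subset_antisym subsetI)
    fix z assume z: "z \<in> carrier E"
    have "?\<psi> (Y (coord z)) = z" using \<psi>Y[OF coordB[OF z]] coord_sum[OF z] by simp
    thus "z \<in> ?\<psi> ` carrier M.F" using Yc[OF coordB[OF z]] by (metis imageI)
  qed auto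
  have iso: "(\<lambda>x. the_elem (?\<psi> ` x)) \<in> ring_iso (?P Quot (Idl\<^bsub>?P\<^esub> Rel)) E"
    using ring_hom_ring.FactRing_iso_set[OF \<psi>r surj] KJ unfolding P K_def J_def by simp
  moreover have "the_elem (?\<psi> ` ((Idl\<^bsub>?P\<^esub> Rel) +>\<^bsub>?P\<^esub> M.single {#} b)) = h b" if b: "b \<in> carrier B" for b
  proof -
    have "M.single {#} b \<in> carrier M.F" using b eG by (intro M.single_closed)
    thus ?thesis using ring_hom_ring.the_elem_simp[OF \<psi>r, of "M.single {#} b"] \<psi>b[OF b] KJ unfolding P K_def J_def by simp
  qed
  ultimately show ?thesis
    unfolding finitely_presented_def using Rel_fin Rel_c
    by (intro exI[of _ n] exI[of _ Rel] exI[of _ "\<lambda>x. the_elem (?\<psi> ` x)"]) (simp add: P)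
qed

end

context separable_extension
begin

lemma etale: "etale TYPE('c) B E h"
  unfolding etale_def using ring_hom_cring_axioms finitely_presented formally_etale by blast

end


section \<open>Extensions that become free after localization\<close>

text \<open>The data are to become fractions: \<open>c i z\<close> over \<open>f\<close> the
  coordinates of \<open>z\<close>, and \<open>d i\<close> over \<open>f\<close> the dual basis.
  \<open>torsion\<close> is what remains of linear independence before localizing, and
  \<open>dual_expand\<close> is \<open>dual_mult\<close> with its denominators cleared.\<close>

locale localized_free = localized_subring E K f
  for E :: "('t, 'k) ring_scheme" (structure) and K f +
  fixes n :: nat and e :: "nat \<Rightarrow> 't" and c :: "nat \<Rightarrow> 't \<Rightarrow> 't" and d :: "nat \<Rightarrow> 't"
  assumes e_closed [simp]: "i \<in> {1..n} \<Longrightarrow> e i \<in> carrier E"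
    and d_closed [simp]: "i \<in> {1..n} \<Longrightarrow> d i \<in> carrier E"
    and c_closed: "i \<in> {1..n} \<Longrightarrow> z \<in> carrier E \<Longrightarrow> c i z \<in> K"
    and expand: "z \<in> carrier E \<Longrightarrow> (\<Oplus>i\<in>{1..n}. c i z \<otimes> e i) = f \<otimes> z"
    and torsion: "\<And>r i. (\<And>j. j \<in> {1..n} \<Longrightarrow> r j \<in> K) \<Longrightarrow> (\<Oplus>j\<in>{1..n}. r j \<otimes> e j) = \<zero>
      \<Longrightarrow> i \<in> {1..n} \<Longrightarrow> f \<otimes> r i = \<zero>"
    and dual_unit: "(\<Oplus>i\<in>{1..n}. e i \<otimes> d i) = f"
    and dual_expand: "\<And>z i. z \<in> carrier E \<Longrightarrow> i \<in> {1..n}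
      \<Longrightarrow> (\<Oplus>j\<in>{1..n}. c i (z \<otimes> e j) \<otimes> d j) = f \<otimes> (z \<otimes> d i)"
begin

abbreviation h where "h \<equiv> loc_inclusion E f"
abbreviation eL where "eL i \<equiv> to_loc E f (e i)"
abbreviation dL where "dL i \<equiv> E.frac (d i) f"

sublocale h: ring_hom_cring B.L E.L h
  by (rule loc_inclusion_hom)

lemma K_closed [simp]: "r \<in> K \<Longrightarrow> r \<in> carrier E"
  using K_subset by blast

lemma eL_closed: "i \<in> {1..n} \<Longrightarrow> eL i \<in> carrier E.L"
  by (simp add: to_loc_def E.frac_closed)

lemma lin_comb:
  assumes "\<And>i. i \<in> {1..n} \<Longrightarrow> r i \<in> K" "s \<in> E.S"
  shows "(\<Oplus>\<^bsub>E.L\<^esub>i\<in>{1..n}. h (B.frac (r i) s) \<otimes>\<^bsub>E.L\<^esub> eL i) = E.frac (\<Oplus>i\<in>{1..n}. r i \<otimes> e i) s"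
proof -
  have "(\<Oplus>\<^bsub>E.L\<^esub>i\<in>{1..n}. h (B.frac (r i) s) \<otimes>\<^bsub>E.L\<^esub> eL i) = (\<Oplus>\<^bsub>E.L\<^esub>i\<in>{1..n}. E.frac (r i \<otimes> e i) s)"
    using assms by (intro E.L.finsum_cong')
      (auto simp: loc_inclusion_frac to_loc_def E.frac_mult_one intro!: E.frac_closed)
  also have "\<dots> = E.frac (\<Oplus>i\<in>{1..n}. r i \<otimes> e i) s" using assms by (intro E.frac_finsum) auto
  finally show ?thesis .
qed

text \<open>Over a common denominator, the relation says that some power \<open>t\<close> of
  \<open>f\<close> kills the sum of the \<open>r i \<otimes> e i\<close>. As \<open>t\<close> lies
  in \<open>K\<close>, it can be absorbed into the coefficients, and \<open>torsion\<close> shows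
  that \<open>f \<otimes> t\<close> kills each \<open>r i\<close>.\<close>

lemma eL_independent:
  assumes x: "\<And>i. i \<in> {1..n} \<Longrightarrow> x i \<in> carrier B.L"
    and 0: "(\<Oplus>\<^bsub>E.L\<^esub>i\<in>{1..n}. h (x i) \<otimes>\<^bsub>E.L\<^esub> eL i) = \<zero>\<^bsub>E.L\<^esub>" and i: "i \<in> {1..n}"
  shows "x i = \<zero>\<^bsub>B.L\<^esub>"
proof -
  have "\<exists>s\<in>E.S. \<exists>r. \<forall>i\<in>{1..n}. r i \<in> K \<and> x i = B.frac (r i) s"
    using B.common_denominator[of "{1..n}" x] x by simp
  then obtain s r where s: "s \<in> E.S" and r: "\<And>i. i \<in> {1..n} \<Longrightarrow> r i \<in> K \<and> x i = B.frac (r i) s"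
    by blast
  have "(\<Oplus>\<^bsub>E.L\<^esub>i\<in>{1..n}. h (x i) \<otimes>\<^bsub>E.L\<^esub> eL i) = (\<Oplus>\<^bsub>E.L\<^esub>i\<in>{1..n}. h (B.frac (r i) s) \<otimes>\<^bsub>E.L\<^esub> eL i)"
    using r s eL_closed x by (intro E.L.finsum_cong') auto
  also have "\<dots> = E.frac (\<Oplus>i\<in>{1..n}. r i \<otimes> e i) s" using r s by (intro lin_comb) auto
  finally have "E.frac (\<Oplus>i\<in>{1..n}. r i \<otimes> e i) s = \<zero>\<^bsub>E.L\<^esub>" using 0 by simp
  moreover have rc: "(\<Oplus>i\<in>{1..n}. r i \<otimes> e i) \<in> carrier E" using r by (intro E.finsum_closed) auto
  ultimately obtain t where t: "t \<in> E.S" "t \<otimes> (\<Oplus>i\<in>{1..n}. r i \<otimes> e i) = \<zero>"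
    using E.frac_eq_zero_iff[OF _ s] by blast
  have tK: "t \<in> K" using B.powers_closed[of t] t(1) by simp
  have trK: "t \<otimes> r j \<in> K" if "j \<in> {1..n}" for j using B.m_closed[of t "r j"] tK r that by simp
  have "(\<Oplus>j\<in>{1..n}. (t \<otimes> r j) \<otimes> e j) = (\<Oplus>j\<in>{1..n}. t \<otimes> (r j \<otimes> e j))"
    using r t(1) by (intro E.finsum_cong') (auto simp: E.m_assoc)
  also have "\<dots> = t \<otimes> (\<Oplus>i\<in>{1..n}. r i \<otimes> e i)"
    using r t(1) by (intro E.finsum_rdistr[symmetric]) auto
  also have "\<dots> = \<zero>" by (rule t(2))
  finally have "f \<otimes> (t \<otimes> r i) = \<zero>" using trK i by (intro torsion)
  hence "(f \<otimes> t) \<otimes> r i = \<zero>" using r i t(1) E.f_closed by (simp add: E.m_assoc)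
  moreover have "f \<otimes> t \<in> E.S" using t(1) by simp
  ultimately have "B.frac (r i) s = \<zero>\<^bsub>B.L\<^esub>" using B.frac_eq_zero_iff[of "r i" s] r[OF i] s by auto
  thus ?thesis using r[OF i] by simp
qed

lemma frac_coordinates:
  assumes "r \<in> carrier E" "s \<in> E.S"
  shows "is_coordinates B.L E.L h n eL (E.frac r s) (\<lambda>i\<in>{1..n}. B.frac (c i r) (f \<otimes> s))"
  unfolding is_coordinates_def
proof
  have fs: "f \<otimes> s \<in> E.S" using assms by simp
  have "B.frac (c i r) (f \<otimes> s) \<in> carrier B.L" if "i \<in> {1..n}" for i
    using c_closed[OF that assms(1)] fs B.frac_closed[of "c i r" "f \<otimes> s"] by simp
  thus "(\<lambda>i\<in>{1..n}. B.frac (c i r) (f \<otimes> s)) \<in> {1..n} \<rightarrow>\<^sub>E carrier B.L" by auto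
  hence "(\<Oplus>\<^bsub>E.L\<^esub>i\<in>{1..n}. h ((\<lambda>i\<in>{1..n}. B.frac (c i r) (f \<otimes> s)) i) \<otimes>\<^bsub>E.L\<^esub> eL i)
     = (\<Oplus>\<^bsub>E.L\<^esub>i\<in>{1..n}. h (B.frac (c i r) (f \<otimes> s)) \<otimes>\<^bsub>E.L\<^esub> eL i)"
    using eL_closed by (intro E.L.finsum_cong') (auto simp: PiE_iff)
  also have "\<dots> = E.frac (\<Oplus>i\<in>{1..n}. c i r \<otimes> e i) (f \<otimes> s)"
    using c_closed assms(1) fs by (intro lin_comb)
  also have "\<dots> = E.frac r s"
    using assms E.f_closed unfolding expand[OF assms(1)] by (intro E.frac_eqI) (auto simp: E.m_ac)
  finally show "E.frac r s = (\<Oplus>\<^bsub>E.L\<^esub>i\<in>{1..n}. h ((\<lambda>i\<in>{1..n}. B.frac (c i r) (f \<otimes> s)) i) \<otimes>\<^bsub>E.L\<^esub> eL i)" ..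
qed

lemma eL_basis: "is_module_basis B.L E.L h n eL"
  unfolding is_module_basis_def
proof (intro conjI ballI funcsetI eL_closed)
  fix z assume "z \<in> carrier E.L"
  then obtain r s where rs: "r \<in> carrier E" "s \<in> E.S" "z = E.frac r s" by (rule E.loc_carrierE)
  show "\<exists>!c. is_coordinates B.L E.L h n eL z c"
  proof (rule ex_ex1I)
    show "\<exists>c. is_coordinates B.L E.L h n eL z c" using frac_coordinates[OF rs(1,2)] rs(3) by blast
    fix c1 c2 assume "is_coordinates B.L E.L h n eL z c1" "is_coordinates B.L E.L h n eL z c2"
    hence c1: "c1 \<in> {1..n} \<rightarrow>\<^sub>E carrier B.L" and z1: "z = (\<Oplus>\<^bsub>E.L\<^esub>i\<in>{1..n}. h (c1 i) \<otimes>\<^bsub>E.L\<^esub> eL i)"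
      and c2: "c2 \<in> {1..n} \<rightarrow>\<^sub>E carrier B.L" and z2: "z = (\<Oplus>\<^bsub>E.L\<^esub>i\<in>{1..n}. h (c2 i) \<otimes>\<^bsub>E.L\<^esub> eL i)"
      by (simp_all only: is_coordinates_def)
    have cc: "c1 i \<in> carrier B.L" "c2 i \<in> carrier B.L" if "i \<in> {1..n}" for i
      using c1 c2 that by (auto simp: PiE_iff)
    have "(\<Oplus>\<^bsub>E.L\<^esub>i\<in>{1..n}. h (c1 i \<ominus>\<^bsub>B.L\<^esub> c2 i) \<otimes>\<^bsub>E.L\<^esub> eL i)
        = (\<Oplus>\<^bsub>E.L\<^esub>i\<in>{1..n}. h (c1 i) \<otimes>\<^bsub>E.L\<^esub> eL i \<ominus>\<^bsub>E.L\<^esub> h (c2 i) \<otimes>\<^bsub>E.L\<^esub> eL i)"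
      using cc eL_closed
      by (intro E.L.finsum_cong') (auto simp: B.L.minus_eq E.L.minus_eq E.L.l_distr E.L.l_minus)
    also have "\<dots> = z \<ominus>\<^bsub>E.L\<^esub> z"
      using cc eL_closed z1[symmetric] z2[symmetric] by (subst E.L.finsum_diff) auto
    also have "\<dots> = \<zero>\<^bsub>E.L\<^esub>" using rs by simp
    finally have 0: "(\<Oplus>\<^bsub>E.L\<^esub>i\<in>{1..n}. h (c1 i \<ominus>\<^bsub>B.L\<^esub> c2 i) \<otimes>\<^bsub>E.L\<^esub> eL i) = \<zero>\<^bsub>E.L\<^esub>" .
    have "c1 i \<ominus>\<^bsub>B.L\<^esub> c2 i = \<zero>\<^bsub>B.L\<^esub>" if "i \<in> {1..n}" for i
      using cc 0 that by (intro eL_independent[of "\<lambda>i. c1 i \<ominus>\<^bsub>B.L\<^esub> c2 i"]) auto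
    hence "c1 i = c2 i" if "i \<in> {1..n}" for i using cc that by simp
    thus "c1 = c2" by (rule PiE_ext[OF c1 c2])
  qed
qed

sublocale free: free_extension B.L E.L h n eL
  by unfold_locales (rule eL_basis)

lemma coord_frac:
  assumes "r \<in> carrier E" "s \<in> E.S" "i \<in> {1..n}"
  shows "free.coord (E.frac r s) i = B.frac (c i r) (f \<otimes> s)"
proof -
  have "E.frac r s \<in> carrier E.L" using assms by (intro E.frac_closed)
  hence "free.coord (E.frac r s) = (\<lambda>i\<in>{1..n}. B.frac (c i r) (f \<otimes> s))"
    using free.coord_is_coordinates free.coordinates_ex1 frac_coordinates[OF assms(1,2)] by blast
  thus ?thesis using assms(3) by simp
qed

sublocale separable: separable_extension B.L E.L h n eL dL
proof unfold_locales
  show "dL i \<in> carrier E.L" if "i \<in> {1..n}" for i using that by (intro E.frac_closed) auto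
  have "(\<Oplus>\<^bsub>E.L\<^esub>i\<in>{1..n}. eL i \<otimes>\<^bsub>E.L\<^esub> dL i) = (\<Oplus>\<^bsub>E.L\<^esub>i\<in>{1..n}. E.frac (e i \<otimes> d i) f)"
    using E.f_closed by (intro E.L.finsum_cong') (auto simp: to_loc_def E.frac_mult intro!: E.frac_closed)
  also have "\<dots> = E.frac (\<Oplus>i\<in>{1..n}. e i \<otimes> d i) f" by (intro E.frac_finsum) auto
  also have "\<dots> = \<one>\<^bsub>E.L\<^esub>" unfolding dual_unit by (intro E.frac_one) simp
  finally show "(\<Oplus>\<^bsub>E.L\<^esub>i\<in>{1..n}. eL i \<otimes>\<^bsub>E.L\<^esub> dL i) = \<one>\<^bsub>E.L\<^esub>" .
next
  fix z i assume "z \<in> carrier E.L" and i: "i \<in> {1..n}"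
  then obtain r s where rs: "r \<in> carrier E" "s \<in> E.S" "z = E.frac r s" by (elim E.loc_carrierE)
  have fs: "f \<otimes> s \<in> E.S" "f \<otimes> s \<otimes> f \<in> E.S" "s \<otimes> f \<in> E.S" using rs by auto
  have t: "h (free.coord (z \<otimes>\<^bsub>E.L\<^esub> eL j) i) \<otimes>\<^bsub>E.L\<^esub> dL j = E.frac (c i (r \<otimes> e j) \<otimes> d j) (f \<otimes> s \<otimes> f)"
    if j: "j \<in> {1..n}" for j
  proof -
    have re: "r \<otimes> e j \<in> carrier E" using rs j by simp
    have "z \<otimes>\<^bsub>E.L\<^esub> eL j = E.frac (r \<otimes> e j) s" using rs j by (simp add: to_loc_def E.frac_mult_one)
    hence "free.coord (z \<otimes>\<^bsub>E.L\<^esub> eL j) i = B.frac (c i (r \<otimes> e j)) (f \<otimes> s)" using coord_frac[OF re rs(2) i] by simp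
    thus ?thesis using c_closed[OF i re] fs(1) j by (simp add: loc_inclusion_frac E.frac_mult)
  qed
  have cE: "c i (r \<otimes> e j) \<in> carrier E" if "j \<in> {1..n}" for j using c_closed[OF i] rs that by simp
  have "(\<Oplus>\<^bsub>E.L\<^esub>j\<in>{1..n}. h (free.coord (z \<otimes>\<^bsub>E.L\<^esub> eL j) i) \<otimes>\<^bsub>E.L\<^esub> dL j)
      = (\<Oplus>\<^bsub>E.L\<^esub>j\<in>{1..n}. E.frac (c i (r \<otimes> e j) \<otimes> d j) (f \<otimes> s \<otimes> f))"
    using t cE fs by (intro E.L.finsum_cong') (auto intro!: E.frac_closed)
  also have "\<dots> = E.frac (\<Oplus>j\<in>{1..n}. c i (r \<otimes> e j) \<otimes> d j) (f \<otimes> s \<otimes> f)"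
    using cE fs by (intro E.frac_finsum) auto
  also have "\<dots> = E.frac (r \<otimes> d i) (s \<otimes> f)"
    unfolding dual_expand[OF rs(1) i] using rs i fs E.f_closed
    by (intro E.frac_eqI) (auto simp: E.m_ac)
  also have "\<dots> = z \<otimes>\<^bsub>E.L\<^esub> dL i" using rs i by (simp add: E.frac_mult)
  finally show "z \<otimes>\<^bsub>E.L\<^esub> dL i = (\<Oplus>\<^bsub>E.L\<^esub>j\<in>{1..n}. h (free.coord (z \<otimes>\<^bsub>E.L\<^esub> eL j) i) \<otimes>\<^bsub>E.L\<^esub> dL j)" ..
qed

text \<open>\<open>finsum\<close> refers to the carrier, so the two sums are different terms; they
  agree because the inclusion is a ring homomorphism.\<close>

lemma finsum_subring:
  assumes "finite I" "\<And>i. i \<in> I \<Longrightarrow> r i \<in> K"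
  shows "finsum (E\<lparr>carrier := K\<rparr>) r I = finsum E r I"
  using ring_hom_cring.hom_finsum[OF ring_hom_cring_id_subring[OF E.cring_axioms B.cring_axioms K_subset], of r I] assms
  by (simp add: o_def Pi_iff)

text \<open>The diagonal coordinates of multiplication by \<open>w\<close> are the
  \<open>c i (e i \<otimes> w)\<close> over \<open>f\<close>. The hypothesis on \<open>t\<close>
  evaluates their sum, and one factor \<open>f\<close> cancels.\<close>

lemma linear_trace_mult:
  assumes w: "w \<in> carrier E" and t: "t \<in> K" "(\<Oplus>i\<in>{1..n}. c i (e i \<otimes> w)) = f \<otimes> t"
  shows "linear_trace B.L E.L h n eL (\<lambda>z. z \<otimes>\<^bsub>E.L\<^esub> to_loc E f w) = to_loc (E\<lparr>carrier := K\<rparr>) f t"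
proof -
  have cK: "c i (e i \<otimes> w) \<in> K" if "i \<in> {1..n}" for i using c_closed[OF that] that w by simp
  have fK: "f \<in> K" using B.f_closed by simp
  have "linear_trace B.L E.L h n eL (\<lambda>z. z \<otimes>\<^bsub>E.L\<^esub> to_loc E f w)
      = (\<Oplus>\<^bsub>B.L\<^esub>i\<in>{1..n}. free.coord (eL i \<otimes>\<^bsub>E.L\<^esub> to_loc E f w) i)"
    unfolding linear_trace_def free.coord_def ..
  also have "\<dots> = (\<Oplus>\<^bsub>B.L\<^esub>i\<in>{1..n}. B.frac (c i (e i \<otimes> w)) f)"
  proof (intro B.L.finsum_cong')
    fix i assume i: "i \<in> {1..n}"
    have "eL i \<otimes>\<^bsub>E.L\<^esub> to_loc E f w = E.frac (e i \<otimes> w) \<one>" using i w by (simp add: to_loc_def E.frac_mult_one)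
    thus "free.coord (eL i \<otimes>\<^bsub>E.L\<^esub> to_loc E f w) i = B.frac (c i (e i \<otimes> w)) f"
      using coord_frac[of "e i \<otimes> w" \<one> i] i w E.f_closed by simp
  qed (use cK B.frac_closed in auto)
  also have "\<dots> = B.frac (finsum (E\<lparr>carrier := K\<rparr>) (\<lambda>i. c i (e i \<otimes> w)) {1..n}) f"
    using cK by (intro B.frac_finsum) auto
  also have "finsum (E\<lparr>carrier := K\<rparr>) (\<lambda>i. c i (e i \<otimes> w)) {1..n} = f \<otimes> t"
    using finsum_subring[of "{1..n}" "\<lambda>i. c i (e i \<otimes> w)"] cK t(2) by simp
  also have "B.frac (f \<otimes> t) f = B.frac t \<one>"
    using B.frac_eqI[of "f \<otimes> t" f t \<one>] B.m_closed[of f t] fK t(1) E.f_closed by simp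
  finally show ?thesis by (simp add: to_loc_def)
qed

end


section \<open>Symmetric group actions\<close>

text \<open>In the application \<open>T\<close> is the tensor power and \<open>y p i\<close> the
  image of \<open>x i\<close> under the \<open>p\<close>-th co-projection. Permutations move the row
  index of \<open>y\<close> and leave the column index alone.\<close>

locale symmetric_action = cring T
  for T :: "('t, 'k) ring_scheme" (structure) +
  fixes n :: nat and act :: "(nat \<Rightarrow> nat) \<Rightarrow> 't \<Rightarrow> 't" and y :: "nat \<Rightarrow> nat \<Rightarrow> 't"
  assumes n_pos: "n \<ge> 1"
    and act_hom: "\<rho> permutes {1..n} \<Longrightarrow> act \<rho> \<in> ring_hom T T"
    and act_id: "t \<in> carrier T \<Longrightarrow> act id t = t"
    and act_comp: "\<rho> permutes {1..n} \<Longrightarrow> \<tau> permutes {1..n} \<Longrightarrow> t \<in> carrier T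
      \<Longrightarrow> act (\<rho> \<circ> \<tau>) t = act \<rho> (act \<tau> t)"
    and y_closed: "p \<in> {1..n} \<Longrightarrow> i \<in> {1..n} \<Longrightarrow> y p i \<in> carrier T"
    and act_y: "\<rho> permutes {1..n} \<Longrightarrow> p \<in> {1..n} \<Longrightarrow> i \<in> {1..n} \<Longrightarrow> act \<rho> (y p i) = y (\<rho> p) i"
begin

lemma act_hom_cring: "\<rho> permutes {1..n} \<Longrightarrow> ring_hom_cring T T (act \<rho>)"
  using act_hom by unfold_locales auto

lemma act_closed: "\<rho> permutes {1..n} \<Longrightarrow> t \<in> carrier T \<Longrightarrow> act \<rho> t \<in> carrier T"
  by (rule ring_hom_closed[OF act_hom])

lemma act_mult: "\<rho> permutes {1..n} \<Longrightarrow> s \<in> carrier T \<Longrightarrow> t \<in> carrier T \<Longrightarrow> act \<rho> (s \<otimes> t) = act \<rho> s \<otimes> act \<rho> t"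
  by (rule ring_hom_mult[OF act_hom])

lemma act_finsum:
  assumes "\<rho> permutes {1..n}" "\<And>i. i \<in> I \<Longrightarrow> t i \<in> carrier T"
  shows "act \<rho> (\<Oplus>i\<in>I. t i) = (\<Oplus>i\<in>I. act \<rho> (t i))"
  using ring_hom_cring.hom_finsum[OF act_hom_cring[OF assms(1)], of t I] assms(2) by (simp add: o_def Pi_iff)

definition fixed where "fixed P = {t \<in> carrier T. \<forall>\<rho>. \<rho> permutes P \<longrightarrow> act \<rho> t = t}"

lemma fixed_closed: "t \<in> fixed P \<Longrightarrow> t \<in> carrier T"
  by (simp add: fixed_def)

lemma fixed_subcring:
  assumes "P \<subseteq> {1..n}"
  shows "cring (T\<lparr>carrier := fixed P\<rparr>)"
proof -
  have p: "\<rho> permutes {1..n}" if "\<rho> permutes P" for \<rho> using permutes_subset[OF that assms] .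
  have "subcring (fixed P) T"
  proof (intro subcringI subringI)
    fix s t assume st: "s \<in> fixed P" "t \<in> fixed P"
    show "\<ominus> s \<in> fixed P" "s \<oplus> t \<in> fixed P" "s \<otimes> t \<in> fixed P"
      using st p ring_hom_cring.hom_a_inv[OF act_hom_cring] ring_hom_add[OF act_hom] act_mult
      by (auto simp: fixed_def)
    show "s \<otimes> t = t \<otimes> s" using st by (intro m_comm fixed_closed)
  qed (use p ring_hom_one[OF act_hom] in \<open>auto simp: fixed_def\<close>)
  thus ?thesis by (rule subcring_iff[THEN iffD1, rotated]) (auto simp: fixed_def)
qed

section \<open>The determinant of \<open>y\<close> and its adjugate under the action\<close>

abbreviation \<alpha> where "\<alpha> \<equiv> ring_det T n y"
definition disc where "disc = \<alpha> \<otimes> \<alpha>"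
text \<open>Formally \<open>disc\<close> times the transposed inverse of \<open>y\<close>: the
  inverse has the entries cofactor over \<alpha>, and these are expanded by \<alpha> to obtain the
  invariant denominator \<open>disc\<close>.\<close>

definition adj where "adj p i = \<alpha> \<otimes> cofactor n y p i"

lemma alpha_closed: "\<alpha> \<in> carrier T"
  using y_closed by (intro ring_det_closed)

lemma disc_closed: "disc \<in> carrier T"
  unfolding disc_def using alpha_closed by simp

lemma adj_closed: "adj p i \<in> carrier T"
  unfolding adj_def using alpha_closed cofactor_closed[of n y] y_closed by simp

lemma act_alpha:
  assumes r: "\<rho> permutes {1..n}"
  shows "act \<rho> \<alpha> = [sign \<rho>] \<cdot> \<alpha>"
proof -
  have "act \<rho> \<alpha> = ring_det T n (\<lambda>p i. act \<rho> (y p i))"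
    using y_closed by (intro ring_hom_cring.hom_ring_det[OF act_hom_cring[OF r]])
  also have "\<dots> = ring_det T n (\<lambda>p. y (\<rho> p))"
    using act_y[OF r] y_closed permutes_in_image[OF r] by (intro ring_det_cong) auto
  also have "\<dots> = [sign \<rho>] \<cdot> \<alpha>" using y_closed r by (intro ring_det_permute_rows)
  finally show ?thesis .
qed

text \<open>Acting on the entries leaves the unit row at place \<open>p\<close> and puts row
  \<open>\<rho> k\<close> of \<open>y\<close> at every other place \<open>k\<close>. As \<rho> is
  injective, this is \<open>y\<close> with row \<open>\<rho> p\<close> replaced by the unit row and
  with its rows permuted by \<rho>.\<close>

lemma act_cofactor:
  assumes r: "\<rho> permutes {1..n}" and p: "p \<in> {1..n}" and i: "i \<in> {1..n}"
  shows "act \<rho> (cofactor n y p i) = [sign \<rho>] \<cdot> cofactor n y (\<rho> p) i"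
proof -
  let ?u = "\<lambda>j. if j = i then \<one> else \<zero>"
  have "act \<rho> (cofactor n y p i) = ring_det T n (\<lambda>k j. act \<rho> ((y(p := ?u)) k j))"
    unfolding cofactor_def using y_closed by (intro ring_hom_cring.hom_ring_det[OF act_hom_cring[OF r]]) auto
  also have "\<dots> = ring_det T n (\<lambda>k. (y(\<rho> p := ?u)) (\<rho> k))"
  proof (rule ring_det_cong)
    fix k j assume kj: "k \<in> {1..n}" "j \<in> {1..n}"
    show "act \<rho> ((y(p := ?u)) k j) = (y(\<rho> p := ?u)) (\<rho> k) j"
      using act_y[OF r] kj injD[OF permutes_inj[OF r], of k p]
        ring_hom_one[OF act_hom[OF r]] ring_hom_cring.hom_zero[OF act_hom_cring[OF r]] by auto
    show "(y(\<rho> p := ?u)) (\<rho> k) j \<in> carrier T" using y_closed kj permutes_in_image[OF r] by auto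
  qed
  also have "\<dots> = [sign \<rho>] \<cdot> cofactor n y (\<rho> p) i"
    unfolding cofactor_def using y_closed r by (intro ring_det_permute_rows) auto
  finally show ?thesis .
qed

lemma sign_cancel:
  assumes "s \<in> carrier T" "t \<in> carrier T"
  shows "([sign \<rho>] \<cdot> s) \<otimes> ([sign \<rho>] \<cdot> t) = s \<otimes> t"
  using assms by (simp add: add_pow_sign l_minus r_minus)

lemma act_disc: "\<rho> permutes {1..n} \<Longrightarrow> act \<rho> disc = disc"
  unfolding disc_def using alpha_closed by (simp add: act_mult act_alpha sign_cancel)

lemma act_adj: "\<rho> permutes {1..n} \<Longrightarrow> p \<in> {1..n} \<Longrightarrow> i \<in> {1..n} \<Longrightarrow> act \<rho> (adj p i) = adj (\<rho> p) i"
  unfolding adj_def using alpha_closed cofactor_closed[of n y] y_closed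
  by (simp add: act_mult act_alpha act_cofactor sign_cancel)

lemma adj_row:
  assumes "p \<in> {1..n}" "q \<in> {1..n}"
  shows "(\<Oplus>i\<in>{1..n}. y q i \<otimes> adj p i) = (if p = q then disc else \<zero>)"
proof -
  have cc: "cofactor n y p i \<in> carrier T" for p i using cofactor_closed[of n y] y_closed by simp
  have "(\<Oplus>i\<in>{1..n}. y q i \<otimes> adj p i) = (\<Oplus>i\<in>{1..n}. \<alpha> \<otimes> (y q i \<otimes> cofactor n y p i))"
    unfolding adj_def using assms alpha_closed cc y_closed by (intro finsum_cong') (auto simp: m_ac)
  also have "\<dots> = \<alpha> \<otimes> (\<Oplus>i\<in>{1..n}. y q i \<otimes> cofactor n y p i)"
    using assms alpha_closed cc y_closed by (intro finsum_rdistr[symmetric]) auto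
  also have "\<dots> = (if p = q then disc else \<zero>)"
    using cofactor_row[of n y p q] y_closed assms alpha_closed by (simp add: disc_def)
  finally show ?thesis .
qed

lemma adj_column:
  assumes "i \<in> {1..n}" "j \<in> {1..n}"
  shows "(\<Oplus>p\<in>{1..n}. y p j \<otimes> adj p i) = (if i = j then disc else \<zero>)"
proof -
  have cc: "cofactor n y p i \<in> carrier T" for p i using cofactor_closed[of n y] y_closed by simp
  have "(\<Oplus>p\<in>{1..n}. y p j \<otimes> adj p i) = (\<Oplus>p\<in>{1..n}. \<alpha> \<otimes> (y p j \<otimes> cofactor n y p i))"
    unfolding adj_def using assms alpha_closed cc y_closed by (intro finsum_cong') (auto simp: m_ac)
  also have "\<dots> = \<alpha> \<otimes> (\<Oplus>p\<in>{1..n}. y p j \<otimes> cofactor n y p i)"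
    using assms alpha_closed cc y_closed by (intro finsum_rdistr[symmetric]) auto
  also have "\<dots> = (if i = j then disc else \<zero>)"
    using cofactor_column[of n y i j] y_closed assms alpha_closed by (simp add: disc_def)
  finally show ?thesis .
qed

section \<open>Conjugates and the two rings of invariants\<close>

lemma n_mem: "n \<in> {1..n}"
  using n_pos by (simp add: atLeastAtMost_iff)

abbreviation KB where "KB \<equiv> fixed {1..n}"
abbreviation KE where "KE \<equiv> fixed {1..n - 1}"

lemma sub_index: "{1..n - 1} \<subseteq> {1..n}"
  by (auto simp: atLeastAtMost_iff)

text \<open>The transpositions of \<open>p\<close> and \<open>n\<close>, with the identity for
  \<open>p = n\<close>, represent the cosets of the subgroup fixing \<open>n\<close>. On
  \<open>KE\<close> the choice of representatives does not matter, by
  \<open>act_eq_conj\<close>.\<close>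

definition conj where "conj p z = act (transpose p n) z"

lemma transpose_permutes: "p \<in> {1..n} \<Longrightarrow> transpose p n permutes {1..n}"
  using n_mem by (intro permutes_swap_id)

lemma conj_closed: "p \<in> {1..n} \<Longrightarrow> z \<in> carrier T \<Longrightarrow> conj p z \<in> carrier T"
  unfolding conj_def using transpose_permutes by (intro act_closed)

lemma conj_mult: "p \<in> {1..n} \<Longrightarrow> s \<in> carrier T \<Longrightarrow> t \<in> carrier T \<Longrightarrow> conj p (s \<otimes> t) = conj p s \<otimes> conj p t"
  unfolding conj_def using transpose_permutes by (intro act_mult)

lemma conj_y: "p \<in> {1..n} \<Longrightarrow> i \<in> {1..n} \<Longrightarrow> conj p (y n i) = y p i"
  unfolding conj_def using transpose_permutes n_mem by (simp add: act_y)

lemma conj_n: "z \<in> carrier T \<Longrightarrow> conj n z = z"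
proof -
  have "transpose n n = id" by (auto simp: transpose_def)
  thus "z \<in> carrier T \<Longrightarrow> conj n z = z" unfolding conj_def using act_id by simp
qed

text \<open>Following \<rho> by the transposition of \<open>\<rho> n\<close> and \<open>n\<close>
  brings \<open>n\<close> back to itself, so the composite permutes \<open>{1..n - 1}\<close> and
  fixes \<open>z\<close>. The transposition is an involution, so it can be moved to the other
  side.\<close>

lemma act_eq_conj:
  assumes r: "\<rho> permutes {1..n}" and z: "z \<in> KE"
  shows "act \<rho> z = conj (\<rho> n) z"
proof -
  let ?t = "transpose (\<rho> n) n"
  have zc: "z \<in> carrier T" using z by (rule fixed_closed)
  have t: "?t permutes {1..n}" using n_mem permutes_in_image[OF r] by (intro transpose_permutes) simp
  have tr: "(?t \<circ> \<rho>) permutes {1..n}" using r t by (rule permutes_compose)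
  have "(?t \<circ> \<rho>) permutes {1..n - 1}"
  proof (rule permutes_superset[OF tr])
    fix k assume "k \<in> {1..n} - {1..n - 1}"
    hence "k = n" by (auto simp: atLeastAtMost_iff)
    thus "(?t \<circ> \<rho>) k = k" by simp
  qed
  hence "act (?t \<circ> \<rho>) z = z" using z by (simp add: fixed_def)
  hence "act ?t (act \<rho> z) = z" using act_comp[OF t r zc] by simp
  hence "act ?t (act ?t (act \<rho> z)) = act ?t z" by simp
  moreover have "act ?t (act ?t (act \<rho> z)) = act \<rho> z"
    using act_comp[OF t t, of "act \<rho> z"] act_id act_closed[OF r zc] by simp
  ultimately show ?thesis by (simp add: conj_def)
qed

lemma act_conj:
  assumes r: "\<rho> permutes {1..n}" and p: "p \<in> {1..n}" and z: "z \<in> KE"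
  shows "act \<rho> (conj p z) = conj (\<rho> p) z"
proof -
  have "act \<rho> (conj p z) = act (\<rho> \<circ> transpose p n) z"
    unfolding conj_def using act_comp[OF r transpose_permutes[OF p] fixed_closed[OF z]] by simp
  also have "\<dots> = conj ((\<rho> \<circ> transpose p n) n) z"
    using permutes_compose[OF transpose_permutes[OF p] r] z by (rule act_eq_conj)
  finally show ?thesis by simp
qed

text \<open>A permutation only reindexes the sum. Used for the coordinates \<open>crd\<close> and
  for the entries of the trace matrix.\<close>

lemma orbit_sum_fixed:
  assumes g: "\<And>p. p \<in> {1..n} \<Longrightarrow> g p \<in> carrier T"
    and act_g: "\<And>\<rho> p. \<rho> permutes {1..n} \<Longrightarrow> p \<in> {1..n} \<Longrightarrow> act \<rho> (g p) = g (\<rho> p)"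
  shows "(\<Oplus>p\<in>{1..n}. g p) \<in> KB"
proof -
  have "act \<rho> (\<Oplus>p\<in>{1..n}. g p) = (\<Oplus>p\<in>{1..n}. g p)" if r: "\<rho> permutes {1..n}" for \<rho>
  proof -
    have "act \<rho> (\<Oplus>p\<in>{1..n}. g p) = (\<Oplus>p\<in>{1..n}. act \<rho> (g p))" using r g by (rule act_finsum)
    also have "\<dots> = (\<Oplus>p\<in>{1..n}. g (\<rho> p))"
      using act_g[OF r] g permutes_in_image[OF r] by (intro finsum_cong') auto
    also have "\<dots> = (\<Oplus>p\<in>\<rho> ` {1..n}. g p)"
      using g permutes_in_image[OF r] permutes_inj_on[OF r] by (intro finsum_reindex[symmetric]) auto
    finally show ?thesis using permutes_image[OF r] by simp
  qed
  moreover have "(\<Oplus>p\<in>{1..n}. g p) \<in> carrier T" using g by (intro finsum_closed) auto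
  ultimately show ?thesis by (simp add: fixed_def)
qed

text \<open>Cramer's rule, up to the factor \<open>disc\<close>, for the unknown coordinates of
  \<open>z\<close>: the linear system consists of the \<open>n\<close> conjugates of the wanted
  expansion, with coefficient matrix \<open>y\<close> and right-hand sides
  \<open>conj p z\<close>.\<close>

definition crd where "crd i z = (\<Oplus>p\<in>{1..n}. adj p i \<otimes> conj p z)"

lemma crd_fixed:
  assumes i: "i \<in> {1..n}" and z: "z \<in> KE"
  shows "crd i z \<in> KB"
  unfolding crd_def
proof (rule orbit_sum_fixed)
  fix \<rho> p assume r: "\<rho> permutes {1..n}" and p: "p \<in> {1..n}"
  show "act \<rho> (adj p i \<otimes> conj p z) = adj (\<rho> p) i \<otimes> conj (\<rho> p) z"
    using r p i z adj_closed conj_closed[OF p fixed_closed[OF z]] by (simp add: act_mult act_adj act_conj)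
qed (use adj_closed conj_closed fixed_closed[OF z] in simp)

abbreviation E0 where "E0 \<equiv> T\<lparr>carrier := KE\<rparr>"
abbreviation B0 where "B0 \<equiv> T\<lparr>carrier := KB\<rparr>"

lemma E0_cring: "cring E0" and B0_cring: "cring B0"
  using fixed_subcring[OF sub_index] fixed_subcring[OF subset_refl] .

lemma KB_subset: "KB \<subseteq> KE"
  using permutes_subset[OF _ sub_index] by (auto simp: fixed_def)

lemma finsum_E0:
  assumes "finite I" "\<And>i. i \<in> I \<Longrightarrow> g i \<in> KE"
  shows "finsum E0 g I = finsum T g I"
  using ring_hom_cring.hom_finsum[OF ring_hom_cring_id_subring[OF cring_axioms E0_cring], of g I] assms
  by (auto simp: o_def Pi_iff fixed_def)

lemma y_KE: "i \<in> {1..n} \<Longrightarrow> y n i \<in> KE"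
  and adj_KE: "i \<in> {1..n} \<Longrightarrow> adj n i \<in> KE"
proof -
  assume i: "i \<in> {1..n}"
  have 1: "\<rho> permutes {1..n}" if "\<rho> permutes {1..n - 1}" for \<rho>
    using permutes_subset[OF that sub_index] .
  have 2: "\<rho> n = n" if "\<rho> permutes {1..n - 1}" for \<rho>
    using permutes_not_in[OF that, of n] n_pos by (auto simp: atLeastAtMost_iff)
  show "y n i \<in> KE" "adj n i \<in> KE"
    using i n_mem y_closed adj_closed by (auto simp: fixed_def act_y[OF 1] act_adj[OF 1] 2)
qed

lemma disc_KB: "disc \<in> KB"
  using disc_closed act_disc by (simp add: fixed_def)

lemma KE_mult: "s \<in> KE \<Longrightarrow> t \<in> KE \<Longrightarrow> s \<otimes> t \<in> KE"
  using E0_cring cring.cring_simprules(5)[of E0 s t] by simp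

section \<open>Expansion, torsion, duality and trace with denominators cleared\<close>

lemma delta_sum:
  assumes g: "\<And>p. p \<in> {1..n} \<Longrightarrow> g p \<in> carrier T" and q: "q \<in> {1..n}"
  shows "(\<Oplus>p\<in>{1..n}. g p \<otimes> (if p = q then disc else \<zero>)) = disc \<otimes> g q"
proof -
  have "(\<Oplus>p\<in>{1..n}. g p \<otimes> (if p = q then disc else \<zero>)) = (\<Oplus>p\<in>{1..n}. if p = q then disc \<otimes> g p else \<zero>)"
    using g disc_closed by (intro finsum_cong') (auto simp: m_comm)
  also have "\<dots> = disc \<otimes> g q" using g q disc_closed by (intro finsum_delta) auto
  finally show ?thesis .
qed

text \<open>After exchanging the sums, \<open>adj_row\<close> for row \<open>n\<close> retains only
  the conjugate \<open>conj n z\<close>, which is \<open>z\<close>.\<close>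

lemma crd_expand:
  assumes z: "z \<in> KE"
  shows "(\<Oplus>i\<in>{1..n}. crd i z \<otimes> y n i) = disc \<otimes> z"
proof -
  have zc: "z \<in> carrier T" using z by (rule fixed_closed)
  note cl = adj_closed conj_closed[OF _ zc] y_closed n_mem
  have "(\<Oplus>i\<in>{1..n}. crd i z \<otimes> y n i) = (\<Oplus>i\<in>{1..n}. \<Oplus>p\<in>{1..n}. conj p z \<otimes> (y n i \<otimes> adj p i))"
  proof (intro finsum_cong')
    fix i assume i: "i \<in> {1..n}"
    have "crd i z \<otimes> y n i = (\<Oplus>p\<in>{1..n}. adj p i \<otimes> conj p z \<otimes> y n i)"
      unfolding crd_def using i cl by (intro finsum_ldistr) auto
    also have "\<dots> = (\<Oplus>p\<in>{1..n}. conj p z \<otimes> (y n i \<otimes> adj p i))"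
      using i cl by (intro finsum_cong') (auto simp: m_ac)
    finally show "crd i z \<otimes> y n i = (\<Oplus>p\<in>{1..n}. conj p z \<otimes> (y n i \<otimes> adj p i))" .
  qed (use cl in \<open>auto intro!: finsum_closed\<close>)
  also have "\<dots> = (\<Oplus>p\<in>{1..n}. \<Oplus>i\<in>{1..n}. conj p z \<otimes> (y n i \<otimes> adj p i))"
    using cl by (intro finsum_swap) auto
  also have "\<dots> = (\<Oplus>p\<in>{1..n}. conj p z \<otimes> (\<Oplus>i\<in>{1..n}. y n i \<otimes> adj p i))"
    using cl by (intro finsum_cong' finsum_rdistr[symmetric]) (auto intro!: finsum_closed)
  also have "\<dots> = (\<Oplus>p\<in>{1..n}. conj p z \<otimes> (if p = n then disc else \<zero>))"
    using cl disc_closed adj_row[OF _ n_mem] by (intro finsum_cong') auto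
  also have "\<dots> = disc \<otimes> z" using cl conj_n[OF zc] by (subst delta_sum) auto
  finally show ?thesis .
qed

text \<open>Because the coefficients are invariant, the relation can be conjugated to one for every
  row \<open>p\<close> of \<open>y\<close>. Summing these against column \<open>i\<close> of
  \<open>adj\<close> isolates \<open>r i\<close> by \<open>adj_column\<close>.\<close>

lemma basis_torsion:
  assumes r: "\<And>j. j \<in> {1..n} \<Longrightarrow> r j \<in> KB" and 0: "(\<Oplus>j\<in>{1..n}. r j \<otimes> y n j) = \<zero>" and i: "i \<in> {1..n}"
  shows "disc \<otimes> r i = \<zero>"
proof -
  have rc: "r j \<in> carrier T" if "j \<in> {1..n}" for j using fixed_closed[OF r[OF that]] .
  have rfix: "act \<rho> (r j) = r j" if "\<rho> permutes {1..n}" "j \<in> {1..n}" for \<rho> j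
    using r[OF that(2)] that(1) by (simp add: fixed_def)
  note cl = adj_closed y_closed n_mem rc
  have row: "(\<Oplus>j\<in>{1..n}. r j \<otimes> y p j) = \<zero>" if p: "p \<in> {1..n}" for p
  proof -
    let ?t = "transpose p n"
    note t = transpose_permutes[OF p]
    have "act ?t (\<Oplus>j\<in>{1..n}. r j \<otimes> y n j) = (\<Oplus>j\<in>{1..n}. act ?t (r j \<otimes> y n j))"
      using t cl by (intro act_finsum) auto
    also have "\<dots> = (\<Oplus>j\<in>{1..n}. r j \<otimes> y p j)"
      using t cl p by (intro finsum_cong') (auto simp: act_mult rfix act_y)
    finally show ?thesis using 0 ring_hom_cring.hom_zero[OF act_hom_cring[OF t]] by simp
  qed
  have "disc \<otimes> r i = (\<Oplus>j\<in>{1..n}. r j \<otimes> (if j = i then disc else \<zero>))"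
    using cl i by (intro delta_sum[symmetric]) auto
  also have "\<dots> = (\<Oplus>j\<in>{1..n}. r j \<otimes> (\<Oplus>p\<in>{1..n}. y p j \<otimes> adj p i))"
    using cl i adj_column[OF i] by (intro finsum_cong') (auto intro!: finsum_closed)
  also have "\<dots> = (\<Oplus>j\<in>{1..n}. \<Oplus>p\<in>{1..n}. r j \<otimes> (y p j \<otimes> adj p i))"
    using cl by (intro finsum_cong' finsum_rdistr) (auto intro!: finsum_closed)
  also have "\<dots> = (\<Oplus>p\<in>{1..n}. \<Oplus>j\<in>{1..n}. r j \<otimes> (y p j \<otimes> adj p i))"
    using cl by (intro finsum_swap) auto
  also have "\<dots> = (\<Oplus>p\<in>{1..n}. (\<Oplus>j\<in>{1..n}. r j \<otimes> y p j) \<otimes> adj p i)"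
  proof (intro finsum_cong')
    fix p assume p: "p \<in> {1..n}"
    have "(\<Oplus>j\<in>{1..n}. r j \<otimes> (y p j \<otimes> adj p i)) = (\<Oplus>j\<in>{1..n}. r j \<otimes> y p j \<otimes> adj p i)"
      using p cl by (intro finsum_cong') (auto simp: m_assoc)
    also have "\<dots> = (\<Oplus>j\<in>{1..n}. r j \<otimes> y p j) \<otimes> adj p i"
      using p cl by (intro finsum_ldistr[symmetric]) auto
    finally show "(\<Oplus>j\<in>{1..n}. r j \<otimes> (y p j \<otimes> adj p i)) = (\<Oplus>j\<in>{1..n}. r j \<otimes> y p j) \<otimes> adj p i" .
  qed (use cl in \<open>auto intro!: finsum_closed\<close>)
  also have "\<dots> = \<zero>" using row cl by (intro add.finprod_one_eqI) auto
  finally show ?thesis .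
qed

text \<open>Once \<open>crd\<close> is expanded, the sum over \<open>j\<close> of
  \<open>y p j \<otimes> adj n j\<close> vanishes unless \<open>p = n\<close>, so only
  \<open>adj n i\<close> times \<open>z\<close> itself survives.\<close>

lemma crd_dual:
  assumes z: "z \<in> KE" and i: "i \<in> {1..n}"
  shows "(\<Oplus>j\<in>{1..n}. crd i (z \<otimes> y n j) \<otimes> adj n j) = disc \<otimes> (z \<otimes> adj n i)"
proof -
  have zc: "z \<in> carrier T" using z by (rule fixed_closed)
  note cl = adj_closed conj_closed[OF _ zc] y_closed n_mem
  have "(\<Oplus>j\<in>{1..n}. crd i (z \<otimes> y n j) \<otimes> adj n j)
      = (\<Oplus>j\<in>{1..n}. \<Oplus>p\<in>{1..n}. adj p i \<otimes> conj p z \<otimes> (y p j \<otimes> adj n j))"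
  proof (intro finsum_cong')
    fix j assume j: "j \<in> {1..n}"
    have "crd i (z \<otimes> y n j) = (\<Oplus>p\<in>{1..n}. adj p i \<otimes> (conj p z \<otimes> y p j))"
      unfolding crd_def using j cl zc by (intro finsum_cong') (auto simp: conj_mult conj_y)
    hence "crd i (z \<otimes> y n j) \<otimes> adj n j = (\<Oplus>p\<in>{1..n}. adj p i \<otimes> (conj p z \<otimes> y p j)) \<otimes> adj n j" by simp
    also have "\<dots> = (\<Oplus>p\<in>{1..n}. adj p i \<otimes> (conj p z \<otimes> y p j) \<otimes> adj n j)"
      using j cl by (intro finsum_ldistr) auto
    also have "\<dots> = (\<Oplus>p\<in>{1..n}. adj p i \<otimes> conj p z \<otimes> (y p j \<otimes> adj n j))"
      using j cl by (intro finsum_cong') (auto simp: m_assoc)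
    finally show "crd i (z \<otimes> y n j) \<otimes> adj n j = (\<Oplus>p\<in>{1..n}. adj p i \<otimes> conj p z \<otimes> (y p j \<otimes> adj n j))" .
  qed (use cl in \<open>auto intro!: finsum_closed\<close>)
  also have "\<dots> = (\<Oplus>p\<in>{1..n}. \<Oplus>j\<in>{1..n}. adj p i \<otimes> conj p z \<otimes> (y p j \<otimes> adj n j))"
    using cl by (intro finsum_swap) auto
  also have "\<dots> = (\<Oplus>p\<in>{1..n}. adj p i \<otimes> conj p z \<otimes> (\<Oplus>j\<in>{1..n}. y p j \<otimes> adj n j))"
    using cl by (intro finsum_cong' finsum_rdistr[symmetric]) (auto intro!: finsum_closed)
  also have "\<dots> = (\<Oplus>p\<in>{1..n}. adj p i \<otimes> conj p z \<otimes> (if p = n then disc else \<zero>))"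
    using cl disc_closed adj_row[OF n_mem] by (intro finsum_cong') auto
  also have "\<dots> = disc \<otimes> (adj n i \<otimes> conj n z)" using cl by (subst delta_sum) auto
  also have "\<dots> = disc \<otimes> (z \<otimes> adj n i)" using conj_n[OF zc] zc cl by (simp add: m_comm)
  finally show ?thesis .
qed

text \<open>For each \<open>p\<close> the sum over \<open>i\<close> of
  \<open>y p i \<otimes> adj p i\<close> is \<open>disc\<close>, so every conjugate of
  \<open>w\<close> is counted exactly once.\<close>

lemma crd_trace:
  assumes w: "w \<in> KE"
  shows "(\<Oplus>i\<in>{1..n}. crd i (y n i \<otimes> w)) = disc \<otimes> (\<Oplus>p\<in>{1..n}. conj p w)"
proof -
  have wc: "w \<in> carrier T" using w by (rule fixed_closed)
  note cl = adj_closed conj_closed[OF _ wc] y_closed n_mem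
  have "(\<Oplus>i\<in>{1..n}. crd i (y n i \<otimes> w)) = (\<Oplus>i\<in>{1..n}. \<Oplus>p\<in>{1..n}. conj p w \<otimes> (y p i \<otimes> adj p i))"
    unfolding crd_def using cl wc
    by (intro finsum_cong') (auto simp: conj_mult conj_y m_ac intro!: finsum_closed)
  also have "\<dots> = (\<Oplus>p\<in>{1..n}. \<Oplus>i\<in>{1..n}. conj p w \<otimes> (y p i \<otimes> adj p i))"
    using cl by (intro finsum_swap) auto
  also have "\<dots> = (\<Oplus>p\<in>{1..n}. conj p w \<otimes> (\<Oplus>i\<in>{1..n}. y p i \<otimes> adj p i))"
    using cl by (intro finsum_cong' finsum_rdistr[symmetric]) (auto intro!: finsum_closed)
  also have "\<dots> = (\<Oplus>p\<in>{1..n}. disc \<otimes> conj p w)"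
    using cl disc_closed adj_row by (intro finsum_cong') (auto simp: m_comm)
  also have "\<dots> = disc \<otimes> (\<Oplus>p\<in>{1..n}. conj p w)"
    using cl disc_closed by (intro finsum_rdistr[symmetric]) auto
  finally show ?thesis .
qed

sublocale lf: localized_free E0 KB disc n "y n" crd "adj n"
proof -
  \<comment> \<open>\<open>E0\<close> is already \<open>T\<close> with its carrier overwritten, and
    overwriting it again gives \<open>B0\<close>; so \<open>localized_subring\<close> applies with
    ambient ring \<open>E0\<close>.\<close>
  have B0: "E0\<lparr>carrier := KB\<rparr> = B0" by simp
  interpret E0: cring E0 by (rule E0_cring)
  interpret B0: cring B0 by (rule B0_cring)
  have le: "localization_at E0 disc"
    using disc_KB KB_subset by unfold_locales auto
  have lb: "localization_at (E0\<lparr>carrier := KB\<rparr>) disc"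
    unfolding B0 using disc_KB by unfold_locales auto
  have crdE: "crd i z \<in> KE" if "i \<in> {1..n}" "z \<in> KE" for i z using crd_fixed[OF that] KB_subset by blast
  show "localized_free E0 KB disc n (y n) crd (adj n)"
  proof (intro localized_free.intro localized_subring.intro le lb localized_subring_axioms.intro localized_free_axioms.intro)
    show "KB \<subseteq> carrier E0" using KB_subset by simp
    show "finsum E0 (\<lambda>i. crd i z \<otimes>\<^bsub>E0\<^esub> y n i) {1..n} = disc \<otimes>\<^bsub>E0\<^esub> z" if "z \<in> carrier E0" for z
      using that crdE y_KE KE_mult crd_expand[of z] by (subst finsum_E0) auto
    show "disc \<otimes>\<^bsub>E0\<^esub> r i = \<zero>\<^bsub>E0\<^esub>"
      if r: "\<And>j. j \<in> {1..n} \<Longrightarrow> r j \<in> KB" and 0: "finsum E0 (\<lambda>j. r j \<otimes>\<^bsub>E0\<^esub> y n j) {1..n} = \<zero>\<^bsub>E0\<^esub>"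
        and i: "i \<in> {1..n}" for r i
    proof -
      have "r j \<otimes> y n j \<in> KE" if "j \<in> {1..n}" for j using r[OF that] KB_subset y_KE[OF that] KE_mult by blast
      hence "(\<Oplus>j\<in>{1..n}. r j \<otimes> y n j) = \<zero>" using finsum_E0[of "{1..n}" "\<lambda>j. r j \<otimes> y n j"] 0 by simp
      thus ?thesis using basis_torsion[OF r _ i] by simp
    qed
    show "finsum E0 (\<lambda>i. y n i \<otimes>\<^bsub>E0\<^esub> adj n i) {1..n} = disc"
      using y_KE adj_KE KE_mult adj_row[OF n_mem n_mem] by (subst finsum_E0) auto
    show "finsum E0 (\<lambda>j. crd i (z \<otimes>\<^bsub>E0\<^esub> y n j) \<otimes>\<^bsub>E0\<^esub> adj n j) {1..n} = disc \<otimes>\<^bsub>E0\<^esub> (z \<otimes>\<^bsub>E0\<^esub> adj n i)"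
      if "z \<in> carrier E0" "i \<in> {1..n}" for z i
      using that crdE y_KE adj_KE KE_mult crd_dual[of z i] by (subst finsum_E0) auto
  qed (use y_KE adj_KE crd_fixed in auto)
qed

lemma discriminant_eq:
  "discriminant (localization B0 disc) (localization E0 disc) (loc_inclusion E0 disc) n (\<lambda>i. to_loc E0 disc (y n i))
    = to_loc B0 disc disc"
proof -
  let ?B = "localization B0 disc" and ?E = "localization E0 disc" and ?h = "loc_inclusion E0 disc"
  let ?e = "\<lambda>i. to_loc E0 disc (y n i)"
  let ?G = "\<lambda>i j. \<Oplus>p\<in>{1..n}. y p i \<otimes> y p j"
  have GK: "?G i j \<in> KB" if "i \<in> {1..n}" "j \<in> {1..n}" for i j
    using that y_closed by (intro orbit_sum_fixed) (auto simp: act_mult act_y)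
  have tr: "linear_trace ?B ?E ?h n ?e (\<lambda>z. z \<otimes>\<^bsub>?E\<^esub> (?e i \<otimes>\<^bsub>?E\<^esub> ?e j)) = to_loc B0 disc (?G i j)"
    if i: "i \<in> {1..n}" and j: "j \<in> {1..n}" for i j
  proof -
    let ?w = "y n i \<otimes> y n j"
    have w: "?w \<in> KE" using i j by (intro KE_mult y_KE)
    have "(\<Oplus>p\<in>{1..n}. conj p ?w) = ?G i j"
      using i j y_closed n_mem by (intro finsum_cong') (auto simp: conj_mult conj_y)
    hence "(\<Oplus>k\<in>{1..n}. crd k (y n k \<otimes> ?w)) = disc \<otimes> ?G i j" using crd_trace[OF w] by simp
    moreover have "crd k (y n k \<otimes> ?w) \<in> KE" if "k \<in> {1..n}" for k
      using crd_fixed[OF that, of "y n k \<otimes> ?w"] KE_mult[OF y_KE[OF that] w] KB_subset by blast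
    ultimately have "finsum E0 (\<lambda>k. crd k (y n k \<otimes>\<^bsub>E0\<^esub> ?w)) {1..n} = disc \<otimes>\<^bsub>E0\<^esub> ?G i j"
      by (subst finsum_E0) auto
    moreover have "?e i \<otimes>\<^bsub>?E\<^esub> ?e j = to_loc E0 disc ?w"
      using ring_hom_mult[OF ring_hom_cring.homh[OF lf.E.to_loc_hom], of "y n i" "y n j"] y_KE i j by simp
    ultimately show ?thesis using lf.linear_trace_mult[of ?w "?G i j"] w GK[OF i j] by simp
  qed
  have hB: "ring_hom_cring B0 ?B (to_loc B0 disc)" using lf.B.to_loc_hom by simp
  have "discriminant ?B ?E ?h n ?e = ring_det ?B n (\<lambda>i j. to_loc B0 disc (?G i j))"
    unfolding discriminant_def
    using tr GK ring_hom_closed[OF ring_hom_cring.homh[OF hB]]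
    by (intro cring.ring_det_cong ring_hom_cring.axioms(2)[OF hB]) auto
  also have "\<dots> = to_loc B0 disc (ring_det B0 n ?G)"
    using GK by (intro ring_hom_cring.hom_ring_det[OF hB, symmetric]) auto
  \<comment> \<open>The Gram entries are invariant but the entries of \<open>y\<close> are in
    general not, so the factorization into two determinants takes place in \<open>T\<close>.\<close>
  also have "ring_det B0 n ?G = ring_det T n ?G"
    using GK ring_hom_cring.hom_ring_det[OF ring_hom_cring_id_subring[OF cring_axioms B0_cring], of n ?G]
    by (auto simp: fixed_def)
  also have "\<dots> = disc" unfolding disc_def using y_closed by (intro ring_det_gram)
  finally show ?thesis .
qed

lemma basis_discriminant_etale:
  "is_module_basis (localization B0 disc) (localization E0 disc) (loc_inclusion E0 disc) n (\<lambda>i. to_loc E0 disc (y n i))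
   \<and> discriminant (localization B0 disc) (localization E0 disc) (loc_inclusion E0 disc) n (\<lambda>i. to_loc E0 disc (y n i))
      = to_loc B0 disc disc
   \<and> etale TYPE('c) (localization B0 disc) (localization E0 disc) (loc_inclusion E0 disc)"
  using lf.eL_basis discriminant_eq lf.separable.etale by simp

end


section \<open>The symmetric group action on the tensor power\<close>

text \<open>The bijection \<open>map_prod \<theta> \<theta>\<close> matches the factorizations of
  \<open>g\<close> with those of \<open>\<theta> g\<close>, so the convolution sums agree. Since
  \<open>mult\<close> speaks only of the carrier, \<open>nz\<close> is used to place all pairs with
  nonzero coefficients there.\<close>

lemma (in monoid_algebra_over) precomp_automorphism_hom:
  assumes bij: "bij \<theta>" and carr: "\<And>u. \<theta> u \<in> carrier G \<longleftrightarrow> u \<in> carrier G"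
    and one: "\<theta> \<one>\<^bsub>G\<^esub> = \<one>\<^bsub>G\<^esub>"
    and mult: "\<And>u v. u \<in> carrier G \<Longrightarrow> v \<in> carrier G \<Longrightarrow> \<theta> (u \<otimes>\<^bsub>G\<^esub> v) = \<theta> u \<otimes>\<^bsub>G\<^esub> \<theta> v"
  shows "(\<lambda>f u. f (\<theta> u)) \<in> ring_hom F F"
proof (rule ring_hom_memI)
  have inj: "\<theta> u = \<theta> v \<longleftrightarrow> u = v" for u v using bij by (auto simp: bij_def inj_def)
  show "(\<lambda>u. \<one>\<^bsub>F\<^esub> (\<theta> u)) = \<one>\<^bsub>F\<^esub>"
    unfolding F_one monoid_algebra_single_def using inj one by metis
  fix f assume f: "f \<in> carrier F"
  show "(\<lambda>u. f (\<theta> u)) \<in> carrier F"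
    unfolding mem_carrier_iff
  proof (intro conjI allI)
    have s: "supp (\<lambda>u. f (\<theta> u)) = \<theta> -` supp f" by (auto simp: supp_def)
    show "supp (\<lambda>u. f (\<theta> u)) \<subseteq> carrier G" using carrierD(2)[OF f] carr unfolding s by auto
    show "finite (supp (\<lambda>u. f (\<theta> u)))"
      unfolding s using bij f by (intro finite_vimageI) (auto simp: bij_def)
  qed (use f in simp)
  fix f' assume f': "f' \<in> carrier F"
  show "(\<lambda>u. (f \<oplus>\<^bsub>F\<^esub> f') (\<theta> u)) = (\<lambda>u. f (\<theta> u)) \<oplus>\<^bsub>F\<^esub> (\<lambda>u. f' (\<theta> u))" by (simp add: F_add)
  show "(\<lambda>u. (f \<otimes>\<^bsub>F\<^esub> f') (\<theta> u)) = (\<lambda>u. f (\<theta> u)) \<otimes>\<^bsub>F\<^esub> (\<lambda>u. f' (\<theta> u))"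
  proof
    fix g
    let ?D = "{(u, v). f u \<noteq> \<zero> \<and> f' v \<noteq> \<zero> \<and> u \<otimes>\<^bsub>G\<^esub> v = \<theta> g}"
    let ?D' = "{(u, v). f (\<theta> u) \<noteq> \<zero> \<and> f' (\<theta> v) \<noteq> \<zero> \<and> u \<otimes>\<^bsub>G\<^esub> v = g}"
    have nz: "u \<in> carrier G" if "f u \<noteq> \<zero> \<or> f' u \<noteq> \<zero>" for u
      using that carrierD(2)[OF f] carrierD(2)[OF f'] by (auto simp: supp_def)
    have "?D = map_prod \<theta> \<theta> ` ?D'"
    proof (intro subset_antisym subrelI)
      fix a b assume "(a, b) \<in> ?D"
      hence ab: "f a \<noteq> \<zero>" "f' b \<noteq> \<zero>" "a \<otimes>\<^bsub>G\<^esub> b = \<theta> g" by auto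
      obtain u v where uv: "a = \<theta> u" "b = \<theta> v" using bij by (metis bij_pointE)
      have "u \<in> carrier G" "v \<in> carrier G" using nz ab carr uv by blast+
      hence "\<theta> (u \<otimes>\<^bsub>G\<^esub> v) = \<theta> g" using mult ab uv by simp
      hence "u \<otimes>\<^bsub>G\<^esub> v = g" using inj by simp
      hence "(u, v) \<in> ?D'" using ab uv by simp
      thus "(a, b) \<in> map_prod \<theta> \<theta> ` ?D'" using uv by (intro image_eqI[of _ _ "(u, v)"]) auto
    next
      fix a b assume "(a, b) \<in> map_prod \<theta> \<theta> ` ?D'"
      then obtain u v where uv: "a = \<theta> u" "b = \<theta> v" "f (\<theta> u) \<noteq> \<zero>" "f' (\<theta> v) \<noteq> \<zero>" "u \<otimes>\<^bsub>G\<^esub> v = g" by auto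
      have "u \<in> carrier G" "v \<in> carrier G" using nz carr uv by blast+
      thus "(a, b) \<in> ?D" using uv mult[of u v] by auto
    qed
    moreover have "inj_on (map_prod \<theta> \<theta>) ?D'" using inj by (auto simp: inj_on_def)
    ultimately have "(\<Oplus>p\<in>?D. f (fst p) \<otimes> f' (snd p)) = (\<Oplus>p\<in>?D'. f (\<theta> (fst p)) \<otimes> f' (\<theta> (snd p)))"
      using f f' A.finsum_reindex[of "\<lambda>p. f (fst p) \<otimes> f' (snd p)" "map_prod \<theta> \<theta>" ?D'] by simp
    thus "(f \<otimes>\<^bsub>F\<^esub> f') (\<theta> g) = ((\<lambda>u. f (\<theta> u)) \<otimes>\<^bsub>F\<^esub> (\<lambda>u. f' (\<theta> u))) g"
      unfolding F_mult_apply by simp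
  qed
qed

section \<open>Permutations acting on the quotient by the multilinear relations\<close>

locale tensor_algebra = algebra A R
  for A :: "('a, 'k) ring_scheme" and R :: "('a, 'r, 'l) module_scheme" and n :: nat
begin

abbreviation G where "G \<equiv> tuple_monoid R n"
abbreviation T where "T \<equiv> tensor_power A R n"
abbreviation I where "I \<equiv> tensor_ideal A R n"

lemma cring_A: "cring A" and cring_R: "cring R"
  by unfold_locales

lemma G_carrier: "carrier G = {1..n} \<rightarrow>\<^sub>E carrier R"
  and G_mult: "u \<otimes>\<^bsub>G\<^esub> v = (\<lambda>i\<in>{1..n}. u i \<otimes>\<^bsub>R\<^esub> v i)"
  and G_one: "\<one>\<^bsub>G\<^esub> = (\<lambda>i\<in>{1..n}. \<one>\<^bsub>R\<^esub>)"
  by (simp_all add: tuple_monoid_def)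

lemma comm_monoid_G: "comm_monoid G"
  by (rule comm_monoidI)
    (auto simp: G_carrier G_mult G_one PiE_iff m_ac extensional_def fun_eq_iff)

sublocale F: monoid_algebra_over A G
  by (intro monoid_algebra_over.intro cring_A comm_monoid_G)

abbreviation F where "F \<equiv> monoid_algebra A G"
abbreviation single where "single \<equiv> monoid_algebra_single A"

definition perm where "perm \<rho> f = (\<lambda>x. f (x \<circ> \<rho>))"

lemma permute_factors_eq: "permute_factors \<rho> t = perm \<rho> ` t"
  by (simp add: permute_factors_def perm_def)

lemma comp_mem_iff:
  assumes r: "\<rho> permutes {1..n}"
  shows "x \<circ> \<rho> \<in> {1..n} \<rightarrow>\<^sub>E S \<longleftrightarrow> x \<in> {1..n} \<rightarrow>\<^sub>E S"
proof -
  have 1: "x \<circ> \<rho> \<in> {1..n} \<rightarrow>\<^sub>E S" if "x \<in> {1..n} \<rightarrow>\<^sub>E S" "\<rho> permutes {1..n}" for x \<rho>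
    using that permutes_in_image[OF that(2)] permutes_not_in[OF that(2)] by (auto simp: PiE_iff extensional_def)
  have "(x \<circ> \<rho>) \<circ> inv_into UNIV \<rho> = x" using permutes_inv_o[OF r] by (simp add: comp_assoc)
  thus ?thesis using 1[of x \<rho>] 1[of "x \<circ> \<rho>" "inv_into UNIV \<rho>"] r permutes_inv[OF r] by auto
qed

lemma perm_hom:
  assumes r: "\<rho> permutes {1..n}"
  shows "perm \<rho> \<in> ring_hom F F"
proof -
  have inv: "\<rho> \<circ> inv_into UNIV \<rho> = id" "inv_into UNIV \<rho> \<circ> \<rho> = id" using permutes_inv_o[OF r] by auto
  have "bij (\<lambda>x::nat \<Rightarrow> 'r. x \<circ> \<rho>)"
    by (rule o_bij[where g = "\<lambda>x. x \<circ> inv_into UNIV \<rho>"]) (auto simp: fun_eq_iff permutes_inverses[OF r])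
  moreover have "(u \<otimes>\<^bsub>G\<^esub> v) \<circ> \<rho> = (u \<circ> \<rho>) \<otimes>\<^bsub>G\<^esub> (v \<circ> \<rho>)" for u v
    using permutes_in_image[OF r] by (auto simp: G_mult fun_eq_iff)
  moreover have "\<one>\<^bsub>G\<^esub> \<circ> \<rho> = \<one>\<^bsub>G\<^esub>"
    using permutes_in_image[OF r] by (auto simp: G_one fun_eq_iff)
  ultimately have "(\<lambda>f u. f (u \<circ> \<rho>)) \<in> ring_hom F F"
    by (intro F.precomp_automorphism_hom) (simp_all add: G_carrier comp_mem_iff[OF r])
  thus ?thesis by (simp add: perm_def[abs_def])
qed

lemma perm_single:
  assumes r: "\<rho> permutes {1..n}"
  shows "perm \<rho> (single g a) = single (g \<circ> inv_into UNIV \<rho>) a"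
proof -
  have "u \<circ> \<rho> = g \<longleftrightarrow> u = g \<circ> inv_into UNIV \<rho>" for u
    using permutes_inv_o[OF r] by (auto simp: comp_assoc)
  thus ?thesis by (simp add: perm_def monoid_algebra_single_def)
qed

lemma single_mem: "x \<in> {1..n} \<rightarrow>\<^sub>E carrier R \<Longrightarrow> a \<in> carrier A \<Longrightarrow> single x a \<in> carrier F"
  by (intro F.single_closed) (simp add: G_carrier)

lemma upd_mem: "x \<in> {1..n} \<rightarrow>\<^sub>E carrier R \<Longrightarrow> i \<in> {1..n} \<Longrightarrow> y \<in> carrier R \<Longrightarrow> x(i := y) \<in> {1..n} \<rightarrow>\<^sub>E carrier R"
  by (auto simp: PiE_iff extensional_def)

lemma relation_addI:
  assumes "x \<in> {1..n} \<rightarrow>\<^sub>E carrier R" "i \<in> {1..n}" "y \<in> carrier R" "z \<in> carrier R"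
  shows "single (x(i := y \<oplus>\<^bsub>R\<^esub> z)) \<one>\<^bsub>A\<^esub> \<ominus>\<^bsub>F\<^esub> (single (x(i := y)) \<one>\<^bsub>A\<^esub> \<oplus>\<^bsub>F\<^esub> single (x(i := z)) \<one>\<^bsub>A\<^esub>)
    \<in> multilinear_relations A R n"
  unfolding multilinear_relations_def Let_def
  by (rule UnI1, rule CollectI, (rule exI)+, rule conjI[OF refl]) (intro conjI assms)

lemma relation_smultI:
  assumes "x \<in> {1..n} \<rightarrow>\<^sub>E carrier R" "i \<in> {1..n}" "a \<in> carrier A" "y \<in> carrier R"
  shows "single (x(i := a \<odot>\<^bsub>R\<^esub> y)) \<one>\<^bsub>A\<^esub> \<ominus>\<^bsub>F\<^esub> single (x(i := y)) a \<in> multilinear_relations A R n"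
  unfolding multilinear_relations_def Let_def
  by (rule UnI2, rule CollectI, (rule exI)+, rule conjI[OF refl]) (intro conjI assms)

lemma relations_closed: "multilinear_relations A R n \<subseteq> carrier F"
  unfolding multilinear_relations_def Let_def
  by (auto intro!: F.F.minus_closed F.F.a_closed single_mem upd_mem)

text \<open>A relation in slot \<open>i\<close> goes to a relation of the same kind in slot
  \<open>\<rho> i\<close>, with the other entries of the tuple rearranged; \<open>upd\<close> is the
  underlying identity of tuples.\<close>

lemma perm_relations:
  assumes r: "\<rho> permutes {1..n}" and f: "f \<in> multilinear_relations A R n"
  shows "perm \<rho> f \<in> multilinear_relations A R n"
proof -
  interpret P: ring_hom_cring F F "perm \<rho>" by unfold_locales (rule perm_hom[OF r])
  let ?t = "inv_into UNIV \<rho>"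
  have upd: "(x(i := y)) \<circ> ?t = (x \<circ> ?t)(\<rho> i := y)" for x :: "nat \<Rightarrow> 'r" and i y
    using permutes_inv_eq[OF r] by (auto simp: fun_eq_iff)
  have tx: "x \<circ> ?t \<in> {1..n} \<rightarrow>\<^sub>E carrier R" if "x \<in> {1..n} \<rightarrow>\<^sub>E carrier R" for x
    using that by (rule comp_mem_iff[OF permutes_inv[OF r], THEN iffD2])
  have ri: "\<rho> i \<in> {1..n}" if "i \<in> {1..n}" for i using that permutes_in_image[OF r] by simp
  note c = single_mem upd_mem
  from f consider
    x i y z where "f = single (x(i := y \<oplus>\<^bsub>R\<^esub> z)) \<one>\<^bsub>A\<^esub> \<ominus>\<^bsub>F\<^esub> (single (x(i := y)) \<one>\<^bsub>A\<^esub> \<oplus>\<^bsub>F\<^esub> single (x(i := z)) \<one>\<^bsub>A\<^esub>)"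
      "x \<in> {1..n} \<rightarrow>\<^sub>E carrier R" "i \<in> {1..n}" "y \<in> carrier R" "z \<in> carrier R"
  | x i a y where "f = single (x(i := a \<odot>\<^bsub>R\<^esub> y)) \<one>\<^bsub>A\<^esub> \<ominus>\<^bsub>F\<^esub> single (x(i := y)) a"
      "x \<in> {1..n} \<rightarrow>\<^sub>E carrier R" "i \<in> {1..n}" "a \<in> carrier A" "y \<in> carrier R"
    unfolding multilinear_relations_def Let_def by blast
  thus ?thesis
  proof cases
    case (1 x i y z)
    have "perm \<rho> f = single ((x \<circ> ?t)(\<rho> i := y \<oplus>\<^bsub>R\<^esub> z)) \<one>\<^bsub>A\<^esub> \<ominus>\<^bsub>F\<^esub>
        (single ((x \<circ> ?t)(\<rho> i := y)) \<one>\<^bsub>A\<^esub> \<oplus>\<^bsub>F\<^esub> single ((x \<circ> ?t)(\<rho> i := z)) \<one>\<^bsub>A\<^esub>)"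
      using 1 c by (simp add: F.F.minus_eq perm_single[OF r] upd)
    thus ?thesis using relation_addI[OF tx[OF 1(2)] ri[OF 1(3)] 1(4,5)] by (simp only:)
  next
    case (2 x i a y)
    have "perm \<rho> f = single ((x \<circ> ?t)(\<rho> i := a \<odot>\<^bsub>R\<^esub> y)) \<one>\<^bsub>A\<^esub> \<ominus>\<^bsub>F\<^esub> single ((x \<circ> ?t)(\<rho> i := y)) a"
      using 2 c by (simp add: F.F.minus_eq perm_single[OF r] upd)
    thus ?thesis using relation_smultI[OF tx[OF 2(2)] ri[OF 2(3)] 2(4,5)] by (simp only:)
  qed
qed

lemma ideal_I: "ideal I F"
  unfolding tensor_ideal_def by (rule F.F.genideal_ideal[OF relations_closed])

sublocale I: ideal I F
  by (rule ideal_I)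

text \<open>The preimage of the tensor ideal under the ring homomorphism \<open>perm \<rho>\<close>
  is an ideal, and it contains the generators.\<close>

lemma perm_I:
  assumes r: "\<rho> permutes {1..n}" and f: "f \<in> I"
  shows "perm \<rho> f \<in> I"
proof -
  have hom: "ring_hom_ring F F (perm \<rho>)"
    by (rule ring_hom_ringI2[OF F.F.ring_axioms F.F.ring_axioms perm_hom[OF r]])
  have "multilinear_relations A R n \<subseteq> I"
    unfolding tensor_ideal_def by (rule F.F.genideal_self[OF relations_closed])
  hence "multilinear_relations A R n \<subseteq> {f \<in> carrier F. perm \<rho> f \<in> I}"
    using perm_relations[OF r] relations_closed by blast
  hence "I \<subseteq> {f \<in> carrier F. perm \<rho> f \<in> I}"
    unfolding tensor_ideal_def[of A R n]
    using ring_hom_ring.ideal_vimage[OF hom ideal_I, unfolded tensor_ideal_def]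
    by (intro F.F.genideal_minimal)
  thus ?thesis using f by blast
qed

lemma perm_comp: "perm \<rho> (perm \<tau> f) = perm (\<rho> \<circ> \<tau>) f"
  by (simp add: perm_def comp_assoc)

text \<open>\<open>permute_factors\<close> takes images of cosets as sets, so for its values to be
  cosets again the image of the ideal has to be the whole ideal. The inverse permutation supplies
  the preimages.\<close>

lemma perm_I_image:
  assumes r: "\<rho> permutes {1..n}"
  shows "perm \<rho> ` I = I"
proof (intro subset_antisym subsetI)
  fix f assume "f \<in> I"
  hence "perm (inv_into UNIV \<rho>) f \<in> I" using perm_I permutes_inv[OF r] by blast
  moreover have "perm \<rho> (perm (inv_into UNIV \<rho>) f) = f"
    unfolding perm_comp permutes_inv_o(1)[OF r] by (simp add: perm_def)
  ultimately show "f \<in> perm \<rho> ` I" by (metis imageI)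
qed (use perm_I[OF r] in blast)

abbreviation coset where "coset f \<equiv> I +>\<^bsub>F\<^esub> f"

lemma permute_coset:
  assumes r: "\<rho> permutes {1..n}" and f: "f \<in> carrier F"
  shows "permute_factors \<rho> (coset f) = coset (perm \<rho> f)"
proof -
  have "perm \<rho> ` coset f = (\<lambda>i. perm \<rho> (i \<oplus>\<^bsub>F\<^esub> f)) ` I"
    unfolding a_r_coset_def' by auto
  also have "\<dots> = (\<lambda>i. perm \<rho> i \<oplus>\<^bsub>F\<^esub> perm \<rho> f) ` I"
    using ring_hom_add[OF perm_hom[OF r] I.Icarr f] by (intro image_cong) auto
  also have "\<dots> = (\<lambda>i. i \<oplus>\<^bsub>F\<^esub> perm \<rho> f) ` (perm \<rho> ` I)" by (simp add: image_image)
  also have "\<dots> = coset (perm \<rho> f)" unfolding perm_I_image[OF r] a_r_coset_def' by auto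
  finally show ?thesis by (simp add: permute_factors_eq)
qed

lemma coset_hom: "ring_hom_cring F T coset"
  unfolding tensor_power_def by (rule I.rcos_ring_hom_cring[OF F.cring_monoid_algebra])

sublocale q: ring_hom_cring F T coset
  by (rule coset_hom)

lemma T_carrierE:
  assumes "t \<in> carrier T"
  obtains f where "f \<in> carrier F" "t = coset f"
  using assms unfolding tensor_power_def FactRing_def A_RCOSETS_def' by auto

lemma permute_factors_hom:
  assumes r: "\<rho> permutes {1..n}"
  shows "permute_factors \<rho> \<in> ring_hom T T"
proof (rule ring_hom_memI)
  note hom = perm_hom[OF r]
  fix s assume "s \<in> carrier T"
  then obtain f where f: "f \<in> carrier F" "s = coset f" by (rule T_carrierE)
  note pf = ring_hom_closed[OF hom f(1)]
  show "permute_factors \<rho> s \<in> carrier T" using pf by (simp add: f permute_coset[OF r])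
  fix t assume "t \<in> carrier T"
  then obtain g where g: "g \<in> carrier F" "t = coset g" by (rule T_carrierE)
  note pg = ring_hom_closed[OF hom g(1)]
  have "s \<otimes>\<^bsub>T\<^esub> t = coset (f \<otimes>\<^bsub>F\<^esub> g)" using f g by simp
  thus "permute_factors \<rho> (s \<otimes>\<^bsub>T\<^esub> t) = permute_factors \<rho> s \<otimes>\<^bsub>T\<^esub> permute_factors \<rho> t"
    using f g pf pg by (simp add: permute_coset[OF r] ring_hom_mult[OF hom] del: q.hom_mult) simp
  have "s \<oplus>\<^bsub>T\<^esub> t = coset (f \<oplus>\<^bsub>F\<^esub> g)" using f g by simp
  thus "permute_factors \<rho> (s \<oplus>\<^bsub>T\<^esub> t) = permute_factors \<rho> s \<oplus>\<^bsub>T\<^esub> permute_factors \<rho> t"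
    using f g pf pg by (simp add: permute_coset[OF r] ring_hom_add[OF hom] del: q.hom_add) simp
next
  have "permute_factors \<rho> (coset \<one>\<^bsub>F\<^esub>) = coset \<one>\<^bsub>F\<^esub>"
    using permute_coset[OF r F.F.one_closed] ring_hom_one[OF perm_hom[OF r]] by simp
  thus "permute_factors \<rho> \<one>\<^bsub>T\<^esub> = \<one>\<^bsub>T\<^esub>" by simp
qed

lemma permute_factors_comp: "permute_factors (\<rho> \<circ> \<tau>) t = permute_factors \<rho> (permute_factors \<tau> t)"
  by (simp add: permute_factors_eq image_image perm_comp)

lemma permute_factors_id: "permute_factors id t = t"
  by (simp add: permute_factors_def)

section \<open>Pure tensors, co-projections and the alternating tensor as a determinant\<close>

abbreviation pure where "pure \<equiv> pure_tensor A R n"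
abbreviation \<phi> where "\<phi> \<equiv> coprojection A R n"

lemma restrict_mem: "(\<And>i. i \<in> {1..n} \<Longrightarrow> x i \<in> carrier R) \<Longrightarrow> restrict x {1..n} \<in> {1..n} \<rightarrow>\<^sub>E carrier R"
  by auto

lemma one_A: "\<one>\<^bsub>A\<^esub> \<in> carrier A" and one_R: "\<one>\<^bsub>R\<^esub> \<in> carrier R"
  using cring.cring_simprules(6)[OF cring_A] cring.cring_simprules(6)[OF cring_R] .

lemma pure_closed:
  assumes "\<And>i. i \<in> {1..n} \<Longrightarrow> x i \<in> carrier R"
  shows "pure x \<in> carrier T"
  unfolding pure_tensor_def using single_mem[OF restrict_mem[OF assms] one_A] by (rule q.hom_closed)

lemma pure_mult:
  assumes x: "\<And>i. i \<in> {1..n} \<Longrightarrow> x i \<in> carrier R" and y: "\<And>i. i \<in> {1..n} \<Longrightarrow> y i \<in> carrier R"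
  shows "pure x \<otimes>\<^bsub>T\<^esub> pure y = pure (\<lambda>i. x i \<otimes>\<^bsub>R\<^esub> y i)"
proof -
  have x': "restrict x {1..n} \<in> {1..n} \<rightarrow>\<^sub>E carrier R" and y': "restrict y {1..n} \<in> {1..n} \<rightarrow>\<^sub>E carrier R"
    using x y by (intro restrict_mem; blast)+
  have "restrict x {1..n} \<otimes>\<^bsub>G\<^esub> restrict y {1..n} = restrict (\<lambda>i. x i \<otimes>\<^bsub>R\<^esub> y i) {1..n}"
    by (auto simp: G_mult)
  hence "single (restrict x {1..n}) \<one>\<^bsub>A\<^esub> \<otimes>\<^bsub>F\<^esub> single (restrict y {1..n}) \<one>\<^bsub>A\<^esub>
      = single (restrict (\<lambda>i. x i \<otimes>\<^bsub>R\<^esub> y i) {1..n}) \<one>\<^bsub>A\<^esub>"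
    using F.single_mult[of "restrict x {1..n}" "restrict y {1..n}" "\<one>\<^bsub>A\<^esub>" "\<one>\<^bsub>A\<^esub>"] x' y'
    by (simp only: G_carrier one_A R.l_one)
  thus ?thesis
    unfolding pure_tensor_def q.hom_mult[OF single_mem[OF x' one_A] single_mem[OF y' one_A], symmetric]
    by (rule arg_cong)
qed

lemma pure_cong: "(\<And>i. i \<in> {1..n} \<Longrightarrow> x i = y i) \<Longrightarrow> pure x = pure y"
  unfolding pure_tensor_def by (metis restrict_ext)

lemma pure_one: "pure (\<lambda>i. \<one>\<^bsub>R\<^esub>) = \<one>\<^bsub>T\<^esub>"
  unfolding pure_tensor_def using q.hom_one by (simp add: F.F_one G_one)

lemma coprojection_closed: "r \<in> carrier R \<Longrightarrow> \<phi> p r \<in> carrier T"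
  unfolding coprojection_def using one_R by (intro pure_closed) simp

text \<open>Induction on the set \<open>P\<close> of slots already filled, with 1 in the remaining
  slots. Writing pure tensors as products is what turns the alternating tensor into a
  determinant.\<close>

lemma pure_eq_finprod:
  assumes x: "\<And>i. i \<in> {1..n} \<Longrightarrow> x i \<in> carrier R"
  shows "(\<Otimes>\<^bsub>T\<^esub>i\<in>{1..n}. \<phi> i (x i)) = pure x"
proof -
  have "(\<Otimes>\<^bsub>T\<^esub>i\<in>P. \<phi> i (x i)) = pure (\<lambda>i. if i \<in> P then x i else \<one>\<^bsub>R\<^esub>)" if "finite P" "P \<subseteq> {1..n}" for P
    using that
  proof (induction P rule: finite_induct)
    case empty
    show ?case using pure_one by simp
  next
    case (insert j P)
    have "(\<Otimes>\<^bsub>T\<^esub>i\<in>insert j P. \<phi> i (x i)) = \<phi> j (x j) \<otimes>\<^bsub>T\<^esub> (\<Otimes>\<^bsub>T\<^esub>i\<in>P. \<phi> i (x i))"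
      using insert x coprojection_closed by (intro q.S.finprod_insert) auto
    also have "\<dots> = pure (\<lambda>i. if i = j then x j else \<one>\<^bsub>R\<^esub>) \<otimes>\<^bsub>T\<^esub> pure (\<lambda>i. if i \<in> P then x i else \<one>\<^bsub>R\<^esub>)"
      using insert by (simp add: coprojection_def)
    also have "\<dots> = pure (\<lambda>i. (if i = j then x j else \<one>\<^bsub>R\<^esub>) \<otimes>\<^bsub>R\<^esub> (if i \<in> P then x i else \<one>\<^bsub>R\<^esub>))"
      using x insert.prems by (intro pure_mult) auto
    also have "\<dots> = pure (\<lambda>i. if i \<in> insert j P then x i else \<one>\<^bsub>R\<^esub>)"
      using x insert by (intro pure_cong) auto
    finally show ?case .
  qed
  from this[of "{1..n}"] show ?thesis using pure_cong[of "\<lambda>i. if i \<in> {1..n} then x i else \<one>\<^bsub>R\<^esub>" x] by simp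
qed

text \<open>Slot \<open>i\<close> of the image is filled from the slot that \<rho> sends to
  \<open>i\<close>, so the entry \<open>x\<close> lands in slot \<open>\<rho> p\<close>.\<close>

lemma permute_coprojection:
  assumes r: "\<rho> permutes {1..n}" and p: "p \<in> {1..n}" and x: "x \<in> carrier R"
  shows "permute_factors \<rho> (\<phi> p x) = \<phi> (\<rho> p) x"
proof -
  let ?x = "\<lambda>p i. if i = p then x else \<one>\<^bsub>R\<^esub>"
  have m: "single (restrict (?x p) {1..n}) \<one>\<^bsub>A\<^esub> \<in> carrier F"
    using x one_R by (intro single_mem restrict_mem one_A) auto
  have "restrict (?x p) {1..n} \<circ> inv_into UNIV \<rho> = restrict (?x (\<rho> p)) {1..n}"
    using permutes_inv_eq[OF r] permutes_in_image[OF permutes_inv[OF r]] by (auto simp: fun_eq_iff restrict_def)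
  thus ?thesis
    unfolding coprojection_def pure_tensor_def permute_coset[OF r m] perm_single[OF r] by simp
qed

text \<open>With slots as rows and the index of \<open>x\<close> as column, the term of \<rho> has
  the entries at \<open>i\<close> and \<open>\<rho> i\<close>, so the two sums match without
  inverting \<rho>.\<close>

lemma alternating_tensor_eq_det:
  assumes x: "\<And>i. i \<in> {1..n} \<Longrightarrow> x i \<in> carrier R"
  shows "alternating_tensor A R n x = ring_det T n (\<lambda>p i. \<phi> p (x i))"
  unfolding alternating_tensor_def ring_det_def
proof (intro q.S.finsum_cong')
  fix \<rho> assume "\<rho> \<in> {\<rho>. \<rho> permutes {1..n}}"
  hence "(\<Otimes>\<^bsub>T\<^esub>i\<in>{1..n}. \<phi> i (x (\<rho> i))) = pure (\<lambda>i. x (\<rho> i))"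
    using x permutes_in_image[of \<rho>] by (intro pure_eq_finprod) blast
  thus "[sign \<rho>] \<cdot>\<^bsub>T\<^esub> pure (\<lambda>i. x (\<rho> i)) = [sign \<rho>] \<cdot>\<^bsub>T\<^esub> (\<Otimes>\<^bsub>T\<^esub>i\<in>{1..n}. \<phi> i (x (\<rho> i)))" by simp
next
  have "(\<Otimes>\<^bsub>T\<^esub>i\<in>{1..n}. \<phi> i (x (\<rho> i))) \<in> carrier T" if "\<rho> permutes {1..n}" for \<rho>
    using x coprojection_closed that by (intro q.S.det_term_closed[of n "\<lambda>p i. \<phi> p (x i)"]) auto
  thus "(\<lambda>\<rho>. [sign \<rho>] \<cdot>\<^bsub>T\<^esub> (\<Otimes>\<^bsub>T\<^esub>i\<in>{1..n}. \<phi> i (x (\<rho> i)))) \<in> {\<rho>. \<rho> permutes {1..n}} \<rightarrow> carrier T" by auto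
qed simp

lemma symmetric_action_tensor_power:
  assumes "n \<ge> 1" and x: "\<And>i. i \<in> {1..n} \<Longrightarrow> x i \<in> carrier R"
  shows "symmetric_action T n permute_factors (\<lambda>p i. \<phi> p (x i))"
proof (intro symmetric_action.intro symmetric_action_axioms.intro q.S.cring_axioms)
  show "permute_factors id t = t" for t by (rule permute_factors_id)
  show "permute_factors (\<rho> \<circ> \<tau>) t = permute_factors \<rho> (permute_factors \<tau> t)" for \<rho> \<tau> t
    by (rule permute_factors_comp)
qed (use assms permute_factors_hom coprojection_closed permute_coprojection in auto)

end

theorem proposition3p5:
  fixes A :: "('a, 'k) ring_scheme" and R :: "('a, 'r, 'l) module_scheme"
    and n :: nat and x :: "nat \<Rightarrow> 'r"
  assumes "algebra A R" and "n \<ge> 1" and "\<And>i. i \<in> {1..n} \<Longrightarrow> x i \<in> carrier R"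
  shows "is_module_basis (loc_base A R n x) (loc_ext A R n x) (loc_ext_map A R n x)
           n (loc_ext_basis A R n x)
       \<and> discriminant (loc_base A R n x) (loc_ext A R n x) (loc_ext_map A R n x)
           n (loc_ext_basis A R n x)
         = to_loc (TS A R n) (alternating_tensor_sq A R n x) (alternating_tensor_sq A R n x)
       \<and> etale TYPE('c) (loc_base A R n x) (loc_ext A R n x) (loc_ext_map A R n x)"
proof -
  interpret tensor_algebra A R n
    using assms(1) by (rule tensor_algebra.intro)
  let ?y = "\<lambda>p i. coprojection A R n p (x i)"
  interpret sym: symmetric_action T n permute_factors ?y
    using assms(2,3) by (rule symmetric_action_tensor_power)
  have "alternating_tensor A R n x = sym.\<alpha>"
    using assms(3) by (rule alternating_tensor_eq_det)
  hence "alternating_tensor_sq A R n x = sym.disc"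
    unfolding alternating_tensor_sq_def sym.disc_def using sym.alpha_closed by (simp add: numeral_2_eq_2)
  \<comment> \<open>The invariance conditions unfold to \<open>fixed {1..n}\<close> and
    \<open>fixed {1..n - 1}\<close>, so these are equalities of records and nothing has to be
    transported along an isomorphism.\<close>
  moreover have "TS A R n = sym.B0" "TS1 A R n = sym.E0"
    unfolding TS_def TS1_def tensor_invariants_def sym.fixed_def by (rule refl)+
  moreover have "loc_ext_basis A R n x = (\<lambda>i. to_loc (TS1 A R n) (alternating_tensor_sq A R n x) (?y n i))"
    unfolding loc_ext_basis_def by (rule refl)
  ultimately show ?thesis
    using sym.basis_discriminant_etale unfolding loc_base_def loc_ext_def loc_ext_map_def by (simp only:)
qed

end
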